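(* Every orthogonal, left-finite TRS is infinitarily confluent w.r.t. strong $p$-convergence: if $t$ strongly $p$-converges to $s_1$ and $t$ strongly $p$-converges to $s_2$, then there is $t'$ such that $s_1$ strongly $p$-converges to $t'$ and $s_2$ strongly $p$-converges to $t'$.
   Context: Orthogonal = left-linear and non-overlapping; left-finite = all left-hand sides finite. Terms are partial terms over $\Sigma_\bot=\Sigma\uplus\{\bot\}$, ordered by $\le_\bot$ ($s\le_\bot t$ iff $s$ is $t$ with some subterms replaced by $\bot$), a complete semilattice; $\liminf_{\iota\to\alpha}a_\iota=\bigvee_{\beta<\alpha}\bigwedge_{\beta\le\iota<\alpha}a_\iota$. A transfinite reduction $(t_\iota\to_{\pi_\iota}t_{\iota+1})_{\iota<\alpha}$ with contexts $c_\iota$ ($t_\iota$ with position $\pi_\iota$ replaced by $\bot$) strongly $p$-converges to $t$ if $\liminf_{\iota\to\lambda}c_\iota=t_\lambda$ for every limit $\lambda<\alpha$, and $t$ is the last term if the reduction is closed, resp. $t=\liminf_{\iota\to\alpha}c_\iota$ if it is open; the empty reduction converges from $t$ to $t$. *)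

theory Defs
  imports Main
begin

text \<open>Possibly infinite terms over a signature with function symbols 'f, variables 'v
  and the extra constant Bot (the symbol bottom). The arity of a function symbol
  occurrence is the length of its argument list.\<close>

codatatype ('f, 'v) pterm = PVar 'v | Bot | PFun 'f "('f, 'v) pterm list"

type_synonym pos = "nat list"

fun subt_at :: "('f, 'v) pterm \<Rightarrow> pos \<Rightarrow> ('f, 'v) pterm option" where
  "subt_at t [] = Some t"
| "subt_at (PFun f ts) (i # p) = (if i < length ts then subt_at (ts ! i) p else None)"
| "subt_at (PVar x) (i # p) = None"
| "subt_at Bot (i # p) = None"

definition poss :: "('f, 'v) pterm \<Rightarrow> pos set" where
  "poss t = {p. subt_at t p \<noteq> None}"

fun replace_at :: "('f, 'v) pterm \<Rightarrow> pos \<Rightarrow> ('f, 'v) pterm \<Rightarrow> ('f, 'v) pterm" where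
  "replace_at t [] s = s"
| "replace_at (PFun f ts) (i # p) s =
     (if i < length ts then PFun f (ts[i := replace_at (ts ! i) p s]) else PFun f ts)"
| "replace_at (PVar x) (i # p) s = PVar x"
| "replace_at Bot (i # p) s = Bot"

primcorec subst :: "('v \<Rightarrow> ('f, 'v) pterm) \<Rightarrow> ('f, 'v) pterm \<Rightarrow> ('f, 'v) pterm" where
  "subst \<sigma> t = (case t of PVar x \<Rightarrow> \<sigma> x | Bot \<Rightarrow> Bot | PFun f ts \<Rightarrow> PFun f (map (subst \<sigma>) ts))"

lemma subst_simps_check:
  "subst \<sigma> (PVar x) = \<sigma> x" "subst \<sigma> Bot = Bot"
  "subst \<sigma> (PFun f ts) = PFun f (map (subst \<sigma>) ts)"
  by (subst subst.code; simp)+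

coinductive le_bot :: "('f, 'v) pterm \<Rightarrow> ('f, 'v) pterm \<Rightarrow> bool" where
  le_bot_Bot: "le_bot Bot t"
| le_bot_Var: "le_bot (PVar x) (PVar x)"
| le_bot_Fun: "list_all2 le_bot ss ts \<Longrightarrow> le_bot (PFun f ss) (PFun f ts)"
  monos list.rel_mono

definition is_glb :: "('f, 'v) pterm set \<Rightarrow> ('f, 'v) pterm \<Rightarrow> bool" where
  "is_glb S m \<longleftrightarrow> (\<forall>s\<in>S. le_bot m s) \<and> (\<forall>m'. (\<forall>s\<in>S. le_bot m' s) \<longrightarrow> le_bot m' m)"

definition is_lub :: "('f, 'v) pterm set \<Rightarrow> ('f, 'v) pterm \<Rightarrow> bool" where
  "is_lub S m \<longleftrightarrow> (\<forall>s\<in>S. le_bot s m) \<and> (\<forall>m'. (\<forall>s\<in>S. le_bot s m') \<longrightarrow> le_bot m m')"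

definition glb :: "('f, 'v) pterm set \<Rightarrow> ('f, 'v) pterm" where
  "glb S = (THE m. is_glb S m)"

definition lub :: "('f, 'v) pterm set \<Rightarrow> ('f, 'v) pterm" where
  "lub S = (THE m. is_lub S m)"

definition liminf_bot :: "'i rel \<Rightarrow> 'i set \<Rightarrow> ('i \<Rightarrow> ('f, 'v) pterm) \<Rightarrow> ('f, 'v) pterm" where
  "liminf_bot r J c = lub {glb (c ` {i \<in> J. (b, i) \<in> r}) | b. b \<in> J}"

type_synonym ('f, 'v) rule = "('f, 'v) pterm \<times> ('f, 'v) pterm"
type_synonym ('f, 'v) trs = "('f, 'v) rule set"

definition total :: "('f, 'v) pterm \<Rightarrow> bool" where
  "total t \<longleftrightarrow> (\<forall>p. subt_at t p \<noteq> Some Bot)"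

inductive finite_term :: "('f, 'v) pterm \<Rightarrow> bool" where
  "finite_term (PVar x)"
| "finite_term Bot"
| "(\<And>u. u \<in> set ts \<Longrightarrow> finite_term u) \<Longrightarrow> finite_term (PFun f ts)"

definition is_var :: "('f, 'v) pterm \<Rightarrow> bool" where
  "is_var t \<longleftrightarrow> (\<exists>x. t = PVar x)"

definition linear_term :: "('f, 'v) pterm \<Rightarrow> bool" where
  "linear_term t \<longleftrightarrow> (\<forall>p q x. subt_at t p = Some (PVar x) \<and> subt_at t q = Some (PVar x) \<longrightarrow> p = q)"

definition trs :: "('f, 'v) trs \<Rightarrow> bool" where
  "trs R \<longleftrightarrow> (\<forall>(l, r) \<in> R. total l \<and> total r \<and> \<not> is_var l \<and> set2_pterm r \<subseteq> set2_pterm l)"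

definition left_finite :: "('f, 'v) trs \<Rightarrow> bool" where
  "left_finite R \<longleftrightarrow> (\<forall>(l, r) \<in> R. finite_term l)"

definition left_linear :: "('f, 'v) trs \<Rightarrow> bool" where
  "left_linear R \<longleftrightarrow> (\<forall>(l, r) \<in> R. linear_term l)"

text \<open>Non-overlapping: a non-variable subterm of a left-hand side l1 at position p never
  unifies with a left-hand side l2 (of a rule renamed apart, modelled by independent
  substitutions), except for the trivial overlap of a rule with itself at the root.\<close>
definition non_overlapping :: "('f, 'v) trs \<Rightarrow> bool" where
  "non_overlapping R \<longleftrightarrow>
    (\<forall>\<rho>1 \<in> R. \<forall>\<rho>2 \<in> R. \<forall>p u \<sigma> \<tau>.
       subt_at (fst \<rho>1) p = Some u \<and> \<not> is_var u \<and> subst \<sigma> u = subst \<tau> (fst \<rho>2)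
       \<longrightarrow> p = [] \<and> \<rho>1 = \<rho>2)"

definition orthogonal :: "('f, 'v) trs \<Rightarrow> bool" where
  "orthogonal R \<longleftrightarrow> left_linear R \<and> non_overlapping R"

definition rstep :: "('f, 'v) trs \<Rightarrow> ('f, 'v) pterm \<Rightarrow> pos \<Rightarrow> ('f, 'v) pterm \<Rightarrow> bool" where
  "rstep R t p t' \<longleftrightarrow>
    (\<exists>(l, r) \<in> R. \<exists>\<sigma>. subt_at t p = Some (subst \<sigma> l) \<and> t' = replace_at t p (subst \<sigma> r))"

text \<open>A transfinite reduction of length alpha is given by a (reflexive) well-order r whose
  field I is order-isomorphic to alpha (I is the set of step indices iota < alpha),
  the terms ts i (= t_iota) and the positions ps i (= pi_iota) for i in I.
  strongly_p_conv R r ts ps t s says: this reduction starts in t and strongly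
  p-converges to s.\<close>
definition strongly_p_conv ::
  "('f, 'v) trs \<Rightarrow> 'i rel \<Rightarrow> ('i \<Rightarrow> ('f, 'v) pterm) \<Rightarrow> ('i \<Rightarrow> pos)
     \<Rightarrow> ('f, 'v) pterm \<Rightarrow> ('f, 'v) pterm \<Rightarrow> bool" where
  "strongly_p_conv R r ts ps t s \<longleftrightarrow>
    Well_order r \<and>
    (let I = Field r;
         lt = (\<lambda>a b. (a, b) \<in> r \<and> a \<noteq> b);
         c = (\<lambda>i. replace_at (ts i) (ps i) Bot)
     in
       \<comment> \<open>empty reduction\<close>
       (I = {} \<longrightarrow> s = t) \<and>
       \<comment> \<open>the first term is t\<close>
       (\<forall>i \<in> I. (\<forall>j \<in> I. (i, j) \<in> r) \<longrightarrow> ts i = t) \<and>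
       \<comment> \<open>steps t_iota ->_{pi_iota} t_{iota+1}\<close>
       (\<forall>i \<in> I. \<forall>j \<in> I. lt i j \<and> \<not> (\<exists>k \<in> I. lt i k \<and> lt k j) \<longrightarrow> rstep R (ts i) (ps i) (ts j)) \<and>
       \<comment> \<open>closed reduction: the last step yields s\<close>
       (\<forall>i \<in> I. (\<forall>j \<in> I. (j, i) \<in> r) \<longrightarrow> rstep R (ts i) (ps i) s) \<and>
       \<comment> \<open>limit ordinals lambda < alpha\<close>
       (\<forall>l \<in> I. (\<exists>i \<in> I. lt i l) \<and> \<not> (\<exists>i \<in> I. lt i l \<and> \<not> (\<exists>k \<in> I. lt i k \<and> lt k l))
          \<longrightarrow> ts l = liminf_bot r {i \<in> I. lt i l} c) \<and>
       \<comment> \<open>open reduction of nonzero length: s is the limit inferior of all contexts\<close>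
       (I \<noteq> {} \<and> \<not> (\<exists>i \<in> I. \<forall>j \<in> I. (j, i) \<in> r) \<longrightarrow> s = liminf_bot r I c))"

end

theory Submission
  imports Defs "HOL-Library.Sublist"
begin

text \<open>
  Call a term root-stable if no reduct of it is a redex or \<open>Bot\<close>, and null if no reduct of it is
  root-stable. Contracting a set of parallel redexes at once is a step relation with the diamond
  property, even for infinite sets of redexes and infinite right-hand sides. Hence a term \<open>t\<close> has a
  well-defined normal form \<open>NF t\<close>: it is \<open>Bot\<close> if \<open>t\<close> is null, and otherwise it has the root symbol
  of any root-stable reduct of \<open>t\<close> and the normal forms of the arguments of this reduct. Confluence
  follows from two facts: every term strongly p-converges to its normal form, by a fair reduction of
  length at most omega, and strong p-convergence from \<open>t\<close> to \<open>s\<close> implies \<open>NF t = NF s\<close>.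

  For the second fact, transfinite induction shows that a strongly p-convergent reduction is an
  instance of a coinductive relation \<open>inf\<close> in which finitely many parallel steps precede all
  reductions below the root. At limits this uses that a term whose reduction contracts the root
  infinitely often is null: a reduction to a root-stable term in \<open>n\<close> parallel steps bounds the number
  of root steps by \<open>n\<close>. Finite reductions to root-stable terms can be projected over \<open>inf\<close>, so that
  \<open>inf\<close> preserves normal forms.
\<close>

subsection \<open>Positions, variables and substitutions\<close>

text \<open>Contracting infinitely many nested collapsing redexes at once has no natural result, so
  arbitrary developments are avoided and only redexes at pairwise parallel positions are contracted
  together. A parallel step projected over another one is again a single parallel step. Reductions
  therefore have a length that projection does not increase, although one step may contract
  infinitely many redexes; this length replaces the number of redexes as induction measure.
  Left-finiteness makes matching inductive: a pattern at the end of an infinitary reduction is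
  already exposed after a finite part of it. It also leaves only finitely many distinct variables in
  a right-hand side, so finite reductions of the substituted terms have a common length bound. The
  two given reductions are never projected over each other. Each is compared with the normal form of
  the common source, and nullness is defined by finite reductions alone, so that it makes sense
  before any limit is formed.\<close>

lemma subt_at_append:
  "subt_at t (p @ q) = (case subt_at t p of None \<Rightarrow> None | Some u \<Rightarrow> subt_at u q)"
  by (induction t p rule: subt_at.induct) auto

lemma subt_at_Cons:
  "subt_at t (k # p) = Some u \<longleftrightarrow> (\<exists>f ts. t = PFun f ts \<and> k < length ts \<and> subt_at (ts ! k) p = Some u)"
  by (cases t) auto

lemma var_subt_at: "x \<in> set2_pterm t \<Longrightarrow> \<exists>p. subt_at t p = Some (PVar x)"
proof (induction x t rule: pterm.set_induct(2))
  case (PVar x)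
  have "subt_at (PVar x) [] = Some (PVar x)" by simp
  then show ?case by blast
next
  case (PFun f ts s x)
  then obtain p k where "subt_at s p = Some (PVar x)" "k < length ts" "ts ! k = s"
    by (auto simp: in_set_conv_nth)
  then have "subt_at (PFun f ts) (k # p) = Some (PVar x)" by auto
  then show ?case by blast
qed

lemma linear_term_subt_at:
  assumes "linear_term t" "subt_at t q = Some u"
  shows "linear_term u"
  unfolding linear_term_def
proof (intro allI impI)
  fix p p' x
  assume "subt_at u p = Some (PVar x) \<and> subt_at u p' = Some (PVar x)"
  then have "subt_at t (q @ p) = Some (PVar x)" "subt_at t (q @ p') = Some (PVar x)"
    using assms(2) by (auto simp: subt_at_append)
  then show "p = p'"
    using assms(1) unfolding linear_term_def by (metis same_append_eq)
qed

lemma finite_term_subt_at: "finite_term t \<Longrightarrow> subt_at t q = Some u \<Longrightarrow> finite_term u"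
proof (induction t q rule: subt_at.induct)
  case (2 f ts i p)
  then show ?case
    by (metis finite_term.simps nth_mem option.distinct(1) pterm.distinct(3,5) pterm.inject(2) subt_at.simps(2))
qed auto

lemma finite_vars: "finite_term t \<Longrightarrow> finite (set2_pterm t)"
  by (induction t rule: finite_term.induct) auto

text \<open>In a linear term a variable occurs in only one argument, so substitutions found argument
  by argument never conflict. Left-linearity enters the proof in this form.\<close>

lemma combine_substs:
  assumes lin: "linear_term (PFun f ps)"
  shows "\<exists>\<sigma>. \<forall>k<length ps. \<forall>x\<in>set2_pterm (ps ! k). \<sigma> x = \<sigma>s k x"
proof -
  have uniq: "k = k'" if k: "k < length ps" "x \<in> set2_pterm (ps ! k)"
    and k': "k' < length ps" "x \<in> set2_pterm (ps ! k')" for k k' x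
  proof -
    obtain p p' where "subt_at (ps ! k) p = Some (PVar x)" "subt_at (ps ! k') p' = Some (PVar x)"
      using var_subt_at k(2) k'(2) by metis
    then have "subt_at (PFun f ps) (k # p) = Some (PVar x)" "subt_at (PFun f ps) (k' # p') = Some (PVar x)"
      using k k' by auto
    then show ?thesis using lin unfolding linear_term_def by blast
  qed
  define \<sigma> where "\<sigma> x = \<sigma>s (SOME k. k < length ps \<and> x \<in> set2_pterm (ps ! k)) x" for x
  have "\<sigma> x = \<sigma>s k x" if "k < length ps" "x \<in> set2_pterm (ps ! k)" for k x
    unfolding \<sigma>_def using that uniq by (metis (mono_tags, lifting) someI_ex)
  then show ?thesis by blast
qed

lemmas subst_simps [simp] = subst_simps_check

lemma subst_cong:
  "(\<forall>x\<in>set2_pterm t. \<sigma> x = \<tau> x) \<Longrightarrow> subst \<sigma> t = subst \<tau> t"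
proof (coinduction arbitrary: t rule: pterm.coinduct_strong)
  case (Eq_pterm t)
  then show ?case by (cases t) (auto simp: list_all2_map1 list_all2_map2 list_all2_same)
qed

lemma subst_eq_onD:
  assumes "subst \<sigma> t = subst \<tau> t" "x \<in> set2_pterm t"
  shows "\<sigma> x = \<tau> x"
  using assms(2,1) by (induction x t rule: pterm.set_induct(2)) auto

subsection \<open>Relations below the root\<close>

text \<open>The relator of one term layer. It is monotone and commutes with composition and
  converse, so that a diagram of relations between arguments lifts to the layer above simply by
  composing relations.\<close>

inductive below :: "(('f, 'v) pterm \<Rightarrow> ('f, 'v) pterm \<Rightarrow> bool) \<Rightarrow> ('f, 'v) pterm \<Rightarrow> ('f, 'v) pterm \<Rightarrow> bool"
  for Q where
  below_Var [intro!]: "below Q (PVar x) (PVar x)"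
| below_Bot [intro!]: "below Q Bot Bot"
| below_Fun [intro!]: "list_all2 Q ts ss \<Longrightarrow> below Q (PFun f ts) (PFun f ss)"

lemma below_mono [mono]:
  "(\<And>x y. Q x y \<longrightarrow> Q' x y) \<Longrightarrow> below Q t s \<longrightarrow> below Q' t s"
  by (auto elim!: below.cases intro: list_all2_mono)

lemma below_weaken: "below Q t s \<Longrightarrow> (\<And>x y. Q x y \<Longrightarrow> Q' x y) \<Longrightarrow> below Q' t s"
  using below_mono[of Q Q'] by blast

inductive_simps below_simps [simp]:
  "below Q (PVar x) s" "below Q Bot s" "below Q (PFun f ts) s"
  "below Q s (PVar x)" "below Q s Bot" "below Q s (PFun f ts)"

lemma below_refl: "(\<And>x. Q x x) \<Longrightarrow> below Q t t"
  by (cases t) (auto intro: list_all2_refl)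

lemma below_OO: "below (A OO B) t s \<longleftrightarrow> (\<exists>u. below A t u \<and> below B u s)"
proof
  assume "below (A OO B) t s"
  then show "\<exists>u. below A t u \<and> below B u s"
  proof cases
    case (below_Fun ts ss f)
    then obtain us where "list_all2 A ts us" "list_all2 B us ss"
      unfolding list.rel_compp by blast
    with below_Fun show ?thesis by blast
  qed auto
next
  assume "\<exists>u. below A t u \<and> below B u s"
  then show "below (A OO B) t s"
    by (auto elim!: below.cases simp: list.rel_compp)
qed

lemma below_OO_I: "below A t u \<Longrightarrow> below B u s \<Longrightarrow> below (A OO B) t s"
  using below_OO by blast

lemma below_conversep: "below (A\<inverse>\<inverse>) t s = below A s t"
  by (auto elim!: below.cases simp: list.rel_conversep)

lemma below_FunI:
  "length ts = length ss \<Longrightarrow> (\<And>k. k < length ts \<Longrightarrow> Q (ts ! k) (ss ! k)) \<Longrightarrow> below Q (PFun f ts) (PFun f ss)"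
  by (auto simp: list_all2_conv_all_nth)

subsection \<open>Parallel reduction\<close>

locale orthogonal_trs =
  fixes R :: "('f, 'v) trs"
  assumes trs_R: "trs R" and orthogonal_R: "orthogonal R" and left_finite_R: "left_finite R"
begin

text \<open>Coinduction admits infinitely many redexes. The root clause leaves the substitution
  unreduced, so contracted redexes are never nested and their residuals after another such step are
  again parallel.\<close>

coinductive par :: "('f, 'v) pterm \<Rightarrow> ('f, 'v) pterm \<Rightarrow> bool" where
  par_below: "below par t s \<Longrightarrow> par t s"
| par_root: "(l, r) \<in> R \<Longrightarrow> par (subst \<sigma> l) (subst \<sigma> r)"

lemma par_refl [simp, intro]: "par t t"
proof (coinduction arbitrary: t)
  case par
  have "below (\<lambda>a b. (\<exists>t. a = t \<and> b = t) \<or> par a b) t t" by (rule below_refl) simp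
  then show ?case by blast
qed

definition redex :: "('f, 'v) pterm \<Rightarrow> bool" where
  "redex t \<longleftrightarrow> (\<exists>l r \<sigma>. (l, r) \<in> R \<and> t = subst \<sigma> l)"

text \<open>What remains of a left-hand side below its root, variables included. Such patterns are
  finite, linear and closed under arguments, and by non-overlap no instance of a nonvariable one is
  a redex. All matching proceeds by induction on them.\<close>

definition subpat :: "('f, 'v) pterm \<Rightarrow> bool" where
  "subpat p \<longleftrightarrow> (\<exists>l r i q. (l, r) \<in> R \<and> subt_at l (i # q) = Some p)"

lemma lhs_Fun:
  assumes "(l, r) \<in> R"
  obtains f ls where "l = PFun f ls"
proof (cases l)
  case Bot
  then have "subt_at l [] = Some Bot" by simp
  then show ?thesis using assms trs_R unfolding trs_def total_def by blast
qed (use assms trs_R in \<open>auto simp: trs_def is_var_def\<close>)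

lemma redexE:
  assumes "redex t"
  obtains f ls r \<sigma> where "(PFun f ls, r) \<in> R" "t = subst \<sigma> (PFun f ls)"
  using assms lhs_Fun unfolding redex_def by metis

lemma vars_rhs: "(l, r) \<in> R \<Longrightarrow> x \<in> set2_pterm r \<Longrightarrow> x \<in> set2_pterm l"
  using trs_R unfolding trs_def by blast

lemma finite_lhs: "(l, r) \<in> R \<Longrightarrow> finite_term l"
  using left_finite_R unfolding left_finite_def by blast

lemma linear_lhs: "(l, r) \<in> R \<Longrightarrow> linear_term l"
  using orthogonal_R unfolding orthogonal_def left_linear_def by blast

lemma finite_vars_rhs: "(l, r) \<in> R \<Longrightarrow> finite (set2_pterm r)"
  by (meson finite_lhs finite_subset finite_vars subsetI vars_rhs)

lemma subpat_finite: "subpat p \<Longrightarrow> finite_term p"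
  unfolding subpat_def using finite_term_subt_at finite_lhs by blast

lemma subpat_linear: "subpat p \<Longrightarrow> linear_term p"
  unfolding subpat_def using linear_term_subt_at linear_lhs by blast

lemma subpat_not_Bot: "\<not> subpat Bot"
proof
  assume "subpat Bot"
  then obtain l r i q where "(l, r) \<in> R" "subt_at l (i # q) = Some Bot"
    unfolding subpat_def by blast
  then show False using trs_R unfolding trs_def total_def by blast
qed

lemma subpat_arg: "subpat (PFun f ps) \<Longrightarrow> k < length ps \<Longrightarrow> subpat (ps ! k)"
proof -
  assume "subpat (PFun f ps)" "k < length ps"
  then obtain l r i q where "(l, r) \<in> R" "subt_at l (i # q) = Some (PFun f ps)"
    unfolding subpat_def by blast
  then have "subt_at l (i # (q @ [k])) = Some (ps ! k)"
    using \<open>k < length ps\<close> subt_at_append[of l "i # q" "[k]"] by simp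
  with \<open>(l, r) \<in> R\<close> show "subpat (ps ! k)" unfolding subpat_def by blast
qed

lemma subpat_lhs_arg: "(PFun f ls, r) \<in> R \<Longrightarrow> k < length ls \<Longrightarrow> subpat (ls ! k)"
proof -
  assume "(PFun f ls, r) \<in> R" "k < length ls"
  moreover from this have "subt_at (PFun f ls) (k # []) = Some (ls ! k)" by simp
  ultimately show "subpat (ls ! k)" unfolding subpat_def by blast
qed

lemma subpat_not_redex: "subpat (PFun f ps) \<Longrightarrow> \<not> redex (subst \<sigma> (PFun f ps))"
proof
  assume "subpat (PFun f ps)" "redex (subst \<sigma> (PFun f ps))"
  then obtain l r i q l' r' \<tau> where *: "(l, r) \<in> R" "subt_at l (i # q) = Some (PFun f ps)"
    "(l', r') \<in> R" "subst \<sigma> (PFun f ps) = subst \<tau> l'"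
    unfolding subpat_def redex_def by blast
  have "\<not> is_var (PFun f ps)" unfolding is_var_def by simp
  then have "i # q = []"
    using * orthogonal_R unfolding orthogonal_def non_overlapping_def by (metis fst_conv)
  then show False by simp
qed

lemma same_rule:
  assumes "(l, r) \<in> R" "(l', r') \<in> R" "subst \<sigma> l = subst \<tau> l'"
  shows "l = l' \<and> r = r'"
proof -
  have "subt_at (fst (l, r)) [] = Some l" "\<not> is_var l"
    using assms(1) trs_R unfolding trs_def by auto
  then have "(l, r) = (l', r')"
    using assms orthogonal_R unfolding orthogonal_def non_overlapping_def by (metis fst_conv)
  then show ?thesis by simp
qed

lemma same_contractum:
  assumes "(l, r) \<in> R" "(l', r') \<in> R" "subst \<sigma> l = subst \<tau> l'"
  shows "subst \<sigma> r = subst \<tau> r'"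
  using assms same_rule[OF assms] subst_eq_onD vars_rhs by (metis subst_cong)

lemma par_cases:
  assumes "par t s"
  obtains (below) "below par t s" | (root) l r \<sigma> where "(l, r) \<in> R" "t = subst \<sigma> l" "s = subst \<sigma> r"
  using assms by cases auto

lemma redex_not_Bot: "\<not> redex Bot" "\<not> redex (PVar x)"
  by (auto elim!: redexE)

lemma par_not_redex: "par t s \<Longrightarrow> \<not> redex t \<Longrightarrow> below par t s"
  by (auto elim!: par_cases simp: redex_def)

lemma par_subst: "(\<forall>x\<in>set2_pterm t. par (\<sigma> x) (\<tau> x)) \<Longrightarrow> par (subst \<sigma> t) (subst \<tau> t)"
proof (coinduction arbitrary: t)
  case (par t)
  show ?case
  proof (cases t)
    case (PVar x)
    then have "par (subst \<sigma> t) (subst \<tau> t)" using par by simp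
    then show ?thesis by cases (auto elim: below_weaken)
  next
    case Bot
    then show ?thesis by simp
  next
    case (PFun f ts)
    then show ?thesis using par
      by (auto simp: list_all2_map1 list_all2_map2 intro!: list.rel_refl_strong)
  qed
qed

text \<open>No redex of an instance of a left-hand side overlaps the pattern, so parallel steps below
  the root happen inside the substitution.\<close>

lemma par_subpat:
  assumes "finite_term p" "subpat p" "par (subst \<sigma> p) s"
  shows "\<exists>\<tau>. s = subst \<tau> p \<and> (\<forall>x\<in>set2_pterm p. par (\<sigma> x) (\<tau> x))"
  using assms
proof (induction p arbitrary: s rule: finite_term.induct)
  case (1 x)
  then show ?case by (intro exI[of _ "\<lambda>_. s"]) simp
next
  case 2
  then show ?case using subpat_not_Bot by blast
next
  case (3 ps f)
  then have "below par (subst \<sigma> (PFun f ps)) s" using par_not_redex subpat_not_redex by blast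
  then obtain ss where s: "s = PFun f ss" "length ss = length ps"
    and ss: "\<And>k. k < length ps \<Longrightarrow> par (subst \<sigma> (ps ! k)) (ss ! k)"
    by (auto simp: list_all2_conv_all_nth)
  have "\<forall>k<length ps. \<exists>\<tau>. ss ! k = subst \<tau> (ps ! k) \<and> (\<forall>x\<in>set2_pterm (ps ! k). par (\<sigma> x) (\<tau> x))"
    using 3 ss subpat_arg by (metis nth_mem)
  then obtain \<tau>s where \<tau>s: "\<forall>k<length ps. ss ! k = subst (\<tau>s k) (ps ! k) \<and>
      (\<forall>x\<in>set2_pterm (ps ! k). par (\<sigma> x) (\<tau>s k x))" by metis
  obtain \<tau> where \<tau>: "\<forall>k<length ps. \<forall>x\<in>set2_pterm (ps ! k). \<tau> x = \<tau>s k x"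
    using combine_substs[OF subpat_linear[OF 3(3)], of \<tau>s] by blast
  have "ss ! k = subst \<tau> (ps ! k)" if "k < length ps" for k
    using \<tau>s \<tau> that subst_cong[of "ps ! k" \<tau> "\<tau>s k"] by simp
  then have "s = subst \<tau> (PFun f ps)" using s by (auto intro: nth_equalityI)
  moreover have "\<forall>x\<in>set2_pterm (PFun f ps). par (\<sigma> x) (\<tau> x)"
    using \<tau>s \<tau> by (auto simp: in_set_conv_nth)
  ultimately show ?case by blast
qed

text \<open>The root of a left-hand side is kept apart from \<open>subpat\<close> because its
  instances are redexes. \<open>Q\<close> says how the arguments reach their patterns and
  \<open>P\<close> what happens to the variables, so one gluing argument serves parallel steps,
  infinitary reductions, projections and single-step runs.\<close>

lemma lhs_combine:
  assumes "(PFun f ls, r) \<in> R" "length ss = length ls"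
    and "\<And>k. k < length ls \<Longrightarrow> \<exists>\<tau>. Q (ss ! k) (subst \<tau> (ls ! k)) \<and> (\<forall>x\<in>set2_pterm (ls ! k). P x (\<tau> x))"
  shows "\<exists>\<tau>. below Q (PFun f ss) (subst \<tau> (PFun f ls)) \<and> (\<forall>x\<in>set2_pterm (PFun f ls). P x (\<tau> x))"
proof -
  obtain \<tau>s where \<tau>s: "\<forall>k<length ls. Q (ss ! k) (subst (\<tau>s k) (ls ! k)) \<and>
      (\<forall>x\<in>set2_pterm (ls ! k). P x (\<tau>s k x))" using assms(3) by metis
  obtain \<tau> where \<tau>: "\<forall>k<length ls. \<forall>x\<in>set2_pterm (ls ! k). \<tau> x = \<tau>s k x"
    using combine_substs[OF linear_lhs[OF assms(1)], of \<tau>s] by blast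
  have "subst (\<tau>s k) (ls ! k) = subst \<tau> (ls ! k)" if "k < length ls" for k
    using \<tau> that subst_cong[of "ls ! k" \<tau> "\<tau>s k"] by simp
  then have "below Q (PFun f ss) (subst \<tau> (PFun f ls))"
    using \<tau>s assms(2) by (auto simp: list_all2_conv_all_nth)
  moreover have "\<forall>x\<in>set2_pterm (PFun f ls). P x (\<tau> x)"
    using \<tau>s \<tau> by (auto simp: in_set_conv_nth)
  ultimately show ?thesis by blast
qed

lemma par_lhs:
  assumes R: "(l, r) \<in> R" and "below par (subst \<sigma> l) s"
  shows "\<exists>\<tau>. s = subst \<tau> l \<and> (\<forall>x\<in>set2_pterm l. par (\<sigma> x) (\<tau> x))"
proof -
  obtain f ls where l: "l = PFun f ls" using R by (rule lhs_Fun)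
  then obtain ss where s: "s = PFun f ss" "length ss = length ls"
    and ss: "\<And>k. k < length ls \<Longrightarrow> par (subst \<sigma> (ls ! k)) (ss ! k)"
    using assms(2) by (auto simp: list_all2_conv_all_nth)
  have "\<exists>\<tau>. below (=) (PFun f ss) (subst \<tau> (PFun f ls)) \<and> (\<forall>x\<in>set2_pterm (PFun f ls). par (\<sigma> x) (\<tau> x))"
    using R s ss l subpat_lhs_arg subpat_finite
    by (intro lhs_combine[where P = "\<lambda>x y. par (\<sigma> x) y"]) (auto intro!: par_subpat)
  then show ?thesis using s l by (auto simp: list.rel_eq)
qed

subsection \<open>The diamond property\<close>

definition rootstep :: "('f, 'v) pterm \<Rightarrow> ('f, 'v) pterm \<Rightarrow> bool" where
  "rootstep t s \<longleftrightarrow> (\<exists>l r \<sigma>. (l, r) \<in> R \<and> t = subst \<sigma> l \<and> s = subst \<sigma> r)"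

lemma rootstep_par: "rootstep t s \<Longrightarrow> par t s"
  unfolding rootstep_def using par_root by blast

text \<open>A parallel step below the root acts inside the substitution, so the root redex survives
  it. The other side repeats its effect in every copy made by the right-hand side; the copies are at
  parallel positions, so one step suffices. Two root steps must use the same rule.\<close>

lemma rootstep_diamond:
  assumes "rootstep t s" "par t s'"
  shows "\<exists>u. par s u \<and> par s' u"
proof -
  obtain l r \<sigma> where R: "(l, r) \<in> R" and t: "t = subst \<sigma> l" and s: "s = subst \<sigma> r"
    using assms(1) unfolding rootstep_def by blast
  from assms(2) show ?thesis
  proof (cases rule: par_cases)
    case below
    then obtain \<tau> where "s' = subst \<tau> l" "\<forall>x\<in>set2_pterm l. par (\<sigma> x) (\<tau> x)"
      using par_lhs[OF R] t by blast
    then have "par s' (subst \<tau> r)" "par s (subst \<tau> r)"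
      using R s vars_rhs by (auto intro: par_root par_subst)
    then show ?thesis by blast
  next
    case (root l' r' \<tau>)
    then show ?thesis using same_contractum R t s by (metis par_refl)
  qed
qed

end

text \<open>Skeleton of a common reduct of \<open>s\<close> and \<open>s'\<close> over their source
  \<open>t\<close>: where one of the two steps contracts the root, a given common reduct
  \<open>u\<close> is inserted; elsewhere the shared root is copied and corecursion goes on.
  \<open>Bot\<close> is the default for roots that do not match.\<close>

primcorec join :: "(('f, 'v) pterm \<Rightarrow> ('f, 'v) pterm \<Rightarrow> bool) \<Rightarrow> (('f, 'v) pterm \<Rightarrow> ('f, 'v) pterm \<Rightarrow> ('f, 'v) pterm)
    \<Rightarrow> ('f, 'v) pterm \<times> ('f, 'v) pterm \<times> ('f, 'v) pterm \<Rightarrow> ('f, 'v) pterm" where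
  "join rs u x = (if rs (fst x) (fst (snd x)) \<or> rs (fst x) (snd (snd x)) then u (fst (snd x)) (snd (snd x))
     else case fst x of PVar y \<Rightarrow> PVar y | Bot \<Rightarrow> Bot
       | PFun f ts \<Rightarrow> (case fst (snd x) of PVar y \<Rightarrow> Bot | Bot \<Rightarrow> Bot
       | PFun f' ss \<Rightarrow> (case snd (snd x) of PVar y \<Rightarrow> Bot | Bot \<Rightarrow> Bot
       | PFun f'' us \<Rightarrow> PFun f (map (join rs u) (zip ts (zip ss us))))))"

lemma join_root: "rs t s \<or> rs t s' \<Longrightarrow> join rs u (t, s, s') = u s s'"
  by (subst join.code) simp

lemma join_below:
  "\<not> (rs (PVar y) (PVar y)) \<Longrightarrow> join rs u (PVar y, PVar y, PVar y) = PVar y"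
  "\<not> (rs Bot Bot) \<Longrightarrow> join rs u (Bot, Bot, Bot) = Bot"
  "\<not> (rs (PFun f ts) (PFun f ss) \<or> rs (PFun f ts) (PFun f us)) \<Longrightarrow>
    join rs u (PFun f ts, PFun f ss, PFun f us) = PFun f (map (join rs u) (zip ts (zip ss us)))"
  by (subst join.code; simp)+

context orthogonal_trs
begin

definition closing where "closing = join rootstep (\<lambda>s s'. SOME u. par s u \<and> par s' u)"

text \<open>The disjuncts are the two ways in which the coinductions towards \<open>par s\<close>
  and \<open>par s'\<close> continue: leave through a known step, or descend one layer with the
  source hidden in the existential.\<close>

lemma closing_cases:
  assumes "par t s" "par t s'"
  shows "par s (closing (t, s, s')) \<and> par s' (closing (t, s, s')) \<or>
    below (\<lambda>a b. \<exists>t s'. par t a \<and> par t s' \<and> b = closing (t, a, s')) s (closing (t, s, s')) \<and>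
    below (\<lambda>a b. \<exists>t s. par t s \<and> par t a \<and> b = closing (t, s, a)) s' (closing (t, s, s'))"
proof (cases "rootstep t s \<or> rootstep t s'")
  case True
  then have "\<exists>u. par s u \<and> par s' u" using rootstep_diamond assms by blast
  then have "par s (closing (t, s, s')) \<and> par s' (closing (t, s, s'))"
    unfolding closing_def join_root[where rs = rootstep, OF True] by (rule someI_ex)
  then show ?thesis by blast
next
  case False
  then have "below par t s" "below par t s'"
    using assms unfolding rootstep_def by (meson par_cases)+
  then show ?thesis
  proof cases
    case (below_Fun ts ss f)
    then obtain us where us: "s' = PFun f us" "list_all2 par ts us" using \<open>below par t s'\<close> by auto
    have "closing (t, s, s') = PFun f (map closing (zip ts (zip ss us)))"
      unfolding closing_def using join_below(3)[of rootstep f ts ss us] False below_Fun us by simp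
    moreover have "length ts = length ss" "length ss = length us"
      "\<And>i. i < length us \<Longrightarrow> par (ts ! i) (ss ! i) \<and> par (ts ! i) (us ! i)"
      using below_Fun us by (auto simp: list_all2_conv_all_nth)
    moreover from this
    have "below (\<lambda>a b. \<exists>t s'. par t a \<and> par t s' \<and> b = closing (t, a, s')) (PFun f ss) (PFun f (map closing (zip ts (zip ss us))))"
      by (intro below_FunI exI[of _ "ts ! k" for k] exI[of _ "us ! k" for k]) auto
    moreover from calculation
    have "below (\<lambda>a b. \<exists>t s. par t s \<and> par t a \<and> b = closing (t, s, a)) (PFun f us) (PFun f (map closing (zip ts (zip ss us))))"
      by (intro below_FunI exI[of _ "ts ! k" for k] exI[of _ "ss ! k" for k]) auto
    ultimately show ?thesis using below_Fun us by simp
  qed (use False \<open>below par t s'\<close> in \<open>auto simp: closing_def join_below\<close>)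
qed

lemma par_closing1: "\<exists>t s'. par t s \<and> par t s' \<and> u = closing (t, s, s') \<Longrightarrow> par s u"
proof (coinduction arbitrary: s u)
  case (par s u)
  then obtain t s' where "par t s" "par t s'" and u: "u = closing (t, s, s')" by blast
  from closing_cases[OF this(1,2)] show ?case
  proof (elim disjE conjE)
    assume "par s (closing (t, s, s'))"
    then show ?thesis unfolding u by cases (auto elim: below_weaken)
  qed (auto simp: u elim!: below_weaken)
qed

lemma par_closing2: "\<exists>t s. par t s \<and> par t s' \<and> u = closing (t, s, s') \<Longrightarrow> par s' u"
proof (coinduction arbitrary: s' u)
  case (par s' u)
  then obtain t s where "par t s" "par t s'" and u: "u = closing (t, s, s')" by blast
  from closing_cases[OF this(1,2)] show ?case
  proof (elim disjE conjE)
    assume "par s' (closing (t, s, s'))"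
    then show ?thesis unfolding u by cases (auto elim: below_weaken)
  qed (auto simp: u elim!: below_weaken)
qed

theorem par_diamond: "par t s \<Longrightarrow> par t s' \<Longrightarrow> \<exists>u. par s u \<and> par s' u"
  using par_closing1 par_closing2 by blast

subsection \<open>Sequences of parallel steps\<close>

abbreviation pstar :: "('f, 'v) pterm \<Rightarrow> ('f, 'v) pterm \<Rightarrow> bool" where
  "pstar \<equiv> par\<^sup>*\<^sup>*"

lemma relpow_le_pstar: "(par ^^ n) t s \<Longrightarrow> pstar t s"
  by (rule relpowp_imp_rtranclp)

lemma relpow_pad: "(par ^^ m) t s \<Longrightarrow> m \<le> n \<Longrightarrow> (par ^^ n) t s"
proof (induction "n - m" arbitrary: n)
  case (Suc k)
  then obtain n' where n: "n = Suc n'" by (cases n) auto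
  then have "(par ^^ n') t s" using Suc by auto
  then show ?case using n by (metis par_refl relpowp_Suc_I)
qed simp

lemma relpow_strip: "par t a \<Longrightarrow> (par ^^ n) t b \<Longrightarrow> \<exists>z. (par ^^ n) a z \<and> par b z"
proof (induction n arbitrary: b)
  case 0
  then show ?case by auto
next
  case (Suc n)
  then obtain c where c: "(par ^^ n) t c" "par c b" by auto
  then obtain z where "(par ^^ n) a z" "par c z" using Suc by blast
  then show ?case using par_diamond[OF c(2)] by (metis relpowp_Suc_I)
qed

lemma relpow_grid: "(par ^^ m) t a \<Longrightarrow> (par ^^ n) t b \<Longrightarrow> \<exists>z. (par ^^ n) a z \<and> (par ^^ m) b z"
proof (induction m arbitrary: a)
  case 0
  then show ?case by auto
next
  case (Suc m)
  then obtain c where c: "(par ^^ m) t c" "par c a" by auto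
  then obtain z where "(par ^^ n) c z" "(par ^^ m) b z" using Suc by blast
  then show ?case using relpow_strip[OF c(2)] by (metis relpowp_Suc_I)
qed

lemma pstar_grid: "pstar t a \<Longrightarrow> (par ^^ n) t b \<Longrightarrow> \<exists>z. (par ^^ n) a z \<and> pstar b z"
  unfolding rtranclp_power using relpow_grid by blast

lemma pstar_confluent: "pstar t a \<Longrightarrow> pstar t b \<Longrightarrow> \<exists>z. pstar a z \<and> pstar b z"
  unfolding rtranclp_power using relpow_grid by blast

lemma below_relpow: "below (par ^^ n) t s \<Longrightarrow> (par ^^ n) t s"
proof (induction n arbitrary: s)
  case 0
  then have "t = s" by (auto elim!: below.cases simp: list_all2_eq)
  then show ?case by simp
next
  case (Suc n)
  then have "below ((par ^^ n) OO par) t s" by simp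
  then obtain u where "below (par ^^ n) t u" "below par u s" unfolding below_OO by blast
  then show ?case using Suc.IH par_below by (metis relpowp_Suc_I)
qed

text \<open>Argument lists are finite, so the maximum of the step counts serves all arguments;
  shorter reductions are padded with reflexive steps.\<close>

lemma list_pstar_relpow: "list_all2 pstar ts ss \<Longrightarrow> \<exists>n. list_all2 (par ^^ n) ts ss"
proof (induction rule: list_all2_induct)
  case (Cons x xs y ys)
  then obtain n m where "list_all2 (par ^^ n) xs ys" "(par ^^ m) x y"
    unfolding rtranclp_power by blast
  then have "list_all2 (par ^^ max n m) (x # xs) (y # ys)"
    by (auto elim!: relpow_pad list_all2_mono)
  then show ?case by blast
qed simp

lemma below_pstar_relpow: "below pstar t s \<Longrightarrow> \<exists>n. below (par ^^ n) t s"
  by (elim below.cases) (use list_pstar_relpow in blast)+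

lemma below_relpow_pstar: "below (par ^^ n) t s \<Longrightarrow> below pstar t s"
  by (erule below_weaken) (rule relpow_le_pstar)

lemma below_pstar: "below pstar t s \<Longrightarrow> pstar t s"
  using below_pstar_relpow below_relpow relpow_le_pstar by blast

lemma relpow_subst:
  "(\<forall>x\<in>set2_pterm t. (par ^^ n) (\<sigma> x) (\<tau> x)) \<Longrightarrow> (par ^^ n) (subst \<sigma> t) (subst \<tau> t)"
proof (induction n arbitrary: \<tau>)
  case 0
  then show ?case using subst_cong by auto
next
  case (Suc n)
  then have "\<forall>x\<in>set2_pterm t. \<exists>u. (par ^^ n) (\<sigma> x) u \<and> par u (\<tau> x)" by auto
  then obtain \<rho> where \<rho>: "\<forall>x\<in>set2_pterm t. (par ^^ n) (\<sigma> x) (\<rho> x) \<and> par (\<rho> x) (\<tau> x)" by metis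
  then have "(par ^^ n) (subst \<sigma> t) (subst \<rho> t)" "par (subst \<rho> t) (subst \<tau> t)"
    using Suc.IH par_subst by auto
  then show ?case by (metis relpowp_Suc_I)
qed

text \<open>Finitely many variables give a common length, even if the term contains one of them
  infinitely often. For right-hand sides this finiteness is inherited from the left-hand
  side.\<close>

lemma pstar_subst:
  assumes "finite (set2_pterm t)" "\<forall>x\<in>set2_pterm t. pstar (\<sigma> x) (\<tau> x)"
  shows "pstar (subst \<sigma> t) (subst \<tau> t)"
proof -
  obtain n where n: "\<forall>x\<in>set2_pterm t. (par ^^ n x) (\<sigma> x) (\<tau> x)"
    using assms(2) unfolding rtranclp_power by metis
  then have "\<forall>x\<in>set2_pterm t. (par ^^ Max (n ` set2_pterm t)) (\<sigma> x) (\<tau> x)"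
    using assms(1) by (auto elim!: relpow_pad)
  then show ?thesis using relpow_subst relpow_le_pstar by blast
qed

lemma relpow_subpat:
  assumes "subpat p" "(par ^^ n) (subst \<sigma> p) s"
  shows "\<exists>\<tau>. s = subst \<tau> p \<and> (\<forall>x\<in>set2_pterm p. (par ^^ n) (\<sigma> x) (\<tau> x))"
  using assms(2)
proof (induction n arbitrary: s)
  case (Suc n)
  then obtain u where "(par ^^ n) (subst \<sigma> p) u" and us: "par u s" by auto
  then obtain \<tau> where \<tau>: "u = subst \<tau> p" "\<forall>x\<in>set2_pterm p. (par ^^ n) (\<sigma> x) (\<tau> x)"
    using Suc by blast
  then obtain \<tau>' where "s = subst \<tau>' p" "\<forall>x\<in>set2_pterm p. par (\<tau> x) (\<tau>' x)"
    using par_subpat assms(1) us subpat_finite by blast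
  then show ?case using \<tau> by (metis relpowp_Suc_I)
qed auto

lemma pstar_subpat:
  assumes "subpat p" "pstar (subst \<sigma> p) s"
  shows "\<exists>\<tau>. s = subst \<tau> p \<and> (\<forall>x\<in>set2_pterm p. pstar (\<sigma> x) (\<tau> x))"
  using assms relpow_subpat relpow_le_pstar unfolding rtranclp_power by metis

lemma relpow_lhs:
  assumes "(l, r) \<in> R" "below (par ^^ n) (subst \<sigma> l) s"
  shows "\<exists>\<tau>. s = subst \<tau> l \<and> (\<forall>x\<in>set2_pterm l. (par ^^ n) (\<sigma> x) (\<tau> x))"
  using assms(2)
proof (induction n arbitrary: s)
  case 0
  then show ?case using below_relpow[of 0] by auto
next
  case (Suc n)
  then have "below ((par ^^ n) OO par) (subst \<sigma> l) s" by simp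
  then obtain u where "below (par ^^ n) (subst \<sigma> l) u" and us: "below par u s"
    unfolding below_OO by blast
  then obtain \<tau> where \<tau>: "u = subst \<tau> l" "\<forall>x\<in>set2_pterm l. (par ^^ n) (\<sigma> x) (\<tau> x)"
    using Suc by blast
  then obtain \<tau>' where "s = subst \<tau>' l" "\<forall>x\<in>set2_pterm l. par (\<tau> x) (\<tau>' x)"
    using par_lhs assms(1) us by blast
  then show ?case using \<tau> by (metis relpowp_Suc_I)
qed

lemma below_pstar_redex: "below pstar t s \<Longrightarrow> redex t \<Longrightarrow> redex s"
  unfolding redex_def using below_pstar_relpow relpow_lhs by metis

text \<open>Cut at the first root step: \<open>m\<close> steps precede it and
  \<open>n - m - 1\<close> follow. These exact counts make the later inductions on \<open>n\<close>
  decrease.\<close>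

lemma relpow_split:
  "(par ^^ n) t s \<Longrightarrow> below (par ^^ n) t s \<or>
    (\<exists>m<n. \<exists>l r \<rho>. (l, r) \<in> R \<and> below (par ^^ m) t (subst \<rho> l) \<and> (par ^^ (n - m - 1)) (subst \<rho> r) s)"
proof (induction n arbitrary: t)
  case 0
  then show ?case using below_refl[of "par ^^ 0" t] by auto
next
  case (Suc n)
  then obtain u where u: "par t u" "(par ^^ n) u s" by (metis relpowp_Suc_D2)
  from u(1) show ?case
  proof (cases rule: par_cases)
    case below
    from Suc.IH[OF u(2)] show ?thesis
    proof (elim disjE exE conjE)
      assume "below (par ^^ n) u s"
      with below have "below (par OO par ^^ n) t s" by (rule below_OO_I)
      then show ?thesis by (simp add: relpowp_commute)
    next
      fix m l r \<rho>
      assume *: "m < n" "(l, r) \<in> R" "below (par ^^ m) u (subst \<rho> l)"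
        "(par ^^ (n - m - 1)) (subst \<rho> r) s"
      from below *(3) have "below (par OO par ^^ m) t (subst \<rho> l)" by (rule below_OO_I)
      then have "below (par ^^ Suc m) t (subst \<rho> l)" by (simp add: relpowp_commute)
      moreover have "Suc n - Suc m - 1 = n - m - 1" by simp
      ultimately show ?thesis using * by (metis Suc_less_eq)
    qed
  next
    case (root l r \<sigma>)
    moreover have "below (par ^^ 0) t t" by (intro below_refl) simp
    moreover have "Suc n - 0 - 1 = n" by simp
    ultimately show ?thesis using u by (metis zero_less_Suc)
  qed
qed

subsection \<open>Root-stable terms and null terms\<close>

definition rst :: "('f, 'v) pterm \<Rightarrow> bool" where
  "rst t \<longleftrightarrow> (\<forall>s. pstar t s \<longrightarrow> \<not> redex s \<and> s \<noteq> Bot)"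

text \<open>Null terms are those whose root can be contracted forever (or that reduce to \<open>Bot\<close>); they are
  the terms that p-converge to \<open>Bot\<close>.\<close>

definition null :: "('f, 'v) pterm \<Rightarrow> bool" where
  "null t \<longleftrightarrow> \<not> (\<exists>s. pstar t s \<and> rst s)"

lemma rst_not_redex: "rst t \<Longrightarrow> \<not> redex t" "rst t \<Longrightarrow> t \<noteq> Bot"
  unfolding rst_def by auto

lemma rst_pstar: "rst t \<Longrightarrow> pstar t s \<Longrightarrow> rst s"
  unfolding rst_def using rtranclp_trans[of par t s] by blast

lemma rst_relpow_below: "rst t \<Longrightarrow> (par ^^ n) t s \<Longrightarrow> below (par ^^ n) t s"
proof (rule ccontr)
  assume *: "rst t" "(par ^^ n) t s" "\<not> below (par ^^ n) t s"
  then obtain m l r \<rho> where "(l, r) \<in> R" "below (par ^^ m) t (subst \<rho> l)"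
    using relpow_split by blast
  then have "pstar t (subst \<rho> l)" using below_relpow relpow_le_pstar by blast
  moreover have "redex (subst \<rho> l)" unfolding redex_def using \<open>(l, r) \<in> R\<close> by blast
  ultimately show False using *(1) unfolding rst_def by blast
qed

lemma rst_pstar_below: "rst t \<Longrightarrow> pstar t s \<Longrightarrow> below pstar t s"
proof -
  assume "rst t" "pstar t s"
  then obtain n where "(par ^^ n) t s" unfolding rtranclp_power by blast
  then have "below (par ^^ n) t s" using rst_relpow_below \<open>rst t\<close> by blast
  then show "below pstar t s" by (rule below_relpow_pstar)
qed

lemma below_confluent:
  assumes "below pstar t a" "below pstar t b"
  shows "\<exists>z. below pstar a z \<and> below pstar b z"
proof -
  have "below (pstar\<inverse>\<inverse> OO pstar) a b"
    using assms by (intro below_OO_I) (simp_all only: below_conversep)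
  then have "below (pstar OO pstar\<inverse>\<inverse>) a b"
  proof (rule below_weaken)
    fix x y
    assume "(pstar\<inverse>\<inverse> OO pstar) x y"
    then obtain u where "pstar u x" "pstar u y" by blast
    then show "(pstar OO pstar\<inverse>\<inverse>) x y" using pstar_confluent[of u x y] by blast
  qed
  then show ?thesis unfolding below_OO below_conversep .
qed

text \<open>A redex that \<open>t\<close> reaches without earlier root steps survives joining with
  \<open>s\<close> below the root, and would then be a reduct of \<open>s\<close>.\<close>

lemma rst_expand: "below pstar t s \<Longrightarrow> rst s \<Longrightarrow> rst t"
  unfolding rst_def
proof (intro allI impI)
  fix u
  assume ts: "below pstar t s" and s: "\<forall>u. pstar s u \<longrightarrow> \<not> redex u \<and> u \<noteq> Bot" and "pstar t u"
  have no_redex: "\<not> redex v" if tv: "below pstar t v" for v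
  proof
    assume "redex v"
    obtain z where "below pstar s z" "below pstar v z" using below_confluent[OF ts tv] by blast
    then show False using s below_pstar_redex[OF _ \<open>redex v\<close>] below_pstar[of s z] by blast
  qed
  obtain n where "(par ^^ n) t u" using \<open>pstar t u\<close> unfolding rtranclp_power by blast
  from relpow_split[OF this] have "below pstar t u"
  proof (elim disjE exE conjE)
    fix m l r \<rho>
    assume "(l, r) \<in> R" and *: "below (par ^^ m) t (subst \<rho> l)"
    then have "redex (subst \<rho> l)" unfolding redex_def by blast
    moreover have "below pstar t (subst \<rho> l)" using * by (rule below_relpow_pstar)
    ultimately show "below pstar t u" using no_redex by blast
  qed (rule below_relpow_pstar)
  moreover have "u \<noteq> Bot"
  proof
    assume "u = Bot"
    then have "s = Bot" using ts \<open>below pstar t u\<close> by simp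
    then show False using s by blast
  qed
  ultimately show "\<not> redex u \<and> u \<noteq> Bot" using no_redex by blast
qed

text \<open>All reducts are again instances of the pattern. This root-stability is what allows
  \<open>project_rst\<close> to be applied to matched subpatterns.\<close>

lemma subpat_rst: "subpat (PFun f ps) \<Longrightarrow> rst (subst \<sigma> (PFun f ps))"
proof -
  assume sub: "subpat (PFun f ps)"
  have "\<not> redex s \<and> s \<noteq> Bot" if "pstar (subst \<sigma> (PFun f ps)) s" for s
  proof -
    obtain \<tau> where "s = subst \<tau> (PFun f ps)" using pstar_subpat[OF sub \<open>pstar _ s\<close>] by blast
    then show ?thesis using subpat_not_redex[OF sub, of \<tau>] by simp
  qed
  then show ?thesis unfolding rst_def by blast
qed

lemma pstar_Bot: "pstar Bot s \<Longrightarrow> s = Bot"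
proof (induction rule: rtranclp_induct)
  case (step y z)
  then show ?case using par_not_redex redex_not_Bot by fastforce
qed simp

lemma null_Bot: "null Bot"
  unfolding null_def using pstar_Bot rst_not_redex by blast

lemma rst_not_null: "rst t \<Longrightarrow> \<not> null t"
  unfolding null_def by blast

lemma null_pstar_iff: "pstar t s \<Longrightarrow> null t \<longleftrightarrow> null s"
proof -
  assume ts: "pstar t s"
  have "\<exists>v. pstar s v \<and> rst v" if "pstar t u" "rst u" for u
    using pstar_confluent[OF ts that(1)] rst_pstar[OF that(2)] by blast
  moreover have "pstar t u" if "pstar s u" for u
    using ts that by (rule rtranclp_trans)
  ultimately show ?thesis unfolding null_def by blast
qed

subsection \<open>Infinitary reduction, coinductively\<close>

text \<open>This relation turns out to contain every strongly p-convergent reduction: all steps needed to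
  settle the root are done first, in finite number, unless the root is volatile.\<close>

coinductive inf :: "('f, 'v) pterm \<Rightarrow> ('f, 'v) pterm \<Rightarrow> bool" where
  inf_below: "pstar t w \<Longrightarrow> below inf w s \<Longrightarrow> inf t s"
| inf_null: "null t \<Longrightarrow> inf t Bot"

lemma inf_refl: "inf t t"
proof (coinduction arbitrary: t)
  case inf
  have "below (\<lambda>a b. (\<exists>t. a = t \<and> b = t) \<or> inf a b) t t" by (rule below_refl) simp
  then show ?case by blast
qed

lemma pstar_inf: "pstar t s \<Longrightarrow> inf s u \<Longrightarrow> inf t u"
  by (erule inf.cases) (use rtranclp_trans[of par t s] inf_below null_pstar_iff inf_null in \<open>blast+\<close>)

lemma inf_not_Bot: "inf t s \<Longrightarrow> s \<noteq> Bot \<Longrightarrow> \<exists>w. pstar t w \<and> below inf w s"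
  by (auto elim: inf.cases)

lemma inf_BotD: "inf t Bot \<Longrightarrow> null t"
  by (erule inf.cases) (use null_pstar_iff null_Bot in \<open>auto\<close>)

lemma inf_subst: "(\<forall>x\<in>set2_pterm t. inf (\<sigma> x) (\<tau> x)) \<Longrightarrow> inf (subst \<sigma> t) (subst \<tau> t)"
proof (coinduction arbitrary: t)
  case (inf t)
  show ?case
  proof (cases t)
    case (PVar x)
    then have "inf (subst \<sigma> t) (subst \<tau> t)" using inf by simp
    then show ?thesis by cases (auto elim: below_weaken)
  next
    case Bot
    then show ?thesis by (auto simp: null_Bot)
  next
    case (PFun f ts)
    then have "below (\<lambda>a b. (\<exists>t. a = subst \<sigma> t \<and> b = subst \<tau> t \<and> (\<forall>x. x \<in> set2_pterm t \<longrightarrow> inf (\<sigma> x) (\<tau> x))) \<or> inf a b)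
      (subst \<sigma> t) (subst \<tau> t)"
      using inf by (auto simp: list_all2_map1 list_all2_map2 intro!: list.rel_refl_strong)
    then show ?thesis by (intro disjI1 exI conjI) (rule refl, rule refl, rule rtranclp.rtrancl_refl, simp)
  qed
qed

text \<open>A finite pattern has finitely many layers, so finitely many of the finite prefixes in
  \<open>inf\<close> expose it; everything infinitary is left inside the substitution.\<close>

lemma inf_subpat:
  assumes "finite_term p" "subpat p" "inf t (subst \<sigma> p)"
  shows "\<exists>\<tau>. pstar t (subst \<tau> p) \<and> (\<forall>x\<in>set2_pterm p. inf (\<tau> x) (\<sigma> x))"
  using assms
proof (induction p arbitrary: t rule: finite_term.induct)
  case (1 x)
  then show ?case by (intro exI[of _ "\<lambda>_. t"]) simp
next
  case 2
  then show ?case using subpat_not_Bot by blast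
next
  case (3 ps f)
  then obtain w where tw: "pstar t w" and "below inf w (subst \<sigma> (PFun f ps))"
    using inf_not_Bot by (metis pterm.distinct(5) subst_simps(3))
  then obtain ws where w: "w = PFun f ws" "length ws = length ps"
    and ws: "\<And>k. k < length ps \<Longrightarrow> inf (ws ! k) (subst \<sigma> (ps ! k))"
    by (auto simp: list_all2_conv_all_nth)
  have "\<forall>k<length ps. \<exists>\<tau>. pstar (ws ! k) (subst \<tau> (ps ! k)) \<and> (\<forall>x\<in>set2_pterm (ps ! k). inf (\<tau> x) (\<sigma> x))"
    using 3 ws subpat_arg by (metis nth_mem)
  then obtain \<tau>s where \<tau>s: "\<forall>k<length ps. pstar (ws ! k) (subst (\<tau>s k) (ps ! k)) \<and>
      (\<forall>x\<in>set2_pterm (ps ! k). inf (\<tau>s k x) (\<sigma> x))" by metis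
  obtain \<tau> where \<tau>: "\<forall>k<length ps. \<forall>x\<in>set2_pterm (ps ! k). \<tau> x = \<tau>s k x"
    using combine_substs[OF subpat_linear[OF 3(3)], of \<tau>s] by blast
  have "subst (\<tau>s k) (ps ! k) = subst \<tau> (ps ! k)" if "k < length ps" for k
    using \<tau> that subst_cong[of "ps ! k" \<tau> "\<tau>s k"] by simp
  then have "below pstar w (subst \<tau> (PFun f ps))" using w \<tau>s by (auto simp: list_all2_conv_all_nth)
  then have "pstar t (subst \<tau> (PFun f ps))" using tw below_pstar by (meson rtranclp_trans)
  moreover have "\<forall>x\<in>set2_pterm (PFun f ps). inf (\<tau> x) (\<sigma> x)"
    using \<tau>s \<tau> by (auto simp: in_set_conv_nth)
  ultimately show ?case by blast
qed

lemma inf_lhs: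
  assumes R: "(l, r) \<in> R" and "inf t (subst \<sigma> l)"
  shows "\<exists>\<tau>. pstar t (subst \<tau> l) \<and> (\<forall>x\<in>set2_pterm l. inf (\<tau> x) (\<sigma> x))"
proof -
  obtain f ls where l: "l = PFun f ls" using R by (rule lhs_Fun)
  then obtain w where tw: "pstar t w" and "below inf w (subst \<sigma> l)"
    using inf_not_Bot assms(2) by (metis pterm.distinct(5) subst_simps(3))
  then obtain ws where w: "w = PFun f ws" "length ws = length ls"
    and ws: "\<And>k. k < length ls \<Longrightarrow> inf (ws ! k) (subst \<sigma> (ls ! k))"
    using l by (auto simp: list_all2_conv_all_nth)
  have "\<exists>\<tau>. below pstar (PFun f ws) (subst \<tau> (PFun f ls)) \<and> (\<forall>x\<in>set2_pterm (PFun f ls). inf (\<tau> x) (\<sigma> x))"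
    using R ws w l subpat_lhs_arg subpat_finite
    by (intro lhs_combine[where P = "\<lambda>x y. inf y (\<sigma> x)"]) (auto intro!: inf_subpat)
  then show ?thesis using w l tw below_pstar by (meson rtranclp_trans)
qed

lemma inf_redex: "inf t s \<Longrightarrow> redex s \<Longrightarrow> \<exists>u. pstar t u \<and> redex u"
  unfolding redex_def using inf_lhs by metis

text \<open>If the appended step contracts the root, its pattern is exposed after a finite part by
  \<open>inf_lhs\<close>. The rule is applied there, and the remaining infinitary reductions are
  repeated in the right-hand side. The existential premise is the coinduction invariant.\<close>

lemma inf_par: "\<exists>s. inf t s \<and> par s u \<Longrightarrow> inf t u"
proof (coinduction arbitrary: t u)
  case (inf t u)
  then obtain s where ts: "inf t s" and su: "par s u" by blast
  have via: ?case if "inf t u"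
    using that by cases (auto elim: below_weaken)
  from su show ?case
  proof (cases rule: par_cases)
    case below
    show ?thesis
    proof (cases "s = Bot")
      case True
      then show ?thesis using below ts via by simp
    next
      case False
      then obtain w where w: "pstar t w" "below inf w s" using ts inf_not_Bot by blast
      from w(2) below have "below (inf OO par) w u" by (rule below_OO_I)
      then have "below (\<lambda>a b. (\<exists>t u. a = t \<and> b = u \<and> (\<exists>s. inf t s \<and> par s u)) \<or> inf a b) w u"
        by (elim below_weaken) blast
      then show ?thesis using w by blast
    qed
  next
    case (root l r \<sigma>)
    then obtain \<tau> where \<tau>: "pstar t (subst \<tau> l)" "\<forall>x\<in>set2_pterm l. inf (\<tau> x) (\<sigma> x)"
      using inf_lhs ts by blast
    then have "inf (subst \<tau> r) u" using root inf_subst vars_rhs by blast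
    moreover have "pstar t (subst \<tau> r)" using \<tau> par_root root by (meson rtranclp.simps)
    ultimately show ?thesis using pstar_inf via by blast
  qed
qed

lemma inf_pstar: "pstar s u \<Longrightarrow> inf t s \<Longrightarrow> inf t u"
  by (induction rule: rtranclp_induct) (use inf_par in blast)+

subsection \<open>Projecting finite reductions over infinitary ones\<close>

text \<open>The step count \<open>n\<close> survives projection, because parallel steps have the diamond property; it is
  the induction measure in \<open>project_rst\<close>.\<close>

definition K :: "nat \<Rightarrow> ('f, 'v) pterm \<Rightarrow> ('f, 'v) pterm \<Rightarrow> bool" where
  "K n = pstar OO (par ^^ n)\<inverse>\<inverse> OO inf"

lemma K_iff: "K n a b \<longleftrightarrow> (\<exists>\<upsilon> \<zeta>. inf \<upsilon> b \<and> (par ^^ n) \<upsilon> \<zeta> \<and> pstar a \<zeta>)"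
  unfolding K_def by blast

lemma below_K_iff:
  "below (K n) a b \<longleftrightarrow> (\<exists>\<upsilon> \<zeta>. below inf \<upsilon> b \<and> below (par ^^ n) \<upsilon> \<zeta> \<and> below pstar a \<zeta>)"
  unfolding K_def below_OO below_conversep by blast

text \<open>A predicate of its own, because projecting onto a left-hand side needs the statement for
  one fixed count, and inside the induction it is known only for smaller counts.\<close>

definition project_rst :: "nat \<Rightarrow> bool" where
  "project_rst n \<longleftrightarrow> (\<forall>t s z. inf t s \<longrightarrow> (par ^^ n) t z \<longrightarrow> rst z \<longrightarrow> (\<exists>s'. pstar s s' \<and> below (K n) z s'))"

text \<open>Recursion on the pattern at constant \<open>n\<close>: a nonvariable instance is
  root-stable, so \<open>project_rst\<close> yields its root, and \<open>K n\<close> provides for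
  each argument a new \<open>n\<close>-step reduction to an instance of a smaller pattern.\<close>

lemma project_subpat:
  assumes n: "project_rst n"
    and "finite_term p" "subpat p" "inf t s" "(par ^^ n) t (subst \<sigma> p)"
  shows "\<exists>\<tau>. pstar s (subst \<tau> p) \<and> (\<forall>x\<in>set2_pterm p. K n (\<sigma> x) (\<tau> x))"
  using assms(2-)
proof (induction p arbitrary: t s \<sigma> rule: finite_term.induct)
  case (1 x)
  then have "K n (\<sigma> x) s" unfolding K_iff by auto
  then show ?case by (intro exI[of _ "\<lambda>_. s"]) simp
next
  case 2
  then show ?case using subpat_not_Bot by blast
next
  case (3 ps f)
  then obtain s' where ss': "pstar s s'" "below (K n) (subst \<sigma> (PFun f ps)) s'"
    using n subpat_rst unfolding project_rst_def by blast
  then obtain ss where s': "s' = PFun f ss" "length ss = length ps"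
    and ss: "\<And>k. k < length ps \<Longrightarrow> K n (subst \<sigma> (ps ! k)) (ss ! k)"
    by (auto simp: list_all2_conv_all_nth)
  have "\<exists>\<tau>. pstar (ss ! k) (subst \<tau> (ps ! k)) \<and> (\<forall>x\<in>set2_pterm (ps ! k). K n (\<sigma> x) (\<tau> x))"
    if k: "k < length ps" for k
  proof -
    obtain \<upsilon> \<zeta> where *: "inf \<upsilon> (ss ! k)" "(par ^^ n) \<upsilon> \<zeta>" "pstar (subst \<sigma> (ps ! k)) \<zeta>"
      using ss[OF k] unfolding K_iff by blast
    have sub: "subpat (ps ! k)" using subpat_arg 3(3) k by blast
    then obtain \<sigma>' where \<sigma>': "\<zeta> = subst \<sigma>' (ps ! k)" "\<forall>x\<in>set2_pterm (ps ! k). pstar (\<sigma> x) (\<sigma>' x)"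
      using pstar_subpat * by blast
    then obtain \<tau> where \<tau>: "pstar (ss ! k) (subst \<tau> (ps ! k))" "\<forall>x\<in>set2_pterm (ps ! k). K n (\<sigma>' x) (\<tau> x)"
      using 3(2) k sub * by (metis nth_mem)
    then have "\<forall>x\<in>set2_pterm (ps ! k). K n (\<sigma> x) (\<tau> x)"
      using \<sigma>' unfolding K_iff by (meson rtranclp_trans)
    then show ?thesis using \<tau> by blast
  qed
  then obtain \<tau>s where \<tau>s: "\<forall>k<length ps. pstar (ss ! k) (subst (\<tau>s k) (ps ! k)) \<and>
      (\<forall>x\<in>set2_pterm (ps ! k). K n (\<sigma> x) (\<tau>s k x))" by metis
  obtain \<tau> where \<tau>: "\<forall>k<length ps. \<forall>x\<in>set2_pterm (ps ! k). \<tau> x = \<tau>s k x"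
    using combine_substs[OF subpat_linear[OF 3(3)], of \<tau>s] by blast
  have "subst (\<tau>s k) (ps ! k) = subst \<tau> (ps ! k)" if "k < length ps" for k
    using \<tau> that subst_cong[of "ps ! k" \<tau> "\<tau>s k"] by simp
  then have "below pstar s' (subst \<tau> (PFun f ps))" using s' \<tau>s by (auto simp: list_all2_conv_all_nth)
  then have "pstar s (subst \<tau> (PFun f ps))" using ss' below_pstar by (meson rtranclp_trans)
  moreover have "\<forall>x\<in>set2_pterm (PFun f ps). K n (\<sigma> x) (\<tau> x)"
    using \<tau>s \<tau> by (auto simp: in_set_conv_nth)
  ultimately show ?case by blast
qed

lemma project_lhs:
  assumes n: "project_rst n" and R: "(l, r) \<in> R"
    and "below inf w s" "below (par ^^ n) w (subst \<rho> l)"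
  shows "\<exists>\<tau>. pstar s (subst \<tau> l) \<and> (\<forall>x\<in>set2_pterm l. K n (\<rho> x) (\<tau> x))"
proof -
  obtain f ls where l: "l = PFun f ls" using R by (rule lhs_Fun)
  then obtain ws where w: "w = PFun f ws" "length ws = length ls"
    and ws: "\<And>k. k < length ls \<Longrightarrow> (par ^^ n) (ws ! k) (subst \<rho> (ls ! k))"
    using assms(4) by (auto simp: list_all2_conv_all_nth)
  then obtain ss where s: "s = PFun f ss" "length ss = length ls"
    and ss: "\<And>k. k < length ls \<Longrightarrow> inf (ws ! k) (ss ! k)"
    using assms(3) by (auto simp: list_all2_conv_all_nth)
  have "\<exists>\<tau>. below pstar (PFun f ss) (subst \<tau> (PFun f ls)) \<and> (\<forall>x\<in>set2_pterm (PFun f ls). K n (\<rho> x) (\<tau> x))"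
    using R s w l subpat_lhs_arg subpat_finite ws ss
    by (intro lhs_combine[where P = "\<lambda>x y. K n (\<rho> x) y"]) (auto intro!: project_subpat[OF n])
  then show ?thesis using s l below_pstar by blast
qed

text \<open>Without root steps the arguments are related as they stand. Otherwise the part before
  the first root step is projected by the hypothesis for \<open>m\<close>, the projected side
  applies the same rule, and a reduction with fewer steps remains, starting in the instantiated
  right-hand side.\<close>

lemma project_rst: "project_rst n"
proof (induction n rule: less_induct)
  case (less n)
  show ?case unfolding project_rst_def
  proof (intro allI impI)
    fix t s z
    assume ts: "inf t s" and tz: "(par ^^ n) t z" and z: "rst z"
    have "\<not> null t" using tz z relpow_le_pstar unfolding null_def by blast
    then have "s \<noteq> Bot" using ts inf_BotD by blast
    then obtain w where tw: "pstar t w" and ws: "below inf w s" using ts inf_not_Bot by blast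
    \<comment> \<open>The finite prefix of \<open>inf\<close> is removed first; projecting over it
      keeps the count \<open>n\<close>.\<close>
    obtain z1 where wz1: "(par ^^ n) w z1" and zz1: "pstar z z1" using pstar_grid tw tz by blast
    have z1: "rst z1" "below pstar z z1" using rst_pstar rst_pstar_below z zz1 by blast+
    from relpow_split[OF wz1] show "\<exists>s'. pstar s s' \<and> below (K n) z s'"
    proof (elim disjE exE conjE)
      assume "below (par ^^ n) w z1"
      then show ?thesis using ws z1 below_K_iff by blast
    next
      fix m l r \<rho>
      assume m: "m < n" and R: "(l, r) \<in> R" and wl: "below (par ^^ m) w (subst \<rho> l)"
        and rz1: "(par ^^ (n - m - 1)) (subst \<rho> r) z1"
      obtain \<tau> where s\<tau>: "pstar s (subst \<tau> l)" and K: "\<forall>x\<in>set2_pterm l. K m (\<rho> x) (\<tau> x)"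
        using project_lhs[OF less.IH[OF m] R ws wl] by blast
      then obtain \<upsilon> \<zeta> where \<upsilon>: "\<forall>x\<in>set2_pterm l. inf (\<upsilon> x) (\<tau> x) \<and> (par ^^ m) (\<upsilon> x) (\<zeta> x) \<and> pstar (\<rho> x) (\<zeta> x)"
        unfolding K_iff by metis
      then have inf: "inf (subst \<upsilon> r) (subst \<tau> r)" and \<upsilon>\<zeta>: "(par ^^ m) (subst \<upsilon> r) (subst \<zeta> r)"
        and \<rho>\<zeta>: "pstar (subst \<rho> r) (subst \<zeta> r)"
        using R vars_rhs finite_vars_rhs by (auto intro!: inf_subst relpow_subst pstar_subst)
      obtain z2 where "(par ^^ (n - m - 1)) (subst \<zeta> r) z2" and z12: "pstar z1 z2"
        using pstar_grid[OF \<rho>\<zeta> rz1] by blast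
      \<comment> \<open>The root step is used up: the \<open>m\<close> steps inside the
        substitution, repeated in \<open>r\<close>, and the \<open>n - m - 1\<close> later steps add
        up to \<open>n - 1\<close>.\<close>
      then have "(par ^^ (m + (n - m - 1))) (subst \<upsilon> r) z2" using \<upsilon>\<zeta> relpowp_trans by metis
      moreover have "m + (n - m - 1) = n - 1" using m by simp
      ultimately have *: "(par ^^ (n - 1)) (subst \<upsilon> r) z2" by simp
      have z2: "rst z2" "below pstar z z2"
        using z z1 zz1 z12 rst_pstar rst_pstar_below rtranclp_trans[of par z z1 z2] by blast+
      have "project_rst (n - 1)" using less.IH m by simp
      then obtain s' where s': "pstar (subst \<tau> r) s'" "below (K (n - 1)) z2 s'"
        using inf * z2 unfolding project_rst_def by blast
      from z2(2) s'(2) have "below (pstar OO K (n - 1)) z s'" by (rule below_OO_I)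
      then have "below (K n) z s'"
      proof (elim below_weaken)
        fix a b
        assume "(pstar OO K (n - 1)) a b"
        then obtain c \<upsilon> \<zeta> where *: "pstar a c" "inf \<upsilon> b" "(par ^^ (n - 1)) \<upsilon> \<zeta>" "pstar c \<zeta>"
          unfolding K_iff by blast
        then have "(par ^^ n) \<upsilon> \<zeta>" "pstar a \<zeta>"
          using relpow_pad[of "n - 1" \<upsilon> \<zeta> n] rtranclp_trans[of par a c \<zeta>] by simp_all
        then show "K n a b" unfolding K_iff using * by blast
      qed
      moreover have "pstar s s'" using s\<tau> par_root[OF R] s' by (meson rtranclp.simps rtranclp_trans)
      ultimately show ?thesis by blast
    qed
  qed
qed

text \<open>Projection supplies \<open>s'\<close>. It is root-stable because \<upsilon> is: a redex
  reachable from \<open>s'\<close> is an infinitary reduct of \<upsilon>, so \<upsilon> itself would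
  reach a redex in finitely many steps.\<close>

lemma inf_rst:
  assumes "inf t s" "pstar t z" "rst z"
  shows "\<exists>s' \<upsilon> \<zeta>. pstar s s' \<and> rst s' \<and> below inf \<upsilon> s' \<and> below pstar \<upsilon> \<zeta> \<and> below pstar z \<zeta>"
proof -
  obtain n where n: "(par ^^ n) t z" using assms(2) unfolding rtranclp_power by blast
  then obtain s' where s': "pstar s s'" "below (K n) z s'"
    using project_rst assms unfolding project_rst_def by blast
  then obtain \<upsilon> \<zeta> where *: "below inf \<upsilon> s'" "below (par ^^ n) \<upsilon> \<zeta>" "below pstar z \<zeta>"
    unfolding below_K_iff by blast
  from *(2) have \<upsilon>\<zeta>: "below pstar \<upsilon> \<zeta>" by (rule below_relpow_pstar)
  have "rst \<zeta>" using assms(3) * below_pstar rst_pstar by blast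
  then have \<upsilon>: "rst \<upsilon>" using \<upsilon>\<zeta> rst_expand by blast
  have "\<not> redex u \<and> u \<noteq> Bot" if "pstar s' u" for u
  proof -
    have "inf \<upsilon> u" using *(1) that inf_pstar inf_below by blast
    then show ?thesis using \<upsilon> inf_redex inf_BotD rst_not_null unfolding rst_def by blast
  qed
  then have "rst s'" unfolding rst_def by blast
  then show ?thesis using s' * \<upsilon>\<zeta> by blast
qed

section \<open>Nullness along infinitary reductions, and transitivity\<close>

lemma null_reaches:
  assumes "null w" "w \<noteq> Bot"
  obtains m l r \<rho> where "(l, r) \<in> R" "below (par ^^ m) w (subst \<rho> l)"
proof -
  have "\<not> rst w" using assms rst_not_null by blast
  then obtain u where u: "pstar w u" "redex u \<or> u = Bot" unfolding rst_def by blast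
  then obtain n where "(par ^^ n) w u" unfolding rtranclp_power by blast
  from relpow_split[OF this] show thesis
  proof (elim disjE exE conjE)
    assume *: "below (par ^^ n) w u"
    then have "redex u" using u(2) assms by auto
    then show thesis using that * unfolding redex_def by blast
  qed (use that in blast)
qed

text \<open>Root-stable reducts pass from \<open>t\<close> to \<open>s\<close> by projection.
  Conversely, a null \<open>w\<close> other than \<open>Bot\<close> reaches a redex without root
  steps; projecting this over the arguments would make the root-stable \<open>s'\<close> reach a
  redex.\<close>

lemma null_inf_iff:
  assumes "inf t s"
  shows "null t \<longleftrightarrow> null s"
proof
  assume "null s"
  show "null t"
  proof (rule ccontr)
    assume "\<not> null t"
    then obtain z where "pstar t z" "rst z" unfolding null_def by blast
    then show False using inf_rst[OF assms] \<open>null s\<close> unfolding null_def by blast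
  qed
next
  assume t: "null t"
  show "null s"
  proof (rule ccontr)
    assume "\<not> null s"
    then obtain s' where s': "pstar s s'" "rst s'" unfolding null_def by blast
    then have "inf t s'" using assms inf_pstar by blast
    then obtain w where w: "pstar t w" "below inf w s'"
      using inf_not_Bot s' rst_not_redex by blast
    then have "null w" "w \<noteq> Bot" using t null_pstar_iff s' rst_not_redex by auto
    then obtain m l r \<rho> where "(l, r) \<in> R" "below (par ^^ m) w (subst \<rho> l)"
      by (rule null_reaches)
    then obtain \<tau> where "pstar s' (subst \<tau> l)" using project_lhs project_rst w by blast
    then show False using s'(2) \<open>(l, r) \<in> R\<close> unfolding rst_def redex_def by blast
  qed
qed

text \<open>The finite prefix of the second reduction is absorbed into the first by
  \<open>inf_pstar\<close>, after which both compose below the root. A final \<open>Bot\<close>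
  requires that nullness is reflected along \<open>inf\<close>.\<close>

lemma inf_trans: "\<exists>s. inf t s \<and> inf s u \<Longrightarrow> inf t u"
proof (coinduction arbitrary: t u)
  case (inf t u)
  then obtain s where ts: "inf t s" and su: "inf s u" by blast
  show ?case
  proof (cases "u = Bot")
    case True
    then have "null t" using inf_BotD su null_inf_iff ts by blast
    then show ?thesis using True by blast
  next
    case False
    then obtain w where w: "pstar s w" "below inf w u" using su inf_not_Bot by blast
    then have "inf t w" using ts inf_pstar by blast
    moreover have "w \<noteq> Bot" using w False by auto
    ultimately obtain v where v: "pstar t v" "below inf v w" using inf_not_Bot by blast
    from v(2) w(2) have "below (inf OO inf) v u" by (rule below_OO_I)
    then have "below (\<lambda>a b. (\<exists>t u. a = t \<and> b = u \<and> (\<exists>s. inf t s \<and> inf s u)) \<or> inf a b) v u"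
      by (elim below_weaken) blast
    then show ?thesis using v by blast
  qed
qed

end

subsection \<open>The normal form\<close>

text \<open>\<open>nl\<close> and \<open>h\<close> stand for nullness and a chosen root-stable
  reduct. Such a reduct is never \<open>Bot\<close>, so \<open>Bot\<close> arises from
  \<open>nl\<close> alone.\<close>

primcorec norm :: "(('f, 'v) pterm \<Rightarrow> bool) \<Rightarrow> (('f, 'v) pterm \<Rightarrow> ('f, 'v) pterm) \<Rightarrow> ('f, 'v) pterm \<Rightarrow> ('f, 'v) pterm" where
  "norm nl h t = (if nl t then Bot else case h t of PVar x \<Rightarrow> PVar x | Bot \<Rightarrow> Bot
     | PFun f ts \<Rightarrow> PFun f (map (norm nl h) ts))"

context orthogonal_trs
begin

definition hnf :: "('f, 'v) pterm \<Rightarrow> ('f, 'v) pterm" where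
  "hnf t = (SOME s. pstar t s \<and> rst s)"

definition NF :: "('f, 'v) pterm \<Rightarrow> ('f, 'v) pterm" where
  "NF = norm null hnf"

lemma hnf: "\<not> null t \<Longrightarrow> pstar t (hnf t) \<and> rst (hnf t)"
  unfolding null_def hnf_def by (metis (mono_tags, lifting) someI_ex)

lemma NF_null: "null t \<Longrightarrow> NF t = Bot"
  unfolding NF_def by (subst norm.code) simp

lemma NF_hnf: "\<not> null t \<Longrightarrow> below (\<lambda>a b. b = NF a) (hnf t) (NF t)"
  unfolding NF_def
  by (subst norm.code, cases "hnf t") (auto simp: list_all2_map2 list_all2_same)

text \<open>The zigzag in the premise is a bisimulation: it contains \<open>pstar\<close> and
  \<open>inf\<close>, and it passes from two nonnull terms to the arguments of whatever root-stable
  reducts \<open>hnf\<close> has chosen for them.\<close>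

lemma NF_eq:
  assumes "\<exists>u v y. pstar t v \<and> pstar u v \<and> inf u y \<and> pstar s y"
  shows "NF t = NF s"
  using assms
proof (coinduction arbitrary: t s rule: pterm.coinduct_strong)
  case (Eq_pterm t s)
  then obtain u v y where *: "pstar t v" "pstar u v" "inf u y" "pstar s y" by blast
  then have null: "null t \<longleftrightarrow> null s" using null_pstar_iff null_inf_iff by blast
  show ?case
  proof (cases "null t")
    case True
    then show ?thesis using null NF_null by simp
  next
    case False
    let ?E = "\<lambda>t s. \<exists>u v y. pstar t v \<and> pstar u v \<and> inf u y \<and> pstar s y"
    have t: "pstar t (hnf t)" "rst (hnf t)" and s: "pstar s (hnf s)" "rst (hnf s)"
      using hnf False null by blast+
    obtain z where z: "pstar (hnf t) z" "pstar v z" using pstar_confluent *(1) t by blast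
    then have rz: "rst z" "pstar u z" using t rst_pstar * rtranclp_trans[of par u v z] by blast+
    then obtain s' \<upsilon> \<zeta> where s': "pstar y s'" "rst s'" "below inf \<upsilon> s'" "below pstar \<upsilon> \<zeta>" "below pstar z \<zeta>"
      using inf_rst * by blast
    then obtain x where x: "pstar s' x" "pstar (hnf s) x"
      using pstar_confluent[of s s' "hnf s"] s * by (meson rtranclp_trans)
    have b: "below pstar (hnf t) z" "below pstar (hnf s) x" "below pstar s' x"
      using z x s t s' rst_pstar_below by blast+
    \<comment> \<open>Read from left to right: from \<open>hnf t\<close> to \<open>z\<close> and
      \<zeta>, back to \<upsilon>, infinitarily to \<open>s'\<close>, on to \<open>x\<close>, and
      back to \<open>hnf s\<close>. None of these reductions touches the root.\<close>
    have "below (pstar OO pstar OO pstar\<inverse>\<inverse> OO inf OO pstar OO pstar\<inverse>\<inverse>) (hnf t) (hnf s)"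
      by (rule below_OO_I[OF b(1) below_OO_I[OF s'(5) below_OO_I[OF _ below_OO_I[OF s'(3)
          below_OO_I[OF b(3)]]]]]) (simp_all only: below_conversep s' b)
    then have E: "below ?E (hnf t) (hnf s)"
    proof (elim below_weaken)
      fix a b
      assume "(pstar OO pstar OO pstar\<inverse>\<inverse> OO inf OO pstar OO pstar\<inverse>\<inverse>) a b"
      then obtain c d e f g where "pstar a c" "pstar c d" "pstar e d" "inf e f" "pstar f g" "pstar b g"
        by blast
      then have "pstar a d" "pstar e d" "inf e g" "pstar b g"
        using inf_pstar rtranclp_trans[of par a c d] by blast+
      then show "?E a b" by blast
    qed
    have "below ((\<lambda>a b. b = NF a)\<inverse>\<inverse> OO ?E OO (\<lambda>a b. b = NF a)) (NF t) (NF s)"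
      by (rule below_OO_I[OF _ below_OO_I[OF E]]) (use NF_hnf False null in \<open>simp_all add: below_conversep\<close>)
    then have "below (\<lambda>a b. (\<exists>t s. a = NF t \<and> b = NF s \<and> ?E t s) \<or> a = b) (NF t) (NF s)"
      by (elim below_weaken) blast
    then show ?thesis by cases auto
  qed
qed

lemma NF_inf: "inf t s \<Longrightarrow> NF t = NF s"
  using NF_eq by blast

lemma NF_pstar: "pstar t s \<Longrightarrow> NF t = NF s"
  using NF_eq inf_refl by blast

lemma NF_rst: "rst t \<Longrightarrow> below (\<lambda>a b. b = NF a) t (NF t)"
proof -
  assume t: "rst t"
  then have "below pstar t (hnf t)" "\<not> null t"
    using hnf rst_not_null rst_pstar_below by blast+
  then have "below (pstar OO (\<lambda>a b. b = NF a)) t (NF t)"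
    using NF_hnf by (intro below_OO_I)
  then show ?thesis by (elim below_weaken) (auto simp: NF_pstar)
qed

subsection \<open>Counting root steps\<close>

text \<open>A lower bound for the root contractions that some reduction from \<open>t\<close>
  performs: the \<open>pstar\<close> parts may contain further ones.\<close>

fun roots :: "nat \<Rightarrow> ('f, 'v) pterm \<Rightarrow> bool" where
  "roots 0 t = True"
| "roots (Suc n) t = (\<exists>l r \<sigma>. (l, r) \<in> R \<and> pstar t (subst \<sigma> l) \<and> roots n (subst \<sigma> r))"

lemma roots_inf: "inf t s \<Longrightarrow> roots n s \<Longrightarrow> roots n t"
proof (induction n arbitrary: t s)
  case (Suc n)
  then obtain l r \<sigma> where R: "(l, r) \<in> R" and "pstar s (subst \<sigma> l)" and n: "roots n (subst \<sigma> r)"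
    by auto
  then have "inf t (subst \<sigma> l)" using Suc inf_pstar by blast
  then obtain \<tau> where \<tau>: "pstar t (subst \<tau> l)" "\<forall>x\<in>set2_pterm l. inf (\<tau> x) (\<sigma> x)"
    using inf_lhs R by blast
  then have "inf (subst \<tau> r) (subst \<sigma> r)" using inf_subst vars_rhs R by blast
  then have "roots n (subst \<tau> r)" using Suc.IH n by blast
  then show ?case unfolding roots.simps using \<tau> R by blast
qed simp

text \<open>Projected over a reduction to a redex, the \<open>m\<close> steps still end in a
  root-stable term. Redexes stay redexes under steps below the root, so one of the \<open>m\<close>
  steps contracts the residual of this redex; contracting it beforehand saves that step. Each root
  contraction thus costs one of the \<open>m\<close>.\<close>

lemma roots_bounded: "(par ^^ m) t w \<Longrightarrow> rst w \<Longrightarrow> \<not> roots (Suc m) t"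
proof (induction m arbitrary: t w rule: less_induct)
  case (less m)
  show ?case
  proof
    assume "roots (Suc m) t"
    then obtain l r \<sigma> where R: "(l, r) \<in> R" and t: "pstar t (subst \<sigma> l)" and roots: "roots m (subst \<sigma> r)"
      by auto
    obtain w' where w': "(par ^^ m) (subst \<sigma> l) w'" "pstar w w'" using pstar_grid t less by blast
    then have rst: "rst w'" using less rst_pstar by blast
    from relpow_split[OF w'(1)] show False
    proof (elim disjE exE conjE)
      assume "below (par ^^ m) (subst \<sigma> l) w'"
      then have "redex w'" using relpow_lhs R unfolding redex_def by blast
      then show False using rst rst_not_redex by blast
    next
      fix k l' r' \<rho>
      assume k: "k < m" and R': "(l', r') \<in> R" and below: "below (par ^^ k) (subst \<sigma> l) (subst \<rho> l')"
        and rw: "(par ^^ (m - k - 1)) (subst \<rho> r') w'"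
      obtain \<tau> where \<tau>: "subst \<rho> l' = subst \<tau> l" "\<forall>x\<in>set2_pterm l. (par ^^ k) (\<sigma> x) (\<tau> x)"
        using relpow_lhs[OF R below] by blast
      then have "subst \<rho> r' = subst \<tau> r" using same_contractum R R' by blast
      moreover have "(par ^^ k) (subst \<sigma> r) (subst \<tau> r)"
        using \<tau> relpow_subst vars_rhs R by blast
      ultimately have "(par ^^ (k + (m - k - 1))) (subst \<sigma> r) w'" using rw relpowp_trans by metis
      moreover have "k + (m - k - 1) = m - 1" using k by simp
      ultimately have "\<not> roots (Suc (m - 1)) (subst \<sigma> r)" using less.IH[of "m - 1"] k rst by simp
      then show False using roots k by simp
    qed
  qed
qed

lemma roots_null: "(\<And>n. roots n t) \<Longrightarrow> null t"
  using roots_bounded unfolding null_def rtranclp_power by blast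

lemma roots_rootstep: "rootstep t s \<Longrightarrow> roots n s \<Longrightarrow> roots (Suc n) t"
  unfolding rootstep_def by auto

end

subsection \<open>Symbols at positions and limits inferior\<close>

fun root :: "('f, 'v) pterm \<Rightarrow> ('v + 'f \<times> nat) option" where
  "root (PVar x) = Some (Inl x)"
| "root Bot = None"
| "root (PFun f ts) = Some (Inr (f, length ts))"

text \<open>Through its labels a term is a partial function on positions, undefined at
  \<open>Bot\<close>. The order becomes inclusion of graphs, and meets and limits inferior can be
  computed position by position.\<close>

definition symat :: "('f, 'v) pterm \<Rightarrow> pos \<Rightarrow> ('v + 'f \<times> nat) option" where
  "symat t p = (case subt_at t p of None \<Rightarrow> None | Some u \<Rightarrow> root u)"

lemma symat_simps [simp]:
  "symat t [] = root t"
  "symat (PFun f ts) (k # p) = (if k < length ts then symat (ts ! k) p else None)"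
  "symat (PVar x) (k # p) = None"
  "symat Bot p = None"
  by (auto simp: symat_def) (cases p; simp)

lemma symat_root: "subt_at t p = Some u \<Longrightarrow> symat t p = root u"
  unfolding symat_def by simp

lemma symat_snoc:
  "symat t (p @ [k]) \<noteq> None \<Longrightarrow> \<exists>f n. symat t p = Some (Inr (f, n)) \<and> k < n"
proof (induction p arbitrary: t)
  case Nil
  then show ?case by (cases t) (auto split: if_splits)
next
  case (Cons j p)
  then show ?case by (cases t) (auto split: if_splits)
qed

lemma symat_prefix: "symat t p \<noteq> None \<Longrightarrow> prefix q p \<Longrightarrow> symat t q \<noteq> None"
proof (induction p rule: rev_induct)
  case (snoc k p)
  then show ?case using symat_snoc[of t p k] by (auto simp: prefix_snoc)
qed simp

lemma root_None [simp]: "root t = None \<longleftrightarrow> t = Bot"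
  by (cases t) auto

lemma le_bot_iff: "le_bot s t \<longleftrightarrow> (\<forall>p a. symat s p = Some a \<longrightarrow> symat t p = Some a)"
proof
  assume "le_bot s t"
  then have "symat s p = Some a \<longrightarrow> symat t p = Some a" for p a
  proof (induction p arbitrary: s t)
    case Nil
    then show ?case by cases (auto simp: list_all2_lengthD)
  next
    case (Cons k p)
    from Cons.prems show ?case
      by cases (use Cons.IH in \<open>auto simp: list_all2_conv_all_nth\<close>)
  qed
  then show "\<forall>p a. symat s p = Some a \<longrightarrow> symat t p = Some a" by blast
next
  assume "\<forall>p a. symat s p = Some a \<longrightarrow> symat t p = Some a"
  then show "le_bot s t"
  proof (coinduction arbitrary: s t)
    case (le_bot s t)
    then have sub: "symat t p = Some a" if "symat s p = Some a" for p a using that by blast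
    show ?case
    proof (cases s)
      case (PVar x)
      then have "root t = Some (Inl x)" using sub[of "[]"] by simp
      then show ?thesis using PVar by (cases t) auto
    next
      case (PFun f ss)
      then have "root t = Some (Inr (f, length ss))" using sub[of "[]"] by simp
      then obtain us where t: "t = PFun f us" "length us = length ss" by (cases t) auto
      have "\<forall>p a. symat (ss ! k) p = Some a \<longrightarrow> symat (us ! k) p = Some a" if "k < length ss" for k
        using sub[of "k # p" for p] that t PFun by simp
      then show ?thesis using t PFun by (auto simp: list_all2_conv_all_nth)
    qed simp
  qed
qed

lemma symat_ext: "\<forall>p. symat s p = symat t p \<Longrightarrow> s = t"
proof (coinduction arbitrary: s t rule: pterm.coinduct_strong)
  case (Eq_pterm s t)
  have root: "root s = root t" using Eq_pterm symat_simps(1) by metis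
  show ?case
  proof (cases s)
    case (PFun f ss)
    then obtain us where t: "t = PFun f us" "length us = length ss" using root by (cases t) auto
    have "symat (ss ! k) p = symat (us ! k) p" if "k < length ss" for k p
      using Eq_pterm[THEN spec, of "k # p"] that t PFun by simp
    then show ?thesis using t PFun by (auto simp: list_all2_conv_all_nth)
  qed (use root in \<open>cases t; auto\<close>)+
qed

lemma le_bot_antisym: "le_bot s t \<Longrightarrow> le_bot t s \<Longrightarrow> s = t"
  unfolding le_bot_iff by (intro symat_ext allI) (metis not_Some_eq)

text \<open>Rebuilds a term from a labelling and cuts it at the first undefined label, since a
  labelling collected from several terms may be defined below a hole.\<close>

primcorec of_syms :: "(pos \<Rightarrow> ('v + 'f \<times> nat) option) \<Rightarrow> ('f, 'v) pterm" where
  "of_syms \<phi> = (case \<phi> [] of None \<Rightarrow> Bot | Some a \<Rightarrow> (case a of Inl x \<Rightarrow> PVar x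
     | Inr fn \<Rightarrow> PFun (fst fn) (map (\<lambda>k. of_syms (\<lambda>p. \<phi> (k # p))) [0..<snd fn])))"

text \<open>Arities are compared only where both labels are defined, so holes above defined labels
  are permitted.\<close>

definition treelike :: "(pos \<Rightarrow> ('v + 'f \<times> nat) option) \<Rightarrow> bool" where
  "treelike \<phi> \<longleftrightarrow> (\<forall>p k a b. \<phi> (p @ [k]) = Some a \<longrightarrow> \<phi> p = Some b \<longrightarrow> (\<exists>f n. b = Inr (f, n) \<and> k < n))"

lemma symat_of_syms:
  "treelike \<phi> \<Longrightarrow> symat (of_syms \<phi>) p = Some a \<longleftrightarrow> (\<forall>q. prefix q p \<longrightarrow> \<phi> q \<noteq> None) \<and> \<phi> p = Some a"
proof (induction p arbitrary: \<phi>)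
  case Nil
  then show ?case by (subst of_syms.code) (auto split: option.splits sum.splits)
next
  case (Cons k p)
  have prefixes: "(\<forall>q. prefix q (k # p) \<longrightarrow> \<phi> q \<noteq> None) \<longleftrightarrow>
      \<phi> [] \<noteq> None \<and> (\<forall>q. prefix q p \<longrightarrow> \<phi> (k # q) \<noteq> None)"
    by (auto simp: prefix_Cons)
  have tree: "treelike (\<lambda>p. \<phi> (k # p))"
    using Cons.prems unfolding treelike_def by (metis append_Cons)
  show ?case
  proof (cases "\<exists>f n. \<phi> [] = Some (Inr (f, n)) \<and> k < n")
    case True
    then obtain f n where "\<phi> [] = Some (Inr (f, n))" "k < n" by blast
    then have "symat (of_syms \<phi>) (k # p) = symat (of_syms (\<lambda>p. \<phi> (k # p))) p"
      by (subst of_syms.code) simp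
    then show ?thesis using Cons.IH[OF tree] prefixes True by auto
  next
    case False
    have "\<phi> [k] = None \<or> \<phi> [] = None"
      using Cons.prems False unfolding treelike_def by (metis append_Nil not_Some_eq)
    moreover have "symat (of_syms \<phi>) (k # p) = None"
      using False by (subst of_syms.code) (auto split: option.splits sum.splits)
    ultimately show ?thesis using prefixes by (metis Nil_prefix option.distinct(1))
  qed
qed

section \<open>Meets and limits inferior in terms of labels\<close>

definition common :: "('f, 'v) pterm set \<Rightarrow> pos \<Rightarrow> ('v + 'f \<times> nat) option" where
  "common S p = (if \<exists>a. \<forall>t\<in>S. symat t p = Some a then symat (SOME t. t \<in> S) p else None)"

lemma common_iff: "S \<noteq> {} \<Longrightarrow> common S p = Some a \<longleftrightarrow> (\<forall>t\<in>S. symat t p = Some a)"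
proof -
  assume "S \<noteq> {}"
  then have *: "(SOME t. t \<in> S) \<in> S" by (simp add: some_in_eq)
  show ?thesis
  proof (cases "\<exists>b. \<forall>t\<in>S. symat t p = Some b")
    case True
    then obtain b where "\<forall>t\<in>S. symat t p = Some b" by blast
    then show ?thesis using * unfolding common_def by auto
  qed (auto simp: common_def)
qed

lemma treelike_common: "S \<noteq> {} \<Longrightarrow> treelike (common S)"
  unfolding treelike_def common_iff
proof (intro allI impI)
  fix p k a b
  assume "S \<noteq> {}" "\<forall>t\<in>S. symat t (p @ [k]) = Some a" "\<forall>t\<in>S. symat t p = Some b"
  then obtain t where "symat t (p @ [k]) = Some a" "symat t p = Some b" by blast
  then show "\<exists>f n. b = Inr (f, n) \<and> k < n" using symat_snoc[of t p k] by auto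
qed

lemma symat_common:
  assumes "S \<noteq> {}"
  shows "symat (of_syms (common S)) p = Some a \<longleftrightarrow>
    (\<forall>t\<in>S. symat t p = Some a) \<and> (\<forall>q. prefix q p \<longrightarrow> (\<exists>b. \<forall>t\<in>S. symat t q = Some b))"
proof -
  have "common S q \<noteq> None \<longleftrightarrow> (\<exists>b. \<forall>t\<in>S. symat t q = Some b)" for q
    using common_iff[OF assms, of q] by auto
  then show ?thesis
    using symat_of_syms[OF treelike_common[OF assms]] common_iff[OF assms] by auto
qed

text \<open>Terms may agree at a position and differ above it, as \<open>f(a)\<close> and
  \<open>g(a)\<close> do. \<open>of_syms\<close> discards such positions, which leaves the largest
  common part.\<close>

lemma glb_eq:
  assumes "S \<noteq> {}"
  shows "glb S = of_syms (common S)"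
proof -
  have glb: "is_glb S (of_syms (common S))"
    unfolding is_glb_def le_bot_iff
  proof (intro conjI ballI allI impI)
    fix m p a
    assume m: "\<forall>s\<in>S. \<forall>p a. symat m p = Some a \<longrightarrow> symat s p = Some a" and a: "symat m p = Some a"
    have "\<exists>b. \<forall>t\<in>S. symat t q = Some b" if "prefix q p" for q
      using symat_prefix[OF _ that, of m] a m by auto
    then show "symat (of_syms (common S)) p = Some a"
      using m a by (simp add: symat_common assms)
  qed (simp add: symat_common assms)
  then show ?thesis unfolding glb_def
    by (intro the_equality) (auto simp: is_glb_def intro: le_bot_antisym)
qed

definition ev_sym :: "'i rel \<Rightarrow> 'i set \<Rightarrow> ('i \<Rightarrow> ('f, 'v) pterm) \<Rightarrow> pos \<Rightarrow> ('v + 'f \<times> nat) \<Rightarrow> bool" where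
  "ev_sym r J c p a \<longleftrightarrow> (\<exists>b\<in>J. \<forall>i\<in>J. (b, i) \<in> r \<longrightarrow> symat (c i) p = Some a)"

text \<open>Each prefix may have its own threshold for becoming constant. A position has only
  finitely many prefixes, so one threshold serves all of them, and the meet over that tail already
  contains the position.\<close>

lemma symat_liminf:
  assumes r: "Well_order r" and J: "J \<subseteq> Field r" "J \<noteq> {}"
  shows "symat (liminf_bot r J c) p = Some a \<longleftrightarrow> ev_sym r J c p a \<and> (\<forall>q. prefix q p \<longrightarrow> (\<exists>b. ev_sym r J c q b))"
proof -
  have refl: "(i, i) \<in> r" if "i \<in> J" for i
    using r J that unfolding order_on_defs by (auto dest: refl_onD)
  have tr: "trans r" and tot: "total_on (Field r) r" using r unfolding order_on_defs by blast+
  have join: "\<exists>b\<in>J. (b1, b) \<in> r \<and> (b2, b) \<in> r" if b: "b1 \<in> J" "b2 \<in> J" for b1 b2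
  proof (cases "b1 = b2")
    case False
    then have "(b1, b2) \<in> r \<or> (b2, b1) \<in> r" using tot J(1) b unfolding total_on_def by blast
    then show ?thesis using refl b by blast
  qed (use refl b in blast)
  have joint: "\<exists>b\<in>J. \<forall>i\<in>J. (b, i) \<in> r \<longrightarrow> symat (c i) p = Some x \<and> symat (c i) q = Some y"
    if xy: "ev_sym r J c p x" "ev_sym r J c q y" for p q x y
  proof -
    obtain b1 b2 where b12: "b1 \<in> J" "b2 \<in> J" "\<forall>i\<in>J. (b1, i) \<in> r \<longrightarrow> symat (c i) p = Some x"
      "\<forall>i\<in>J. (b2, i) \<in> r \<longrightarrow> symat (c i) q = Some y"
      using xy unfolding ev_sym_def by blast
    then obtain b where b: "b \<in> J" "(b1, b) \<in> r" "(b2, b) \<in> r" using join by blast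
    then show ?thesis using b12 tr by (blast dest: transD)
  qed
  define \<phi> where "\<phi> p = (if \<exists>a. ev_sym r J c p a then Some (SOME a. ev_sym r J c p a) else None)" for p
  have uniq: "x = y" if xy: "ev_sym r J c p x" "ev_sym r J c p y" for p x y
  proof -
    obtain b where "b \<in> J" "symat (c b) p = Some x \<and> symat (c b) p = Some y"
      using joint[OF xy] refl by blast
    then show ?thesis by (metis option.inject)
  qed
  have \<phi>: "\<phi> p = Some x \<longleftrightarrow> ev_sym r J c p x" for p x
  proof (cases "\<exists>a. ev_sym r J c p a")
    case True
    then have "ev_sym r J c p (SOME a. ev_sym r J c p a)" by (rule someI_ex)
    then show ?thesis unfolding \<phi>_def using True uniq[of p] by auto
  qed (auto simp: \<phi>_def)
  have tree: "treelike \<phi>"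
    unfolding treelike_def \<phi>
  proof (intro allI impI)
    fix p k x y
    assume "ev_sym r J c (p @ [k]) x" "ev_sym r J c p y"
    from joint[OF this] obtain i where "symat (c i) (p @ [k]) = Some x" "symat (c i) p = Some y"
      using refl by blast
    then show "\<exists>f n. y = Inr (f, n) \<and> k < n" using symat_snoc[of "c i" p k] by auto
  qed
  have sym: "symat (of_syms \<phi>) p = Some x \<longleftrightarrow> ev_sym r J c p x \<and> (\<forall>q. prefix q p \<longrightarrow> (\<exists>b. ev_sym r J c q b))" for p x
    using symat_of_syms[OF tree, of p x] \<phi> by (metis not_Some_eq)
  define tail where "tail b = {i \<in> J. (b, i) \<in> r}" for b
  have ne: "c ` tail b \<noteq> {}" if "b \<in> J" for b using refl that unfolding tail_def by blast
  have symg: "symat (glb (c ` tail b)) p = Some x \<longleftrightarrow>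
      (\<forall>i\<in>tail b. symat (c i) p = Some x) \<and> (\<forall>q. prefix q p \<longrightarrow> (\<exists>y. \<forall>i\<in>tail b. symat (c i) q = Some y))"
    if "b \<in> J" for b p x
    using symat_common[OF ne[OF that], of p x] glb_eq[OF ne[OF that]] by simp
  have lub: "is_lub {glb (c ` tail b) | b. b \<in> J} (of_syms \<phi>)"
    unfolding is_lub_def le_bot_iff
  proof (intro conjI ballI allI impI)
    fix s p x
    assume "s \<in> {glb (c ` tail b) | b. b \<in> J}" "symat s p = Some x"
    then obtain b where b: "b \<in> J" "symat (glb (c ` tail b)) p = Some x" by blast
    have ev: "ev_sym r J c q y" if "\<forall>i\<in>tail b. symat (c i) q = Some y" for q y
      using that b unfolding ev_sym_def tail_def by blast
    show "symat (of_syms \<phi>) p = Some x"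
      unfolding sym using b symg[OF b(1)] ev by meson
  next
    fix m p x
    assume m: "\<forall>s\<in>{glb (c ` tail b) | b. b \<in> J}. \<forall>p a. symat s p = Some a \<longrightarrow> symat m p = Some a"
      and "symat (of_syms \<phi>) p = Some x"
    then have p: "ev_sym r J c p x" "\<forall>q. prefix q p \<longrightarrow> (\<exists>b. ev_sym r J c q b)" unfolding sym by blast+
    have fin: "finite {q. prefix q p}" by (metis finite_set set_prefixes_eq)
    have "\<exists>b\<in>J. \<forall>q\<in>Q. \<exists>y. \<forall>i\<in>tail b. symat (c i) q = Some y" if "finite Q" "Q \<subseteq> {q. prefix q p}" for Q
      using that
    proof (induction Q)
      case empty
      then show ?case using J by blast
    next
      case (insert q Q)
      then obtain b1 where b1: "b1 \<in> J" "\<forall>q\<in>Q. \<exists>y. \<forall>i\<in>tail b1. symat (c i) q = Some y" by blast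
      have "prefix q p" using insert.prems by blast
      then obtain y where "ev_sym r J c q y" using p(2) by blast
      then obtain b2 where b2: "b2 \<in> J" "\<forall>i\<in>tail b2. symat (c i) q = Some y"
        unfolding ev_sym_def tail_def by blast
      obtain b where b: "b \<in> J" "(b1, b) \<in> r" "(b2, b) \<in> r" using join b1 b2 by blast
      then have "tail b \<subseteq> tail b1" "tail b \<subseteq> tail b2" using tr unfolding tail_def by (auto dest: transD)
      then have "\<forall>q\<in>insert q Q. \<exists>y. \<forall>i\<in>tail b. symat (c i) q = Some y"
        using b1(2) b2(2) by (simp add: subset_iff) blast
      then show ?case using b(1) by blast
    qed
    from this[OF fin] obtain b where b: "b \<in> J" "\<forall>q. prefix q p \<longrightarrow> (\<exists>y. \<forall>i\<in>tail b. symat (c i) q = Some y)"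
      by auto
    then obtain y where y: "\<forall>i\<in>tail b. symat (c i) p = Some y" by blast
    then have "y = x" using uniq[OF p(1), of y] b(1) unfolding ev_sym_def tail_def by blast
    then have "symat (glb (c ` tail b)) p = Some x" using symg[OF b(1)] b y by blast
    then show "symat m p = Some x" using m b(1) by blast
  qed
  then have "liminf_bot r J c = of_syms \<phi>"
    unfolding liminf_bot_def lub_def tail_def
    by (intro the_equality) (auto simp: is_lub_def intro: le_bot_antisym)
  then show ?thesis using sym by simp
qed

lemma symat_context:
  "subt_at t q \<noteq> None \<Longrightarrow> symat (replace_at t q Bot) p = (if prefix q p then None else symat t p)"
proof (induction q arbitrary: t p)
  case (Cons k q)
  then obtain f ts where t: "t = PFun f ts" "k < length ts" "subt_at (ts ! k) q \<noteq> None"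
    by (auto simp: subt_at_Cons)
  show ?case
  proof (cases p)
    case (Cons j p')
    then show ?thesis using t Cons.IH[OF t(3), of p'] by (cases "j = k") auto
  qed (use t in simp)
qed simp

lemma subt_at_same_path:
  assumes "subt_at t p \<noteq> None" "\<And>q. strict_prefix q p \<Longrightarrow> symat s q = symat t q"
  shows "subt_at s p \<noteq> None"
  using assms
proof (induction p arbitrary: t s)
  case (Cons k p)
  then obtain f ts where t: "t = PFun f ts" "k < length ts" "subt_at (ts ! k) p \<noteq> None"
    by (auto simp: subt_at_Cons)
  have "root s = root t" using Cons.prems(2)[of "[]"] by simp
  then obtain ss where s: "s = PFun f ss" "length ss = length ts" using t by (cases s) auto
  have "symat (ss ! k) q = symat (ts ! k) q" if "strict_prefix q p" for q
    using Cons.prems(2)[of "k # q"] that t s by simp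
  then show ?case using Cons.IH[OF t(3)] s t by simp
qed simp

subsection \<open>Single steps\<close>

context orthogonal_trs
begin

lemma rstep_Nil: "rstep R t [] t' \<longleftrightarrow> rootstep t t'"
  unfolding rstep_def rootstep_def by auto

lemma rstep_Cons:
  "rstep R t (k # q) t' \<longleftrightarrow>
    (\<exists>f ts u. t = PFun f ts \<and> k < length ts \<and> rstep R (ts ! k) q u \<and> t' = PFun f (ts[k := u]))"
proof (cases t)
  case (PFun f ts)
  show ?thesis
  proof
    assume "rstep R t (k # q) t'"
    then obtain l r \<sigma> where "(l, r) \<in> R" "k < length ts" "subt_at (ts ! k) q = Some (subst \<sigma> l)"
      "t' = PFun f (ts[k := replace_at (ts ! k) q (subst \<sigma> r)])"
      unfolding rstep_def PFun by (auto split: if_splits)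
    moreover from this have "rstep R (ts ! k) q (replace_at (ts ! k) q (subst \<sigma> r))"
      unfolding rstep_def by blast
    ultimately show "\<exists>f ts u. t = PFun f ts \<and> k < length ts \<and> rstep R (ts ! k) q u \<and> t' = PFun f (ts[k := u])"
      using PFun by blast
  next
    assume "\<exists>f ts u. t = PFun f ts \<and> k < length ts \<and> rstep R (ts ! k) q u \<and> t' = PFun f (ts[k := u])"
    then obtain u l r \<sigma> where *: "k < length ts" "(l, r) \<in> R" "subt_at (ts ! k) q = Some (subst \<sigma> l)"
      "u = replace_at (ts ! k) q (subst \<sigma> r)" "t' = PFun f (ts[k := u])"
      unfolding rstep_def PFun by blast
    then have "subt_at t (k # q) = Some (subst \<sigma> l)" "t' = replace_at t (k # q) (subst \<sigma> r)"
      unfolding PFun by simp_all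
    then show "rstep R t (k # q) t'" using *(2) unfolding rstep_def by blast
  qed
qed (auto simp: rstep_def)

lemma rstep_par: "rstep R t q t' \<Longrightarrow> par t t'"
proof (induction q arbitrary: t t')
  case Nil
  then show ?case by (simp add: rstep_Nil rootstep_par)
next
  case (Cons k q)
  then obtain f ts u where "t = PFun f ts" "k < length ts" "par (ts ! k) u" "t' = PFun f (ts[k := u])"
    unfolding rstep_Cons by blast
  then have "below par t t'" by (auto simp: list_all2_conv_all_nth nth_list_update)
  then show ?case by (rule par_below)
qed

lemma rstep_subt_at: "rstep R t q t' \<Longrightarrow> subt_at t q \<noteq> None"
  unfolding rstep_def by auto

lemma rstep_at:
  assumes "rstep R t q t'" "\<not> strict_prefix q p" "subt_at t p = Some v"
  shows "\<exists>v'. subt_at t' p = Some v' \<and> par v v' \<and> (q = p \<longrightarrow> rootstep v v') \<and> (q \<noteq> p \<longrightarrow> root v = root v')"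
  using assms
proof (induction p arbitrary: t q t')
  case Nil
  then have "par v t'" using rstep_par by simp
  moreover have "root v = root t'" if "q \<noteq> []"
    using that Nil by (cases q) (auto simp: rstep_Cons)
  ultimately show ?case using Nil rstep_Nil by auto
next
  case (Cons j p)
  then obtain k q' where q: "q = k # q'" by (cases q) auto
  then obtain f ts u where *: "t = PFun f ts" "k < length ts" "rstep R (ts ! k) q' u" "t' = PFun f (ts[k := u])"
    using Cons.prems(1) unfolding q rstep_Cons by blast
  show ?case
  proof (cases "j = k")
    case True
    then have "\<not> strict_prefix q' p" "subt_at (ts ! k) p = Some v" using Cons.prems q * by auto
    from Cons.IH[OF *(3) this] show ?thesis using * q True by simp
  next
    case False
    then show ?thesis using * q Cons.prems(3) by (auto split: if_splits)
  qed
qed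

end

subsection \<open>Transfinite reductions are infinitary reductions\<close>

locale p_reduction = orthogonal_trs R for R :: "('f, 'v) trs" +
  fixes r :: "'i rel" and ts :: "'i \<Rightarrow> ('f, 'v) pterm" and ps :: "'i \<Rightarrow> pos"
    and t s :: "('f, 'v) pterm"
  assumes conv: "strongly_p_conv R r ts ps t s"
begin

abbreviation lt :: "'i \<Rightarrow> 'i \<Rightarrow> bool" where
  "lt i j \<equiv> (i, j) \<in> r \<and> i \<noteq> j"

abbreviation ctxt :: "'i \<Rightarrow> ('f, 'v) pterm" where
  "ctxt i \<equiv> replace_at (ts i) (ps i) Bot"

lemmas convD = conv[unfolded strongly_p_conv_def Let_def]
lemmas wo = convD[THEN conjunct1]
lemmas conv_empty = convD[THEN conjunct2, THEN conjunct1]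
lemmas conv_first = convD[THEN conjunct2, THEN conjunct2, THEN conjunct1]
lemmas conv_step = convD[THEN conjunct2, THEN conjunct2, THEN conjunct2, THEN conjunct1]
lemmas conv_closed = convD[THEN conjunct2, THEN conjunct2, THEN conjunct2, THEN conjunct2, THEN conjunct1]
lemmas conv_limit =
  convD[THEN conjunct2, THEN conjunct2, THEN conjunct2, THEN conjunct2, THEN conjunct2, THEN conjunct1]
lemmas conv_open =
  convD[THEN conjunct2, THEN conjunct2, THEN conjunct2, THEN conjunct2, THEN conjunct2, THEN conjunct2]

lemma refl: "i \<in> Field r \<Longrightarrow> (i, i) \<in> r"
  using wo unfolding order_on_defs by (auto dest: refl_onD)

lemma trans: "(i, j) \<in> r \<Longrightarrow> (j, k) \<in> r \<Longrightarrow> (i, k) \<in> r"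
proof -
  have "Relation.trans r" using wo unfolding order_on_defs by blast
  then show "(i, j) \<in> r \<Longrightarrow> (j, k) \<in> r \<Longrightarrow> (i, k) \<in> r" by (rule transD)
qed

lemma antisym: "(i, j) \<in> r \<Longrightarrow> (j, i) \<in> r \<Longrightarrow> i = j"
proof -
  have "Relation.antisym r" using wo unfolding order_on_defs by blast
  then show "(i, j) \<in> r \<Longrightarrow> (j, i) \<in> r \<Longrightarrow> i = j" by (rule antisymD)
qed

lemma linear: "i \<in> Field r \<Longrightarrow> j \<in> Field r \<Longrightarrow> (i, j) \<in> r \<or> lt j i"
proof -
  assume ij: "i \<in> Field r" "j \<in> Field r"
  have "total_on (Field r) r" using wo unfolding order_on_defs by blast
  then show ?thesis using ij refl[of i] unfolding total_on_def by (cases "i = j") auto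
qed

lemma lt_le_trans: "lt i j \<Longrightarrow> (j, k) \<in> r \<Longrightarrow> lt i k"
  using trans antisym by blast

lemma le_lt_trans: "(i, j) \<in> r \<Longrightarrow> lt j k \<Longrightarrow> lt i k"
  using trans antisym by blast

lemma least:
  assumes "k \<in> Field r" "P k"
  obtains i where "i \<in> Field r" "P i" "\<And>j. j \<in> Field r \<Longrightarrow> P j \<Longrightarrow> (i, j) \<in> r"
proof -
  have "wf (r - Id)" using wo unfolding well_order_on_def by blast
  then obtain i where i: "i \<in> Field r \<and> P i" "\<And>j. (j, i) \<in> r - Id \<Longrightarrow> \<not> (j \<in> Field r \<and> P j)"
    by (rule wfE_min'[of _ "{i. i \<in> Field r \<and> P i}"]) (use assms in auto)
  then show thesis using that linear by blast
qed

lemma step: "i \<in> Field r \<Longrightarrow> j \<in> Field r \<Longrightarrow> lt i j \<Longrightarrow> (\<And>k. k \<in> Field r \<Longrightarrow> lt i k \<Longrightarrow> \<not> lt k j) \<Longrightarrow>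
    rstep R (ts i) (ps i) (ts j)"
  using conv_step by blast

lemma next_step:
  assumes "i \<in> Field r" "k \<in> Field r" "lt i k"
  obtains j where "j \<in> Field r" "lt i j" "(j, k) \<in> r" "rstep R (ts i) (ps i) (ts j)"
    "\<And>k. lt k j \<Longrightarrow> (k, i) \<in> r"
proof -
  obtain j where j: "j \<in> Field r" "lt i j" "\<And>k. k \<in> Field r \<Longrightarrow> lt i k \<Longrightarrow> (j, k) \<in> r"
    using least[of k "lt i"] assms by blast
  moreover have "\<not> lt k j" if "k \<in> Field r" "lt i k" for k using j that antisym by blast
  moreover have "(k, i) \<in> r" if "lt k j" for k
    using calculation(4)[of k] that linear[of k i] assms(1) by (auto intro: FieldI1)
  ultimately show thesis using that step assms by blast
qed

text \<open>Only steps strictly above \<open>p\<close> could move or erase the subterm there. Steps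
  at \<open>p\<close> are root steps of this subterm and remain allowed.\<close>

definition quiet :: "'i set \<Rightarrow> pos \<Rightarrow> bool" where
  "quiet A p \<longleftrightarrow> (\<forall>i\<in>A. \<not> strict_prefix (ps i) p)"

text \<open>The invariant of the transfinite induction. It covers all quiet positions and all
  starting indices, because a limit is analysed by descending to subterms whose positions become
  quiet only at later indices.\<close>

definition tracks :: "'i \<Rightarrow> 'i \<Rightarrow> bool" where
  "tracks i k \<longleftrightarrow> (\<forall>p u. quiet {j. (i, j) \<in> r \<and> lt j k} p \<longrightarrow> subt_at (ts i) p = Some u \<longrightarrow>
     (\<exists>v. subt_at (ts k) p = Some v \<and> inf u v \<and>
       ((\<forall>j. (i, j) \<in> r \<longrightarrow> lt j k \<longrightarrow> ps j \<noteq> p) \<longrightarrow> root u = root v)))"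

text \<open>At a limit, a position at which cofinally many steps take place carries a null subterm; at
  the remaining positions the symbol is eventually constant, so one can descend coinductively.\<close>

lemma limit:
  assumes J: "J \<subseteq> Field r" and down: "\<And>i j. j \<in> J \<Longrightarrow> (i, j) \<in> r \<Longrightarrow> i \<in> J"
    and open_J: "\<And>i. i \<in> J \<Longrightarrow> \<exists>j\<in>J. lt i j"
    and tracks: "\<And>i k. k \<in> J \<Longrightarrow> (i, k) \<in> r \<Longrightarrow> tracks i k"
    and i: "i \<in> J" and p: "quiet {j \<in> J. (i, j) \<in> r} p" and u: "subt_at (ts i) p = Some u"
  shows "\<exists>v. subt_at (liminf_bot r J ctxt) p = Some v \<and> inf u v \<and>
    ((\<forall>j\<in>J. (i, j) \<in> r \<longrightarrow> ps j \<noteq> p) \<longrightarrow> root u = root v)"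
proof -
  let ?L = "liminf_bot r J ctxt"
  note L = symat_liminf[OF wo J, of ctxt]
  have J_ne: "J \<noteq> {}" using i by blast
  have step_J: "subt_at (ts i) (ps i) \<noteq> None" if "i \<in> J" for i
    using open_J[OF that] next_step[of i] J that rstep_subt_at by (metis subsetD)
  have track: "\<exists>v. subt_at (ts k) p = Some v \<and> inf u v \<and> ((\<forall>j\<in>J. (i, j) \<in> r \<longrightarrow> ps j \<noteq> p) \<longrightarrow> root u = root v)"
    if h: "k \<in> J" "(i, k) \<in> r" "quiet {j \<in> J. (i, j) \<in> r} p" "subt_at (ts i) p = Some u" for i k p u
  proof -
    have sub: "{j. (i, j) \<in> r \<and> lt j k} \<subseteq> {j \<in> J. (i, j) \<in> r}" using down h(1) by blast
    then have "quiet {j. (i, j) \<in> r \<and> lt j k} p" using h(3) unfolding quiet_def by blast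
    then obtain v where "subt_at (ts k) p = Some v" "inf u v"
      "(\<forall>j. (i, j) \<in> r \<longrightarrow> lt j k \<longrightarrow> ps j \<noteq> p) \<longrightarrow> root u = root v"
      using tracks[OF h(1,2)] h(4) unfolding tracks_def by blast
    then show ?thesis using sub by blast
  qed
  \<comment> \<open>The hole of the context is neither at nor above \<open>q\<close>, so it does not
    hide the label.\<close>
  have const: "symat (ctxt k) q = symat (ts i) q"
    if h: "k \<in> J" "(i, k) \<in> r" "quiet {j \<in> J. (i, j) \<in> r} q" "\<forall>j\<in>J. (i, j) \<in> r \<longrightarrow> ps j \<noteq> q" "subt_at (ts i) q \<noteq> None"
    for i k q
  proof -
    obtain w where w: "subt_at (ts i) q = Some w" using h(5) by blast
    then obtain v where v: "subt_at (ts k) q = Some v" "root w = root v" using track[OF h(1-3)] h(4) by blast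
    have "\<not> prefix (ps k) q" using h(1-4) unfolding quiet_def by (auto simp: strict_prefix_def)
    then show ?thesis using symat_context step_J h(1) v w symat_root by metis
  qed
  have ev: "ev_sym r J ctxt q a"
    if h: "i \<in> J" "quiet {j \<in> J. (i, j) \<in> r} q" "\<forall>j\<in>J. (i, j) \<in> r \<longrightarrow> ps j \<noteq> q" "symat (ts i) q = Some a" for i q a
  proof -
    have "subt_at (ts i) q \<noteq> None" using h(4) unfolding symat_def by (auto split: option.splits)
    then have "symat (ctxt k) q = Some a" if "k \<in> J" "(i, k) \<in> r" for k
      using const[OF that h(2,3)] h(4) by simp
    then show ?thesis using h(1) unfolding ev_sym_def by blast
  qed
  have path: "symat ?L q = symat (ts i) q"
    if "i \<in> J" "quiet {j \<in> J. (i, j) \<in> r} p" "subt_at (ts i) p \<noteq> None" "strict_prefix q p" for i p q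
  proof -
    have sub: "quiet {j \<in> J. (i, j) \<in> r} q'" "\<forall>j\<in>J. (i, j) \<in> r \<longrightarrow> ps j \<noteq> q'" if "strict_prefix q' p" for q'
      using \<open>quiet _ p\<close> that prefix_order.less_trans[of _ q' p] unfolding quiet_def by blast+
    have "\<exists>a. symat (ts i) q' = Some a" if q': "strict_prefix q' p" for q'
    proof -
      obtain k zs where "p = q' @ k # zs" using q' by (auto elim: strict_prefixE')
      then show ?thesis using \<open>subt_at (ts i) p \<noteq> None\<close>
        by (auto simp: subt_at_append symat_def subt_at_Cons split: option.splits)
    qed
    then have evs: "\<exists>a. symat (ts i) q' = Some a \<and> ev_sym r J ctxt q' a" if "strict_prefix q' p" for q'
      using ev[OF \<open>i \<in> J\<close> sub[OF that]] that by blast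
    have "strict_prefix q' p" if "prefix q' q" for q'
      using that \<open>strict_prefix q p\<close> by (rule prefix_order.le_less_trans)
    then have "\<forall>q'. prefix q' q \<longrightarrow> (\<exists>b. ev_sym r J ctxt q' b)" using evs by blast
    moreover obtain a where "symat (ts i) q = Some a" "ev_sym r J ctxt q a"
      using evs[OF \<open>strict_prefix q p\<close>] by blast
    ultimately show ?thesis using L[OF J_ne, of q a] by simp
  qed
  have pos: "subt_at ?L p \<noteq> None"
    if "i \<in> J" "quiet {j \<in> J. (i, j) \<in> r} p" "subt_at (ts i) p \<noteq> None" for i p
    using subt_at_same_path[OF that(3)] path[OF that] by blast
  have root: "root u = root v"
    if h: "i \<in> J" "quiet {j \<in> J. (i, j) \<in> r} p" "subt_at (ts i) p = Some u" "subt_at ?L p = Some v"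
      "\<forall>j\<in>J. (i, j) \<in> r \<longrightarrow> ps j \<noteq> p" for i p u v
  proof (cases "root u")
    case None
    have "\<not> ev_sym r J ctxt p a" for a
    proof
      assume "ev_sym r J ctxt p a"
      then obtain b where b: "b \<in> J" "\<forall>k\<in>J. (b, k) \<in> r \<longrightarrow> symat (ctxt k) p = Some a"
        unfolding ev_sym_def by blast
      obtain k where "k \<in> J" "(b, k) \<in> r" "(i, k) \<in> r"
        using linear[of b i] refl J b(1) h(1) by blast
      then have "symat (ctxt k) p = symat (ts i) p" "symat (ctxt k) p = Some a"
        using const[of k i p] h b by blast+
      moreover have "symat (ts i) p = None" using None h(3) symat_root by metis
      ultimately show False by simp
    qed
    then have "symat ?L p = None" using L[OF J_ne, of p] by (metis not_Some_eq)
    then show ?thesis using None h(4) symat_root by metis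
  next
    case (Some a)
    then have a: "symat (ts i) p = Some a" using h symat_root by metis
    have "ev_sym r J ctxt p a" using ev a h by blast
    moreover have "\<exists>b. ev_sym r J ctxt q b" if q: "strict_prefix q p" for q
    proof -
      have "symat ?L q = symat (ts i) q" using path[OF h(1,2) _ q] h(3) by blast
      moreover have "symat (ts i) q \<noteq> None" using symat_prefix[of "ts i" p q] a q by simp
      ultimately show ?thesis using L[OF J_ne, of q] by auto
    qed
    ultimately have "symat ?L p = Some a"
      using L[OF J_ne, of p a] prefix_order.le_less[of _ p] by blast
    then show ?thesis using Some h(4) symat_root by metis
  qed
  obtain v where v: "subt_at ?L p = Some v" using pos[OF i p] u by blast
  have "inf u v"
  proof -
    \<comment> \<open>The invariant carries an extra \<open>x\<close> because the descent passes to
      arguments of a reduct of \<open>x\<close>, which need not occur in any term of the given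
      reduction.\<close>
    have "inf x v" if "\<exists>i p u. i \<in> J \<and> quiet {j \<in> J. (i, j) \<in> r} p \<and> subt_at (ts i) p = Some u \<and>
        subt_at ?L p = Some v \<and> inf x u" for x v
      using that
    proof (coinduction arbitrary: x v)
      case (inf x v)
      then obtain i p u where *: "i \<in> J" "quiet {j \<in> J. (i, j) \<in> r} p" "subt_at (ts i) p = Some u"
        "subt_at ?L p = Some v" "inf x u" by blast
      show ?case
      proof (cases "\<forall>b\<in>J. \<exists>k\<in>J. (b, k) \<in> r \<and> ps k = p")
        case True
        have "\<not> ev_sym r J ctxt p a" for a
        proof
          assume "ev_sym r J ctxt p a"
          then obtain k where "k \<in> J" "ps k = p" "symat (ctxt k) p = Some a"
            using True unfolding ev_sym_def by blast
          then show False using symat_context[of "ts k" p p] step_J[of k] by simp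
        qed
        then have "symat ?L p = None" using L[OF J_ne, of p] by (metis not_Some_eq)
        then have v: "v = Bot" using * symat_root by (metis root_None)
        \<comment> \<open>The root steps are separated by infinitary reductions.
          \<open>roots_inf\<close> pulls the count back through them, so each further step at
          \<open>p\<close> adds one.\<close>
        have "\<forall>k w. k \<in> J \<longrightarrow> (i, k) \<in> r \<longrightarrow> subt_at (ts k) p = Some w \<longrightarrow> roots n w" for n
        proof (induction n)
          case (Suc n)
          show ?case
          proof (intro allI impI)
            fix k w
            assume k: "k \<in> J" "(i, k) \<in> r" "subt_at (ts k) p = Some w"
            then obtain l where l: "l \<in> J" "(k, l) \<in> r" "ps l = p" using True by blast
            have "quiet {j \<in> J. (k, j) \<in> r} p" using *(2) k(2) trans unfolding quiet_def by blast
            then obtain y where y: "subt_at (ts l) p = Some y" "inf w y" using track[OF l(1,2)] k by blast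
            obtain m where "m \<in> J" "lt l m" using open_J l by blast
            then obtain j where j: "(j, m) \<in> r" "lt l j" "rstep R (ts l) (ps l) (ts j)"
              using next_step[of l m] l J by blast
            then obtain z where z: "subt_at (ts j) p = Some z" "rootstep y z"
              using rstep_at[OF j(3) _ y(1)] l by auto
            have "j \<in> J" "(i, j) \<in> r" using j \<open>m \<in> J\<close> down trans k l by blast+
            then have "roots n z" using Suc.IH z by blast
            then show "roots (Suc n) w" using roots_rootstep z y roots_inf by blast
          qed
        qed simp
        then have "null u" using roots_null * refl J by blast
        then show ?thesis using null_inf_iff *(5) v by blast
      next
        case False
        then obtain b where b: "b \<in> J" "\<And>k. k \<in> J \<Longrightarrow> (b, k) \<in> r \<Longrightarrow> ps k \<noteq> p" by blast
        \<comment> \<open>Beyond both \<open>i\<close> and \<open>b\<close> no step takes place at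
          or above \<open>p\<close>. The root there is settled, and the positions of its arguments
          are quiet from \<open>k\<close> on.\<close>
        obtain k where k: "k \<in> J" "(i, k) \<in> r" "(b, k) \<in> r"
          using linear[of b i] refl J b(1) *(1) by blast
        have silent: "\<forall>j\<in>J. (k, j) \<in> r \<longrightarrow> ps j \<noteq> p" using b trans k by blast
        have quiet: "quiet {j \<in> J. (k, j) \<in> r} p" using *(2) trans k unfolding quiet_def by blast
        obtain w where w: "subt_at (ts k) p = Some w" "inf u w" using track[OF k(1,2) *(2,3)] by blast
        have rw: "root w = root v" using root[OF k(1) quiet w(1) *(4) silent] .
        have xw: "inf x w" using inf_trans *(5) w(2) by blast
        show ?thesis
        proof (cases w)
          case Bot
          then have "v = Bot" using rw by (metis root_None)
          moreover have "null x" using xw Bot inf_BotD by simp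
          ultimately show ?thesis by blast
        next
          case (PVar y)
          then have "v = PVar y" using rw by (cases v) auto
          moreover obtain z where "pstar x z" "below inf z w" using inf_not_Bot xw PVar by blast
          ultimately show ?thesis using PVar by auto
        next
          case (PFun f ws)
          then obtain vs where v: "v = PFun f vs" "length vs = length ws" using rw by (cases v) auto
          obtain z where z: "pstar x z" "below inf z w" using inf_not_Bot xw PFun by blast
          then obtain zs where zs: "z = PFun f zs" "length zs = length ws" "\<And>j. j < length ws \<Longrightarrow> inf (zs ! j) (ws ! j)"
            using PFun by (auto simp: list_all2_conv_all_nth)
          have "\<exists>i p u. i \<in> J \<and> quiet {j \<in> J. (i, j) \<in> r} p \<and> subt_at (ts i) p = Some u \<and>
              subt_at ?L p = Some (vs ! j) \<and> inf (zs ! j) u" if j: "j < length ws" for j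
          proof (intro exI conjI)
            show "quiet {j \<in> J. (k, j) \<in> r} (p @ [j])"
              using silent quiet unfolding quiet_def by (auto simp: strict_prefix_def)
            show "subt_at (ts k) (p @ [j]) = Some (ws ! j)" "subt_at ?L (p @ [j]) = Some (vs ! j)"
              using w *(4) v PFun j by (auto simp: subt_at_append)
          qed (use k zs j in auto)
          then have "below (\<lambda>a b. (\<exists>x v. a = x \<and> b = v \<and> (\<exists>i p u. i \<in> J \<and> quiet {j \<in> J. (i, j) \<in> r} p \<and>
              subt_at (ts i) p = Some u \<and> subt_at ?L p = Some v \<and> inf x u)) \<or> inf a b) z v"
            unfolding zs v by (intro below_FunI) (use zs v in auto)
          then show ?thesis using z by blast
        qed
      qed
    qed
    then show ?thesis using i p u v inf_refl by blast
  qed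
  then show ?thesis using v root[OF i p u v] by blast
qed

lemma tracks: "k \<in> Field r \<Longrightarrow> (i, k) \<in> r \<Longrightarrow> tracks i k"
proof -
  have "wf (r - Id)" using wo unfolding well_order_on_def by blast
  then have "\<forall>i. k \<in> Field r \<longrightarrow> (i, k) \<in> r \<longrightarrow> tracks i k" for k
  proof (induction k rule: wf_induct_rule)
    case (less k)
    show ?case
    proof (intro allI impI)
      fix i
      assume k: "k \<in> Field r" and ik: "(i, k) \<in> r"
      have i: "i \<in> Field r" using ik by (rule FieldI1)
      show "tracks i k"
      proof (cases "i = k")
        case True
        then show ?thesis unfolding tracks_def using inf_refl antisym by blast
      next
        case False
        show ?thesis
        proof (cases "\<exists>j\<in>Field r. lt j k \<and> \<not> (\<exists>l\<in>Field r. lt j l \<and> lt l k)")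
          case True
          then obtain j where j: "j \<in> Field r" "lt j k" "\<And>l. l \<in> Field r \<Longrightarrow> lt j l \<Longrightarrow> \<not> lt l k" by blast
          have step: "rstep R (ts j) (ps j) (ts k)" using step j k by blast
          have ij: "(i, j) \<in> r" using linear[OF i j(1)] j(3)[OF i] ik False by blast
          then have ij_tracks: "tracks i j" using less[of j] j by blast
          show ?thesis unfolding tracks_def
          proof (intro allI impI)
            fix p u
            assume q: "quiet {j. (i, j) \<in> r \<and> lt j k} p" and u: "subt_at (ts i) p = Some u"
            have sub: "{l. (i, l) \<in> r \<and> lt l j} \<subseteq> {l. (i, l) \<in> r \<and> lt l k}"
              using j lt_le_trans by blast
            then have "quiet {l. (i, l) \<in> r \<and> lt l j} p" using q unfolding quiet_def by blast
            then obtain v where v: "subt_at (ts j) p = Some v" "inf u v"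
              "(\<forall>l. (i, l) \<in> r \<longrightarrow> lt l j \<longrightarrow> ps l \<noteq> p) \<longrightarrow> root u = root v"
              using ij_tracks u unfolding tracks_def by blast
            have "\<not> strict_prefix (ps j) p" using q ij j unfolding quiet_def by blast
            then obtain v' where v': "subt_at (ts k) p = Some v'" "par v v'" "ps j \<noteq> p \<longrightarrow> root v = root v'"
              using rstep_at[OF step _ v(1)] by blast
            then show "\<exists>v. subt_at (ts k) p = Some v \<and> inf u v \<and>
                ((\<forall>j. (i, j) \<in> r \<longrightarrow> lt j k \<longrightarrow> ps j \<noteq> p) \<longrightarrow> root u = root v)"
            proof (intro exI conjI impI)
              show "inf u v'" using inf_par v v' by blast
              assume silent: "\<forall>j. (i, j) \<in> r \<longrightarrow> lt j k \<longrightarrow> ps j \<noteq> p"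
              then have "root u = root v" using v(3) sub by blast
              moreover have "root v = root v'" using v'(3) silent ij j(2) by blast
              ultimately show "root u = root v'" by simp
            qed
          qed
        next
          case no_pred: False
          let ?J = "{j \<in> Field r. lt j k}"
          have "\<exists>j\<in>Field r. lt j k" using ik False i by blast
          then have L: "ts k = liminf_bot r ?J ctxt"
            using conv_limit k no_pred by blast
          show ?thesis unfolding tracks_def
          proof (intro allI impI)
            fix p u
            assume q: "quiet {j. (i, j) \<in> r \<and> lt j k} p" and u: "subt_at (ts i) p = Some u"
            have "\<exists>v. subt_at (liminf_bot r ?J ctxt) p = Some v \<and> inf u v \<and>
                ((\<forall>j\<in>?J. (i, j) \<in> r \<longrightarrow> ps j \<noteq> p) \<longrightarrow> root u = root v)"
            proof (rule limit)
              show "quiet {j \<in> ?J. (i, j) \<in> r} p" using q unfolding quiet_def by blast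
              show "x \<in> ?J" if "y \<in> ?J" "(x, y) \<in> r" for x y
                using that le_lt_trans[of x y k] FieldI1[of x y r] by blast
              show "\<exists>y\<in>?J. lt x y" if "x \<in> ?J" for x using no_pred that by blast
              show "tracks x y" if "y \<in> ?J" "(x, y) \<in> r" for x y using less[of y] that by blast
            qed (use ik False i u in auto)
            then show "\<exists>v. subt_at (ts k) p = Some v \<and> inf u v \<and>
                ((\<forall>j. (i, j) \<in> r \<longrightarrow> lt j k \<longrightarrow> ps j \<noteq> p) \<longrightarrow> root u = root v)"
              unfolding L by blast
          qed
        qed
      qed
    qed
  qed
  then show "k \<in> Field r \<Longrightarrow> (i, k) \<in> r \<Longrightarrow> tracks i k" by blast
qed

text \<open>The root is quiet for every set of steps, so tracking from the first index relates
  \<open>t\<close> to all later terms; the last step, or one more use of \<open>limit\<close>, leads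
  to \<open>s\<close>.\<close>

theorem p_conv_inf: "inf t s"
proof (cases "Field r = {}")
  case True
  then have "s = t" using conv_empty by blast
  then show ?thesis using inf_refl by simp
next
  case False
  then obtain x where "x \<in> Field r" by blast
  then obtain i where i: "i \<in> Field r" "\<And>j. j \<in> Field r \<Longrightarrow> (i, j) \<in> r"
    using least[of x "\<lambda>_. True"] by metis
  then have t: "ts i = t" using conv_first by blast
  have quiet: "quiet A []" for A unfolding quiet_def by simp
  show ?thesis
  proof (cases "\<exists>m\<in>Field r. \<forall>j\<in>Field r. (j, m) \<in> r")
    case True
    then obtain m where m: "m \<in> Field r" "\<forall>j\<in>Field r. (j, m) \<in> r" by blast
    then have "rstep R (ts m) (ps m) s" using conv_closed by blast
    moreover have "inf t (ts m)"
      using tracks[OF m(1) i(2)[OF m(1)], unfolded tracks_def, THEN spec, of "[]"] quiet t by simp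
    ultimately show ?thesis using inf_par rstep_par by blast
  next
    case no_max: False
    then have L: "s = liminf_bot r (Field r) ctxt"
      using conv_open False by blast
    have "\<exists>v. subt_at (liminf_bot r (Field r) ctxt) [] = Some v \<and> inf t v \<and>
        ((\<forall>j\<in>Field r. (i, j) \<in> r \<longrightarrow> ps j \<noteq> []) \<longrightarrow> root t = root v)"
    proof (rule limit)
      show "x \<in> Field r" if "(x, y) \<in> r" for x y using that by (rule FieldI1)
      show "\<exists>y\<in>Field r. lt x y" if "x \<in> Field r" for x using no_max linear that by blast
    qed (use i t quiet tracks in auto)
    then show ?thesis using L by simp
  qed
qed

end

subsection \<open>Finite reductions\<close>

context orthogonal_trs
begin

text \<open>Positions are recorded because the limit of a reduction depends on the contexts of its
  steps and not only on its terms.\<close>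

inductive run :: "('f, 'v) pterm \<Rightarrow> pos list \<Rightarrow> ('f, 'v) pterm \<Rightarrow> bool" where
  run_Nil: "run t [] t"
| run_Cons: "rstep R t p u \<Longrightarrow> run u ps s \<Longrightarrow> run t (p # ps) s"

lemma run_append: "run t ps u \<Longrightarrow> run u qs s \<Longrightarrow> run t (ps @ qs) s"
  by (induction rule: run.induct) (auto intro: run_Cons)

lemma run_single: "rstep R t p u \<Longrightarrow> run t [p] u"
  by (auto intro: run.intros)

lemma run_pstar: "run t ps s \<Longrightarrow> pstar t s"
proof (induction rule: run.induct)
  case (run_Cons t p u ps s)
  then show ?case using rstep_par by (meson converse_rtranclp_into_rtranclp)
qed simp

lemma run_arg:
  "run u ps v \<Longrightarrow> k < length ts \<Longrightarrow> ts ! k = u \<Longrightarrow> run (PFun f ts) (map ((#) k) ps) (PFun f (ts[k := v]))"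
proof (induction arbitrary: ts rule: run.induct)
  case (run_Nil t)
  then have "ts[k := t] = ts" by auto
  then show ?case by (simp add: run.run_Nil)
next
  case (run_Cons t p u ps s)
  have "rstep R (PFun f ts) (k # p) (PFun f (ts[k := u]))"
    unfolding rstep_Cons using run_Cons.hyps run_Cons.prems by blast
  moreover have "run (PFun f (ts[k := u])) (map ((#) k) ps) (PFun f (ts[k := s]))"
    using run_Cons.IH[of "ts[k := u]"] run_Cons.prems by simp
  ultimately show ?case by (simp add: run.run_Cons)
qed

text \<open>The position list is explicit so that \<open>proj\<close> can later recover the run of
  each argument from it.\<close>

lemma run_args:
  assumes "length us = length ts" "\<And>k. k < length ts \<Longrightarrow> run (ts ! k) (pss k) (us ! k)"
  shows "run (PFun f ts) (concat (map (\<lambda>k. map ((#) k) (pss k)) [0..<length ts])) (PFun f us)"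
proof -
  have "run (PFun f ts) (concat (map (\<lambda>k. map ((#) k) (pss k)) [0..<m])) (PFun f (take m us @ drop m ts))"
    if "m \<le> length ts" for m
    using that
  proof (induction m)
    case 0
    then show ?case by (simp add: run_Nil)
  next
    case (Suc m)
    let ?xs = "take m us @ drop m ts"
    have m: "m < length ?xs" "?xs ! m = ts ! m" using Suc.prems assms(1) by (auto simp: nth_append)
    have "?xs[m := us ! m] = take (Suc m) us @ drop (Suc m) ts"
      using Suc.prems assms(1)
      by (intro nth_equalityI) (auto simp: nth_append nth_list_update less_Suc_eq)
    then have "run (PFun f ?xs) (map ((#) m) (pss m)) (PFun f (take (Suc m) us @ drop (Suc m) ts))"
      using run_arg[OF assms(2)[of m], of m "?xs" f] Suc.prems m by simp
    then show ?case using run_append[OF Suc.IH] Suc.prems by simp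
  qed
  from this[of "length ts"] show ?thesis using assms(1) by simp
qed

section \<open>Reaching root-stable terms by finitely many single steps\<close>

definition runs :: "('f, 'v) pterm \<Rightarrow> ('f, 'v) pterm \<Rightarrow> bool" where
  "runs t s \<longleftrightarrow> (\<exists>ps. run t ps s)"

lemma runs_refl: "runs t t"
  unfolding runs_def using run_Nil by blast

lemma runs_trans: "runs t u \<Longrightarrow> runs u s \<Longrightarrow> runs t s"
  unfolding runs_def using run_append by blast

lemma runs_rootstep: "rootstep t s \<Longrightarrow> runs t s"
  unfolding runs_def using run_single[of t "[]" s] rstep_Nil by blast

lemma below_runs: "below runs t s \<Longrightarrow> runs t s"
proof (erule below.cases)
  fix ts ss f
  assume t: "t = PFun f ts" "s = PFun f ss" and "list_all2 runs ts ss"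
  then have "\<forall>k<length ts. \<exists>ps. run (ts ! k) ps (ss ! k)" "length ss = length ts"
    unfolding runs_def by (auto simp: list_all2_conv_all_nth)
  then obtain pss where "\<And>k. k < length ts \<Longrightarrow> run (ts ! k) (pss k) (ss ! k)" by metis
  then show ?thesis using run_args[of ss ts pss f] \<open>length ss = length ts\<close> t unfolding runs_def by blast
qed (auto simp: runs_refl)

text \<open>A parallel step with infinitely many redexes is not a finite run. Only the redexes
  needed to expose patterns at the root are contracted one by one; all others are postponed below
  the root within the same count.\<close>

definition finitize :: "nat \<Rightarrow> bool" where
  "finitize n \<longleftrightarrow> (\<forall>t s. (par ^^ n) t s \<longrightarrow> (\<exists>w. runs t w \<and> below (par ^^ n) w s))"

lemma finitize_subpat:
  assumes n: "finitize n" and "finite_term p" "subpat p" "(par ^^ n) t (subst \<sigma> p)"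
  shows "\<exists>\<tau>. runs t (subst \<tau> p) \<and> (\<forall>x\<in>set2_pterm p. (par ^^ n) (\<tau> x) (\<sigma> x))"
  using assms(2-)
proof (induction p arbitrary: t rule: finite_term.induct)
  case (1 x)
  then show ?case by (intro exI[of _ "\<lambda>_. t"]) (simp add: runs_refl)
next
  case 2
  then show ?case using subpat_not_Bot by blast
next
  case (3 ps f)
  then obtain w where tw: "runs t w" and "below (par ^^ n) w (subst \<sigma> (PFun f ps))"
    using n unfolding finitize_def by blast
  then obtain ws where w: "w = PFun f ws" "length ws = length ps"
    and ws: "\<And>k. k < length ps \<Longrightarrow> (par ^^ n) (ws ! k) (subst \<sigma> (ps ! k))"
    by (auto simp: list_all2_conv_all_nth)
  have "\<forall>k<length ps. \<exists>\<tau>. runs (ws ! k) (subst \<tau> (ps ! k)) \<and> (\<forall>x\<in>set2_pterm (ps ! k). (par ^^ n) (\<tau> x) (\<sigma> x))"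
    using 3 ws subpat_arg by (metis nth_mem)
  then obtain \<tau>s where \<tau>s: "\<forall>k<length ps. runs (ws ! k) (subst (\<tau>s k) (ps ! k)) \<and>
      (\<forall>x\<in>set2_pterm (ps ! k). (par ^^ n) (\<tau>s k x) (\<sigma> x))" by metis
  obtain \<tau> where \<tau>: "\<forall>k<length ps. \<forall>x\<in>set2_pterm (ps ! k). \<tau> x = \<tau>s k x"
    using combine_substs[OF subpat_linear[OF 3(3)], of \<tau>s] by blast
  have "subst (\<tau>s k) (ps ! k) = subst \<tau> (ps ! k)" if "k < length ps" for k
    using \<tau> that subst_cong[of "ps ! k" \<tau> "\<tau>s k"] by simp
  then have "below runs w (subst \<tau> (PFun f ps))" using w \<tau>s by (auto simp: list_all2_conv_all_nth)
  then have "runs t (subst \<tau> (PFun f ps))" using tw below_runs runs_trans by blast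
  moreover have "\<forall>x\<in>set2_pterm (PFun f ps). (par ^^ n) (\<tau> x) (\<sigma> x)"
    using \<tau>s \<tau> by (auto simp: in_set_conv_nth)
  ultimately show ?case by blast
qed

lemma finitize_lhs:
  assumes n: "finitize n" and R: "(l, r) \<in> R" and w: "below (par ^^ n) w (subst \<sigma> l)"
  shows "\<exists>\<tau>. runs w (subst \<tau> l) \<and> (\<forall>x\<in>set2_pterm l. (par ^^ n) (\<tau> x) (\<sigma> x))"
proof -
  obtain f ls where l: "l = PFun f ls" using R by (rule lhs_Fun)
  then obtain ws where ws: "w = PFun f ws" "length ws = length ls"
    "\<And>k. k < length ls \<Longrightarrow> (par ^^ n) (ws ! k) (subst \<sigma> (ls ! k))"
    using w by (auto simp: list_all2_conv_all_nth)
  have "\<exists>\<tau>. below runs (PFun f ws) (subst \<tau> (PFun f ls)) \<and> (\<forall>x\<in>set2_pterm (PFun f ls). (par ^^ n) (\<tau> x) (\<sigma> x))"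
    using R l ws subpat_lhs_arg subpat_finite
    by (intro lhs_combine[where P = "\<lambda>x y. (par ^^ n) y (\<sigma> x)"]) (auto intro!: finitize_subpat[OF n])
  then show ?thesis using ws l below_runs by blast
qed

lemma finitize: "finitize n"
proof (induction n)
  case 0
  have "below (par ^^ 0) t t" for t by (rule below_refl) simp
  then show ?case unfolding finitize_def using runs_refl by auto
next
  case (Suc n)
  show ?case unfolding finitize_def
  proof (intro allI impI)
    fix t s
    assume "(par ^^ Suc n) t s"
    then obtain u where tu: "(par ^^ n) t u" and us: "par u s" by auto
    obtain w where tw: "runs t w" and wu: "below (par ^^ n) w u"
      using Suc tu unfolding finitize_def by blast
    from us show "\<exists>w. runs t w \<and> below (par ^^ Suc n) w s"
    proof (cases rule: par_cases)
      case below
      with wu have "below (par ^^ n OO par) w s" by (rule below_OO_I)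
      then show ?thesis using tw by auto
    next
      case (root l r \<sigma>)
      obtain \<tau> where \<tau>: "runs w (subst \<tau> l)" "\<forall>x\<in>set2_pterm l. (par ^^ n) (\<tau> x) (\<sigma> x)"
        using finitize_lhs[OF Suc root(1)] wu root(2) by blast
      have "runs (subst \<tau> l) (subst \<tau> r)"
        using root(1) by (intro runs_rootstep) (auto simp: rootstep_def)
      then have tr: "runs t (subst \<tau> r)" using tw \<tau>(1) runs_trans by blast
      \<comment> \<open>The postponed steps lie inside the substitution, so they take
        \<open>n\<close> steps in the right-hand side as well, and the induction hypothesis applies
        a second time.\<close>
      have "(par ^^ n) (subst \<tau> r) s" unfolding root(3)
        using \<tau>(2) vars_rhs[OF root(1)] by (intro relpow_subst) blast
      then obtain v where v: "runs (subst \<tau> r) v" "below (par ^^ n) v s"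
        using Suc unfolding finitize_def by blast
      have "below (par ^^ Suc n) v s" using v(2) by (rule below_weaken) (auto intro: relpow_pad)
      then show ?thesis using tr v(1) runs_trans by blast
    qed
  qed
qed

text \<open>The run stops at a term that lacks only steps below the root to reach the root-stable
  \<open>z\<close>; \<open>rst_expand\<close> pulls root-stability back to it.\<close>

lemma runs_rst:
  assumes "\<not> null t"
  shows "\<exists>w. runs t w \<and> rst w"
proof -
  obtain z n where z: "(par ^^ n) t z" "rst z" using assms unfolding null_def rtranclp_power by blast
  then obtain w where "runs t w" "below (par ^^ n) w z" using finitize unfolding finitize_def by blast
  then show ?thesis using rst_expand[OF below_relpow_pstar] z(2) by blast
qed

lemma runs_null:
  assumes "null t" "t \<noteq> Bot"
  shows "\<exists>u v. runs t u \<and> rootstep u v"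
proof -
  obtain m l r \<rho> where R: "(l, r) \<in> R" "below (par ^^ m) t (subst \<rho> l)"
    using assms by (rule null_reaches)
  then obtain \<tau> where "runs t (subst \<tau> l)" using finitize_lhs finitize by blast
  then show ?thesis unfolding rootstep_def using R(1) by blast
qed

subsection \<open>A fair reduction to the normal form\<close>

definition proj :: "nat \<Rightarrow> pos list \<Rightarrow> pos list" where
  "proj k ps = map tl (filter (\<lambda>p. p \<noteq> [] \<and> hd p = k) ps)"

lemma set_proj: "q \<in> set (proj k ps) \<longleftrightarrow> k # q \<in> set ps"
  unfolding proj_def by (auto simp: image_iff)

lemma proj_append: "proj k (ps @ qs) = proj k ps @ proj k qs"
  unfolding proj_def by simp

lemma proj_map: "proj k (map ((#) j) ps) = (if j = k then ps else [])"
  unfolding proj_def by (induction ps) auto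

lemma proj_concat: "proj k (concat (map (\<lambda>j. map ((#) j) (pss j)) [0..<n])) = (if k < n then pss k else [])"
proof (induction n)
  case (Suc n)
  then show ?case by (auto simp: proj_append proj_map)
qed (simp add: proj_def)

text \<open>A round of depth \<open>n\<close> makes every nonnull subterm down to depth \<open>n\<close> root-stable, without
  touching the positions where this holds already, and contracts at least one redex at the root of
  every null subterm other than \<open>Bot\<close> it meets.\<close>

fun round :: "nat \<Rightarrow> ('f, 'v) pterm \<Rightarrow> pos list \<Rightarrow> ('f, 'v) pterm \<Rightarrow> bool" where
  "round 0 u ps u' \<longleftrightarrow> ps = [] \<and> u' = u"
| "round (Suc n) u ps u' \<longleftrightarrow>
    (if null u then run u ps u' \<and> (u = Bot \<or> [] \<in> set ps)
     else \<exists>ps0 w ps1. run u ps0 w \<and> rst w \<and> (rst u \<longrightarrow> ps0 = []) \<and> ps = ps0 @ ps1 \<and>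
       run w ps1 u' \<and> [] \<notin> set ps1 \<and>
       ((\<exists>x. w = PVar x \<and> u' = PVar x) \<or>
        (\<exists>f ws us. w = PFun f ws \<and> u' = PFun f us \<and> length us = length ws \<and>
           (\<forall>k<length ws. round n (ws ! k) (proj k ps1) (us ! k)))))"

lemma round_run: "round n u ps u' \<Longrightarrow> run u ps u'"
  by (cases n) (auto intro: run_Nil run_append split: if_splits)

lemma round_exists: "\<exists>ps u'. round n u ps u'"
proof (induction n arbitrary: u)
  case 0
  have "round 0 u [] u" by simp
  then show ?case by blast
next
  case (Suc n)
  show ?case
  proof (cases "null u")
    case True
    show ?thesis
    proof (cases "u = Bot")
      case True
      then have "round (Suc n) u [] u" using null_Bot by (simp add: run_Nil)
      then show ?thesis by blast
    next
      case False
      then obtain ps v v' where "run u ps v" "rootstep v v'"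
        using runs_null[OF True] unfolding runs_def by blast
      then have "run u (ps @ [[]]) v'" using run_append run_single rstep_Nil by blast
      then have "round (Suc n) u (ps @ [[]]) v'" using True by simp
      then show ?thesis by blast
    qed
  next
    case False
    obtain ps0 w where w: "run u ps0 w" "rst w" "rst u \<longrightarrow> ps0 = []"
    proof (cases "rst u")
      case True
      then show thesis using that[of "[]" u] run_Nil by blast
    next
      case False
      then show thesis using runs_rst[OF \<open>\<not> null u\<close>] that unfolding runs_def by blast
    qed
    show ?thesis
    proof (cases w)
      case (PVar x)
      then have "round (Suc n) u ps0 w"
        unfolding round.simps using False w run_Nil[of w] PVar
        by (simp, intro exI[of _ ps0] exI[of _ "PVar x"] exI[of _ "[]"]) simp
      then show ?thesis by blast
    next
      case Bot
      then show ?thesis using w rst_not_redex by blast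
    next
      case (PFun f ws)
      have "\<forall>k. \<exists>ps u'. round n (ws ! k) ps u'" using Suc by blast
      then obtain pss us where rounds: "\<And>k. round n (ws ! k) (pss k) (us k)" by metis
      define ps1 where "ps1 = concat (map (\<lambda>k. map ((#) k) (pss k)) [0..<length ws])"
      let ?us = "map us [0..<length ws]"
      have run: "run w ps1 (PFun f ?us)"
        unfolding PFun ps1_def
      proof (rule run_args)
        fix k
        assume "k < length ws"
        then show "run (ws ! k) (pss k) (?us ! k)" using round_run[OF rounds[of k]] by simp
      qed simp
      have "[] \<notin> set ps1" unfolding ps1_def by auto
      moreover have "round n (ws ! k) (proj k ps1) (?us ! k)" if "k < length ws" for k
        unfolding ps1_def proj_concat using rounds that by simp
      ultimately have "round (Suc n) u (ps0 @ ps1) (PFun f ?us)"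
        unfolding round.simps using False w run PFun by (simp, blast)
      then show ?thesis by blast
    qed
  qed
qed

text \<open>The criterion of \<open>omega_conv\<close> at one position, counted in rounds. A
  \<open>Bot\<close> of \<open>N\<close> has two origins: a null subterm whose root is contracted in
  every late round, or an actual \<open>Bot\<close> left in place.\<close>

definition settles :: "(nat \<Rightarrow> ('f, 'v) pterm) \<Rightarrow> (nat \<Rightarrow> pos list) \<Rightarrow> ('f, 'v) pterm \<Rightarrow> pos \<Rightarrow> bool" where
  "settles u ps N p \<longleftrightarrow>
    (\<forall>a. symat N p = Some a \<longrightarrow>
      (\<exists>m. \<forall>n\<ge>m. symat (u n) p = Some a \<and> (\<forall>q\<in>set (ps n). \<not> prefix q p))) \<and>
    (subt_at N p = Some Bot \<longrightarrow>
      (\<exists>m. \<forall>n\<ge>m. p \<in> set (ps n)) \<or>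
      (\<exists>m. \<forall>n\<ge>m. subt_at (u n) p = Some Bot \<and> (\<forall>q\<in>set (ps n). \<not> prefix q p)))"

lemma run_Bot: "run Bot ps u \<Longrightarrow> ps = [] \<and> u = Bot"
proof (erule run.cases)
  fix t p v qs s
  assume "Bot = t" "rstep R t p v"
  then show ?thesis using rstep_Nil rstep_Cons redex_not_Bot
    by (cases p) (auto simp: rootstep_def redex_def)
qed auto

lemma rounds_pstar:
  assumes "\<And>n. round (n + d) (u n) (ps n) (u (Suc n))"
  shows "pstar (u 0) (u n)"
proof (induction n)
  case (Suc n)
  then show ?case using run_pstar[OF round_run[OF assms[of n]]] by (rule rtranclp_trans)
qed simp

lemma rounds_null_settle:
  assumes rounds: "\<And>n. round (n + d) (u n) (ps n) (u (Suc n))" and null: "null (u 0)"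
  shows "settles u ps Bot p"
proof -
  have run: "run (u n) (ps n) (u (Suc n))" for n using rounds round_run by blast
  have null: "null (u n)" for n
    using null null_pstar_iff[OF rounds_pstar[of d u ps, OF rounds]] by blast
  have "(\<exists>m. \<forall>n\<ge>m. [] \<in> set (ps n)) \<or> (\<exists>m. \<forall>n\<ge>m. u n = Bot \<and> ps n = [])"
  proof (cases "\<exists>m. u m = Bot")
    case True
    then obtain m where m: "u m = Bot" by blast
    have Bot: "u n = Bot" if "m \<le> n" for n
      using that
    proof (induction n rule: dec_induct)
      case (step n)
      then show ?case using run[of n] run_Bot by simp
    qed (rule m)
    then have "ps n = []" if "m \<le> n" for n using run[of n] run_Bot that by simp
    then show ?thesis using Bot by blast
  next
    case False
    \<comment> \<open>From index 1 on the depth \<open>n + d\<close> is positive; a round of depth 0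
      does nothing.\<close>
    have "[] \<in> set (ps n)" if "1 \<le> n" for n
    proof -
      have "n + d = Suc (n - 1 + d)" using that by simp
      then have "round (Suc (n - 1 + d)) (u n) (ps n) (u (Suc n))" using rounds[of n] by simp
      then show ?thesis using null False by simp
    qed
    then show ?thesis by blast
  qed
  then show ?thesis unfolding settles_def by (cases p) auto
qed

text \<open>The bound 2 is a delay: round 0 has depth 0 if \<open>d = 0\<close>, and round 1 makes
  the root stable. From then on the initial part \<open>ps0\<close> of a round is empty.\<close>

lemma rounds_rst:
  assumes rounds: "\<And>n. round (n + d) (u n) (ps n) (u (Suc n))" and null: "\<not> null (u 0)" and n: "2 \<le> n"
  shows "rst (u n)" "[] \<notin> set (ps n)"
    "(\<exists>x. u n = PVar x \<and> u (Suc n) = PVar x) \<or>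
     (\<exists>f ws us. u n = PFun f ws \<and> u (Suc n) = PFun f us \<and> length us = length ws \<and>
       (\<forall>k<length ws. round (n + d - 1) (ws ! k) (proj k (ps n)) (us ! k)))"
proof -
  have run: "run (u n) (ps n) (u (Suc n))" for n using rounds round_run by blast
  have null: "\<not> null (u n)" for n
    using null null_pstar_iff[OF rounds_pstar[of d u ps, OF rounds]] by blast
  have ex: "\<exists>ps0 w ps1. run (u n) ps0 w \<and> rst w \<and> (rst (u n) \<longrightarrow> ps0 = []) \<and> ps n = ps0 @ ps1 \<and>
       run w ps1 (u (Suc n)) \<and> [] \<notin> set ps1 \<and>
       ((\<exists>x. w = PVar x \<and> u (Suc n) = PVar x) \<or>
        (\<exists>f ws us. w = PFun f ws \<and> u (Suc n) = PFun f us \<and> length us = length ws \<and>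
           (\<forall>k<length ws. round (n + d - 1) (ws ! k) (proj k ps1) (us ! k))))" if "1 \<le> n" for n
  proof -
    have "n + d = Suc (n + d - 1)" using that by simp
    then have "round (Suc (n + d - 1)) (u n) (ps n) (u (Suc n))" using rounds[of n] by simp
    then show ?thesis using null[of n] by simp
  qed
  obtain j where j: "n = Suc j" "1 \<le> j" using n by (cases n) auto
  obtain w ps1 where "run w ps1 (u (Suc j))" "rst w" using ex[OF j(2)] by blast
  then show rst: "rst (u n)" using rst_pstar run_pstar j by blast
  obtain ps0 w ps1 where *: "run (u n) ps0 w" "ps0 = []" "ps n = ps0 @ ps1" "[] \<notin> set ps1"
      "(\<exists>x. w = PVar x \<and> u (Suc n) = PVar x) \<or>
        (\<exists>f ws us. w = PFun f ws \<and> u (Suc n) = PFun f us \<and> length us = length ws \<and>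
           (\<forall>k<length ws. round (n + d - 1) (ws ! k) (proj k ps1) (us ! k)))"
    using ex[of n] n rst by auto
  then have "u n = w" "ps n = ps1" by (auto elim: run.cases)
  then show "[] \<notin> set (ps n)" "(\<exists>x. u n = PVar x \<and> u (Suc n) = PVar x) \<or>
     (\<exists>f ws us. u n = PFun f ws \<and> u (Suc n) = PFun f us \<and> length us = length ws \<and>
       (\<forall>k<length ws. round (n + d - 1) (ws ! k) (proj k (ps n)) (us ! k)))"
    using * by simp_all
qed

fun arg :: "nat \<Rightarrow> ('f, 'v) pterm \<Rightarrow> ('f, 'v) pterm" where
  "arg k (PFun f ts) = ts ! k"
| "arg k (PVar x) = Bot"
| "arg k Bot = Bot"

text \<open>Induction on the position. Argument \<open>k\<close> is followed from index 2 on, when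
  the root no longer changes: a round of depth \<open>n + 2 + d\<close> at the root has depth
  \<open>n + (d + 1)\<close> in the argument. This shift is the reason for the offset
  \<open>d\<close>.\<close>

lemma rounds_settle:
  assumes "\<And>n. round (n + d) (u n) (ps n) (u (Suc n))"
  shows "settles u ps (NF (u 0)) p"
  using assms
proof (induction p arbitrary: u ps d)
  case (Nil u ps d)
  show ?case
  proof (cases "null (u 0)")
    case True
    then show ?thesis using rounds_null_settle[of d u ps] Nil NF_null by simp
  next
    case False
    note rst = rounds_rst[of d u ps, OF Nil False]
    have root: "root (u n) = root (u 2)" if "2 \<le> n" for n
      using that
    proof (induction n rule: dec_induct)
      case (step n)
      then show ?case using rst(3)[of n] by auto
    qed simp
    have "NF (u 0) = NF (u 2)" using rounds_pstar[of d u ps, OF Nil] by (rule NF_pstar)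
    moreover have "below (\<lambda>a b. b = NF a) (u 2) (NF (u 2))" using rst(1) NF_rst by simp
    then have "root (NF (u 2)) = root (u 2)" by (auto elim!: below.cases simp: list_all2_lengthD)
    ultimately have N: "root (NF (u 0)) = root (u 2)" by simp
    have "u 2 \<noteq> Bot" using rst(1) rst_not_redex by simp
    then have "NF (u 0) \<noteq> Bot" using N by (metis root_None)
    moreover have "symat (u n) [] = root (NF (u 0)) \<and> (\<forall>q\<in>set (ps n). \<not> prefix q [])" if "2 \<le> n" for n
      using N root[OF that] rst(2)[OF that] by auto
    ultimately show ?thesis unfolding settles_def by (auto intro!: exI[of _ 2])
  qed
next
  case (Cons k p u ps d)
  show ?case
  proof (cases "null (u 0)")
    case True
    then show ?thesis using rounds_null_settle[of d u ps] Cons.prems NF_null by simp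
  next
    case False
    note rst = rounds_rst[of d u ps, OF Cons.prems False]
    have N: "NF (u 0) = NF (u 2)" using rounds_pstar[of d u ps, OF Cons.prems] by (rule NF_pstar)
    have below: "below (\<lambda>a b. b = NF a) (u 2) (NF (u 0))" unfolding N using rst(1) NF_rst by simp
    show ?thesis
    proof (cases "\<exists>f ws. u 2 = PFun f ws \<and> k < length ws")
      case False
      then have "symat (NF (u 0)) (k # p) = None" "subt_at (NF (u 0)) (k # p) = None"
        using below by (auto elim!: below.cases simp: list_all2_lengthD)
      then show ?thesis unfolding settles_def by simp
    next
      case True
      then obtain f ws where ws: "u 2 = PFun f ws" "k < length ws" by blast
      have shape: "\<exists>us. u n = PFun f us \<and> length us = length ws" if "2 \<le> n" for n
        using that
      proof (induction n rule: dec_induct)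
        case (step n)
        then show ?case using rst(3)[of n] by auto
      qed (use ws in simp)
      define u' where "u' n = arg k (u (n + 2))" for n
      have "round (n + (d + 1)) (u' n) (proj k (ps (n + 2))) (u' (Suc n))" for n
      proof -
        obtain us where us: "u (n + 2) = PFun f us" "length us = length ws" using shape[of "n + 2"] by auto
        then obtain vs where "u (Suc (n + 2)) = PFun f vs" "round (n + 2 + d - 1) (us ! k) (proj k (ps (n + 2))) (vs ! k)"
          using rst(3)[of "n + 2"] ws by auto
        then show ?thesis unfolding u'_def using us by simp
      qed
      then have IH: "settles u' (\<lambda>n. proj k (ps (n + 2))) (NF (u' 0)) p" by (rule Cons.IH)
      have "u' 0 = ws ! k" unfolding u'_def using ws by (simp add: numeral_2_eq_2)
      then obtain Ns where Ns: "NF (u 0) = PFun f Ns" "length Ns = length ws" "Ns ! k = NF (u' 0)"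
        using below ws by (auto simp: list_all2_conv_all_nth)
      have at: "symat (u n) (k # q) = symat (u' (n - 2)) q" "subt_at (u n) (k # q) = subt_at (u' (n - 2)) q"
        if n: "2 \<le> n" for n q
      proof -
        obtain us where "u n = PFun f us" "length us = length ws" using shape[OF n] by auto
        moreover have "n - 2 + 2 = n" using n by simp
        ultimately show "symat (u n) (k # q) = symat (u' (n - 2)) q"
          "subt_at (u n) (k # q) = subt_at (u' (n - 2)) q" unfolding u'_def using ws by simp_all
      qed
      have silent: "\<forall>q\<in>set (ps n). \<not> prefix q (k # p)"
        if n: "2 \<le> n" and sil: "\<forall>q\<in>set (proj k (ps (n - 2 + 2))). \<not> prefix q p" for n
      proof
        fix q
        assume q: "q \<in> set (ps n)"
        have "n - 2 + 2 = n" using n by simp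
        then show "\<not> prefix q (k # p)" using sil q rst(2)[OF n] by (cases q) (auto simp: set_proj)
      qed
      show ?thesis unfolding settles_def
      proof (intro conjI allI impI)
        fix a
        assume "symat (NF (u 0)) (k # p) = Some a"
        then have "symat (NF (u' 0)) p = Some a" using Ns ws by simp
        then obtain m where m: "\<forall>n\<ge>m. symat (u' n) p = Some a \<and> (\<forall>q\<in>set (proj k (ps (n + 2))). \<not> prefix q p)"
          using IH unfolding settles_def by blast
        have "symat (u n) (k # p) = Some a \<and> (\<forall>q\<in>set (ps n). \<not> prefix q (k # p))" if n: "m + 2 \<le> n" for n
        proof -
          have "2 \<le> n" "m \<le> n - 2" using n by auto
          then show ?thesis using m at(1)[of n p] silent[of n] by simp
        qed
        then show "\<exists>m. \<forall>n\<ge>m. symat (u n) (k # p) = Some a \<and> (\<forall>q\<in>set (ps n). \<not> prefix q (k # p))" by blast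
      next
        assume "subt_at (NF (u 0)) (k # p) = Some Bot"
        then have "subt_at (NF (u' 0)) p = Some Bot" using Ns ws by simp
        then consider m where "\<forall>n\<ge>m. p \<in> set (proj k (ps (n + 2)))"
          | m where "\<forall>n\<ge>m. subt_at (u' n) p = Some Bot \<and> (\<forall>q\<in>set (proj k (ps (n + 2))). \<not> prefix q p)"
          using IH unfolding settles_def by blast
        then show "(\<exists>m. \<forall>n\<ge>m. k # p \<in> set (ps n)) \<or>
          (\<exists>m. \<forall>n\<ge>m. subt_at (u n) (k # p) = Some Bot \<and> (\<forall>q\<in>set (ps n). \<not> prefix q (k # p)))"
        proof cases
          case (1 m)
          have "k # p \<in> set (ps n)" if n: "m + 2 \<le> n" for n
          proof -
            have "m \<le> n - 2" "n - 2 + 2 = n" using n by auto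
            then show ?thesis using 1 set_proj by metis
          qed
          then show ?thesis by blast
        next
          case (2 m)
          have "subt_at (u n) (k # p) = Some Bot \<and> (\<forall>q\<in>set (ps n). \<not> prefix q (k # p))" if n: "m + 2 \<le> n" for n
          proof -
            have "2 \<le> n" "m \<le> n - 2" using n by auto
            then show ?thesis using 2 at(2)[of n p] silent[of n] by simp
          qed
          then show ?thesis by blast
        qed
      qed
    qed
  qed
qed

end

subsection \<open>Sequences of steps of length at most omega\<close>

text \<open>A labelled position of \<open>X\<close> outside \<open>N\<close> would have to leave
  \<open>N\<close> through a variable or beyond an arity, which the agreeing labels forbid, or
  through a \<open>Bot\<close> of \<open>N\<close>, where \<open>X\<close> has no label.\<close>

lemma eq_by_symat:
  assumes some: "\<And>p a. symat N p = Some a \<Longrightarrow> symat X p = Some a"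
    and bot: "\<And>p. subt_at N p = Some Bot \<Longrightarrow> symat X p = None"
  shows "N = X"
proof (rule le_bot_antisym)
  show "le_bot N X" unfolding le_bot_iff using some by blast
  have "symat X p = Some a \<Longrightarrow> symat N p = Some a" for p a
  proof (induction p arbitrary: a rule: rev_induct)
    case Nil
    have "N \<noteq> Bot" using bot[of "[]"] Nil by auto
    then obtain b where "symat N [] = Some b" by (cases N) auto
    then show ?case using some[of "[]" b] Nil by simp
  next
    case (snoc k p)
    then obtain f n where fn: "symat X p = Some (Inr (f, n))" "k < n" using symat_snoc[of X p k] by auto
    then have "symat N p = Some (Inr (f, n))" using snoc.IH by blast
    then obtain u where u: "subt_at N p = Some u" "root u = Some (Inr (f, n))"
      unfolding symat_def by (auto split: option.splits)
    then obtain us where us: "u = PFun f us" "length us = n" by (cases u) auto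
    then have sub: "subt_at N (p @ [k]) = Some (us ! k)" using u fn by (simp add: subt_at_append)
    then have "us ! k \<noteq> Bot" using bot[of "p @ [k]"] snoc.prems by auto
    then obtain b where "symat N (p @ [k]) = Some b" using sub by (cases "us ! k") (auto simp: symat_def)
    then show ?case using some[of "p @ [k]" b] snoc.prems by simp
  qed
  then show "le_bot X N" unfolding le_bot_iff by blast
qed

text \<open>A sequence may contain idle times \<open>i\<close>, where \<open>\<pi> i = None\<close>; they are left out of the index
  set of the reduction.\<close>

definition active_rel :: "(nat \<Rightarrow> pos option) \<Rightarrow> nat rel" where
  "active_rel \<pi> = natLeq \<inter> ({i. \<pi> i \<noteq> None} \<times> {i. \<pi> i \<noteq> None})"

lemma active_rel_iff: "(i, j) \<in> active_rel \<pi> \<longleftrightarrow> i \<le> j \<and> \<pi> i \<noteq> None \<and> \<pi> j \<noteq> None"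
  unfolding active_rel_def natLeq_def by auto

lemma Field_active_rel: "Field (active_rel \<pi>) = {i. \<pi> i \<noteq> None}"
proof -
  have "i \<in> Field (active_rel \<pi>)" if "\<pi> i \<noteq> None" for i
    by (rule FieldI1[of i i]) (simp add: active_rel_iff that)
  moreover have "Field (active_rel \<pi>) \<subseteq> {i. \<pi> i \<noteq> None}"
    unfolding Field_def by (auto simp: active_rel_iff)
  ultimately show ?thesis by blast
qed

lemma Well_order_active_rel: "Well_order (active_rel \<pi>)"
  unfolding active_rel_def by (rule Well_order_Restr) (rule natLeq_Well_order)

context orthogonal_trs
begin

text \<open>With infinitely many active times, the assumptions identify \<open>N\<close> with the
  limit inferior of the contexts, position by position. With finitely many, the sequence is
  eventually constant and the same assumptions force \<open>N\<close> to be its last term.\<close>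

lemma omega_conv:
  assumes steps: "\<And>i. case \<pi> i of None \<Rightarrow> v (Suc i) = v i | Some p \<Rightarrow> rstep R (v i) p (v (Suc i))"
    and some: "\<And>p a. symat N p = Some a \<Longrightarrow>
      \<exists>m. \<forall>i\<ge>m. symat (v i) p = Some a \<and> (\<forall>q. \<pi> i = Some q \<longrightarrow> \<not> prefix q p)"
    and bot: "\<And>p. subt_at N p = Some Bot \<Longrightarrow>
      (\<forall>b. \<exists>i\<ge>b. \<pi> i = Some p) \<or> (\<exists>m. \<forall>i\<ge>m. symat (v i) p = None)"
  shows "strongly_p_conv R (active_rel \<pi>) v (the \<circ> \<pi>) (v 0) N"
proof -
  have step: "rstep R (v i) (the (\<pi> i)) (v (Suc i))" if "\<pi> i \<noteq> None" for i
    using steps[of i] that by auto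
  have idle: "v j = v i" if "i \<le> j" "\<forall>k. i \<le> k \<longrightarrow> k < j \<longrightarrow> \<pi> k = None" for i j
    using that
  proof (induction j rule: dec_induct)
    case (step j)
    then have "v j = v i" "\<pi> j = None" by auto
    then show ?case using steps[of j] by simp
  qed simp
  have ended: "N = v i" if none: "\<forall>k\<ge>i. \<pi> k = None" for i
  proof (rule eq_by_symat)
    have const: "v j = v i" if "i \<le> j" for j using idle[OF that] none by simp
    fix p a
    assume "symat N p = Some a"
    then obtain m where m: "\<forall>i\<ge>m. symat (v i) p = Some a" using some by blast
    then have "symat (v (max m i)) p = Some a" by simp
    then show "symat (v i) p = Some a" using const[of "max m i"] by simp
  next
    have const: "v j = v i" if "i \<le> j" for j using idle[OF that] none by simp
    fix p
    assume "subt_at N p = Some Bot"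
    then consider "\<exists>j\<ge>i. \<pi> j = Some p" | m where "\<forall>i\<ge>m. symat (v i) p = None" using bot by blast
    then show "symat (v i) p = None"
    proof cases
      case (2 m)
      then have "symat (v (max m i)) p = None" by simp
      then show ?thesis using const[of "max m i"] by simp
    qed (use none in auto)
  qed
  let ?r = "active_rel \<pi>" and ?I = "{i. \<pi> i \<noteq> None}"
  let ?c = "\<lambda>i. replace_at (v i) ((the \<circ> \<pi>) i) Bot"
  have ctxt: "symat (?c i) p = (if prefix (the (\<pi> i)) p then None else symat (v i) p)" if "\<pi> i \<noteq> None" for i p
    using symat_context[OF rstep_subt_at[OF step[OF that]]] by simp
  have liminf: "N = liminf_bot ?r ?I ?c" if infinite: "\<forall>i. \<exists>j\<ge>i. \<pi> j \<noteq> None"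
  proof -
    have ne: "?I \<noteq> {}" using infinite by blast
    have sub: "?I \<subseteq> Field ?r" by (simp add: Field_active_rel)
    note L = symat_liminf[OF Well_order_active_rel sub ne, of ?c]
    have ev: "ev_sym ?r ?I ?c p a" if Np: "symat N p = Some a" for p a
    proof -
      obtain m where m: "\<forall>i\<ge>m. symat (v i) p = Some a \<and> (\<forall>q. \<pi> i = Some q \<longrightarrow> \<not> prefix q p)"
        using some[OF Np] by blast
      obtain b where b: "m \<le> b" "\<pi> b \<noteq> None" using infinite by blast
      have "symat (?c i) p = Some a" if "(b, i) \<in> ?r" for i
      proof -
        have i: "m \<le> i" "\<pi> i \<noteq> None" using b that unfolding active_rel_iff by auto
        then show ?thesis using ctxt[of i p] m by auto
      qed
      then show ?thesis using b unfolding ev_sym_def by blast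
    qed
    show ?thesis
    proof (rule eq_by_symat)
      fix p a
      assume p: "symat N p = Some a"
      have "\<exists>b. ev_sym ?r ?I ?c q b" if "prefix q p" for q
        using symat_prefix[of N p q] p that ev[of q] by auto
      then show "symat (liminf_bot ?r ?I ?c) p = Some a" using L[of p a] ev[OF p] by blast
    next
      fix p
      assume p: "subt_at N p = Some Bot"
      have "\<not> ev_sym ?r ?I ?c p a" for a
      proof
        assume "ev_sym ?r ?I ?c p a"
        then obtain b where b: "\<pi> b \<noteq> None" "\<forall>i\<in>?I. (b, i) \<in> ?r \<longrightarrow> symat (?c i) p = Some a"
          unfolding ev_sym_def by blast
        have "\<exists>i\<ge>b. \<pi> i \<noteq> None \<and> symat (?c i) p = None"
          using bot[OF p]
        proof (elim disjE exE)
          assume "\<forall>b. \<exists>i\<ge>b. \<pi> i = Some p"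
          then obtain i where i: "b \<le> i" "\<pi> i = Some p" by blast
          then have "symat (?c i) p = None" using ctxt[of i p] by simp
          then show ?thesis using i by blast
        next
          fix m
          assume m: "\<forall>i\<ge>m. symat (v i) p = None"
          obtain i where i: "max b m \<le> i" "\<pi> i \<noteq> None" using infinite by blast
          then have "symat (?c i) p = None" using ctxt[of i p] m by simp
          then show ?thesis using i by (intro exI[of _ i]) auto
        qed
        then obtain i where "b \<le> i" "\<pi> i \<noteq> None" "symat (?c i) p = None" by blast
        then show False using b unfolding active_rel_iff by auto
      qed
      then have "symat (liminf_bot ?r ?I ?c) p \<noteq> Some a" for a using L[of p a] by blast
      then show "symat (liminf_bot ?r ?I ?c) p = None" using not_Some_eq by blast
    qed
  qed
  show ?thesis
    unfolding strongly_p_conv_def Let_def Field_active_rel active_rel_iff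
  proof (intro conjI impI ballI)
    show "well_order_on ?I ?r" using Well_order_active_rel[of \<pi>] unfolding Field_active_rel .
    show "N = v 0" if "?I = {}" using that by (intro ended) auto
    show "v i = v 0" if "i \<in> ?I" "\<forall>j\<in>?I. i \<le> j \<and> \<pi> i \<noteq> None \<and> \<pi> j \<noteq> None" for i
    proof (rule idle)
      show "\<forall>k. 0 \<le> k \<longrightarrow> k < i \<longrightarrow> \<pi> k = None"
      proof (intro allI impI, rule ccontr)
        fix k
        assume "k < i" "\<pi> k \<noteq> None"
        then show False using that(2) by auto
      qed
    qed simp
    fix i j
    assume "i \<in> ?I" "j \<in> ?I" and ij: "((i \<le> j \<and> \<pi> i \<noteq> None \<and> \<pi> j \<noteq> None) \<and> i \<noteq> j) \<and>
      \<not> (\<exists>k\<in>?I. ((i \<le> k \<and> \<pi> i \<noteq> None \<and> \<pi> k \<noteq> None) \<and> i \<noteq> k) \<and> (k \<le> j \<and> \<pi> k \<noteq> None \<and> \<pi> j \<noteq> None) \<and> k \<noteq> j)"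
    have "v j = v (Suc i)"
    proof (rule idle)
      show "Suc i \<le> j" using ij by auto
      show "\<forall>k. Suc i \<le> k \<longrightarrow> k < j \<longrightarrow> \<pi> k = None"
      proof (intro allI impI, rule ccontr)
        fix k
        assume k: "Suc i \<le> k" "k < j" "\<pi> k \<noteq> None"
        then have "i \<le> k" "k \<le> j" "i \<noteq> k" "k \<noteq> j" by simp_all
        then show False using ij k(3) by blast
      qed
    qed
    then show "rstep R (v i) ((the \<circ> \<pi>) i) (v j)" using step[of i] \<open>i \<in> ?I\<close> by simp
  next
    fix i
    assume i: "i \<in> ?I" "\<forall>j\<in>?I. j \<le> i \<and> \<pi> j \<noteq> None \<and> \<pi> i \<noteq> None"
    have "N = v (Suc i)"
    proof (rule ended)
      show "\<forall>k\<ge>Suc i. \<pi> k = None"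
      proof (intro allI impI, rule ccontr)
        fix k
        assume "Suc i \<le> k" "\<pi> k \<noteq> None"
        then show False using i(2) by auto
      qed
    qed
    then show "rstep R (v i) ((the \<circ> \<pi>) i) N" using step[of i] i by simp
  next
    fix l
    assume l: "l \<in> ?I" and lim: "(\<exists>i\<in>?I. (i \<le> l \<and> \<pi> i \<noteq> None \<and> \<pi> l \<noteq> None) \<and> i \<noteq> l) \<and>
      \<not> (\<exists>i\<in>?I. ((i \<le> l \<and> \<pi> i \<noteq> None \<and> \<pi> l \<noteq> None) \<and> i \<noteq> l) \<and>
        \<not> (\<exists>k\<in>?I. ((i \<le> k \<and> \<pi> i \<noteq> None \<and> \<pi> k \<noteq> None) \<and> i \<noteq> k) \<and> (k \<le> l \<and> \<pi> k \<noteq> None \<and> \<pi> l \<noteq> None) \<and> k \<noteq> l))"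
    \<comment> \<open>The greatest active index below \<open>l\<close> is its predecessor, so there
      are no limit indices.\<close>
    let ?A = "{i. \<pi> i \<noteq> None \<and> i < l}"
    have fin: "finite ?A" by simp
    moreover have ne: "?A \<noteq> {}" using lim by auto
    ultimately have "Max ?A \<in> ?A" by (rule Max_in)
    then obtain m where m: "m = Max ?A" "\<pi> m \<noteq> None" "m \<le> l" "m \<noteq> l" by auto
    then obtain k where k: "\<pi> k \<noteq> None" "m \<le> k" "m \<noteq> k" "k \<le> l" "k \<noteq> l" using lim l by blast
    then have "k \<le> Max ?A" using fin by (intro Max_ge) auto
    then have False using m(1) k by simp
    then show "v l = liminf_bot ?r {i \<in> ?I. (i \<le> l \<and> \<pi> i \<noteq> None \<and> \<pi> l \<noteq> None) \<and> i \<noteq> l} ?c"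
      by blast
  next
    assume op: "?I \<noteq> {} \<and> \<not> (\<exists>i\<in>?I. \<forall>j\<in>?I. j \<le> i \<and> \<pi> j \<noteq> None \<and> \<pi> i \<noteq> None)"
    have "infinite ?I"
    proof
      assume "finite ?I"
      then have "Max ?I \<in> ?I" "\<forall>j\<in>?I. j \<le> Max ?I" using op Max_in[of ?I] by simp_all
      then show False using op by blast
    qed
    then have "\<forall>i. \<exists>j\<ge>i. \<pi> j \<noteq> None" unfolding finite_nat_set_iff_bounded by (simp add: not_less) blast
    then show "N = liminf_bot ?r ?I ?c" by (rule liminf)
  qed
qed

lemma run_seq:
  "run t ps s \<Longrightarrow> \<exists>g. g 0 = t \<and> g (length ps) = s \<and> (\<forall>i<length ps. rstep R (g i) (ps ! i) (g (Suc i)))"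
proof (induction rule: run.induct)
  case (run_Nil t)
  then show ?case by auto
next
  case (run_Cons t p u ps s)
  then obtain g where "g 0 = u" "g (length ps) = s" "\<forall>i<length ps. rstep R (g i) (ps ! i) (g (Suc i))"
    by blast
  then show ?case using run_Cons.hyps
    by (intro exI[of _ "\<lambda>i. case i of 0 \<Rightarrow> t | Suc i \<Rightarrow> g i"]) (auto simp: nth_Cons split: nat.splits)
qed

text \<open>Concatenating the runs, with one idle time after each of them: time \<open>T n + j\<close> is step \<open>j\<close> of
  run \<open>n\<close>.\<close>

lemma flatten_runs:
  assumes "\<And>n. run (u n) (ps n) (u (Suc n))"
  shows "\<exists>v \<pi> T g. v 0 = u 0 \<and>
    (\<forall>i. case \<pi> i of None \<Rightarrow> v (Suc i) = v i | Some p \<Rightarrow> rstep R (v i) p (v (Suc i))) \<and>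
    (\<forall>n. n \<le> T n) \<and> (\<forall>m i. T m \<le> i \<longrightarrow> (\<exists>n\<ge>m. \<exists>j\<le>length (ps n). i = T n + j)) \<and>
    (\<forall>n j. j \<le> length (ps n) \<longrightarrow> v (T n + j) = g n j \<and>
      \<pi> (T n + j) = (if j < length (ps n) then Some (ps n ! j) else None)) \<and>
    (\<forall>n. g n 0 = u n) \<and> (\<forall>n j. j < length (ps n) \<longrightarrow> rstep R (g n j) (ps n ! j) (g n (Suc j)))"
proof -
  have "\<forall>n. \<exists>g. g 0 = u n \<and> g (length (ps n)) = u (Suc n) \<and>
      (\<forall>i<length (ps n). rstep R (g i) (ps n ! i) (g (Suc i)))"
    using run_seq[OF assms] by blast
  then obtain g where g: "\<And>n. g n 0 = u n" "\<And>n. g n (length (ps n)) = u (Suc n)"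
    "\<And>n i. i < length (ps n) \<Longrightarrow> rstep R (g n i) (ps n ! i) (g n (Suc i))" by metis
  define next_pos where "next_pos = (\<lambda>(n, j). if j < length (ps n) then (n, Suc j) else (Suc n, 0))"
  define st where "st i = (next_pos ^^ i) (0, 0)" for i
  \<comment> \<open>\<open>Suc\<close> counts the idle time, so even an empty run takes up time and
    \<open>n \<le> T n\<close> holds.\<close>
  define T where "T n = (\<Sum>k<n. Suc (length (ps k)))" for n
  define v where "v i = g (fst (st i)) (snd (st i))" for i
  define \<pi> where "\<pi> i = (if snd (st i) < length (ps (fst (st i))) then Some (ps (fst (st i)) ! snd (st i)) else None)" for i
  have st_T: "st (T n + j) = (n, j)" if "j \<le> length (ps n)" for n j
    using that
  proof (induction n arbitrary: j)
    case 0
    then show ?case by (induction j) (auto simp: st_def T_def next_pos_def)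
  next
    case (Suc n)
    have "st (T n + length (ps n)) = (n, length (ps n))" using Suc.IH by simp
    then have "st (Suc (T n + length (ps n))) = (Suc n, 0)" unfolding st_def next_pos_def by simp
    then have "st (T (Suc n)) = (Suc n, 0)" unfolding T_def by simp
    then show ?case using Suc.prems by (induction j) (auto simp: st_def next_pos_def)
  qed
  have cover: "\<exists>n j. j \<le> length (ps n) \<and> i = T n + j" for i
  proof (induction i)
    case 0
    then show ?case by (intro exI[of _ 0]) (simp add: T_def)
  next
    case (Suc i)
    then obtain n j where nj: "j \<le> length (ps n)" "i = T n + j" by blast
    show ?case
    proof (cases "j < length (ps n)")
      case True
      then show ?thesis using nj by (intro exI[of _ n] exI[of _ "Suc j"]) simp
    next
      case False
      then show ?thesis using nj by (intro exI[of _ "Suc n"] exI[of _ 0]) (simp add: T_def)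
    qed
  qed
  have mono: "T m \<le> T n" if "m \<le> n" for m n
    unfolding T_def using that by (intro sum_mono2) auto
  have v: "v (T n + j) = g n j" and \<pi>: "\<pi> (T n + j) = (if j < length (ps n) then Some (ps n ! j) else None)"
    if "j \<le> length (ps n)" for n j
    using st_T[OF that] unfolding v_def \<pi>_def by simp_all
  show ?thesis
  proof (intro exI[of _ v] exI[of _ \<pi>] exI[of _ T] exI[of _ g] conjI allI impI)
    show "v 0 = u 0" using v[of 0 0] g(1) by (simp add: T_def)
    show "case \<pi> i of None \<Rightarrow> v (Suc i) = v i | Some p \<Rightarrow> rstep R (v i) p (v (Suc i))" for i
    proof -
      obtain n j where nj: "j \<le> length (ps n)" "i = T n + j" using cover by blast
      show ?thesis
      proof (cases "j < length (ps n)")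
        case True
        then show ?thesis using nj v[of j n] v[of "Suc j" n] \<pi>[of j n] g(3) by simp
      next
        case False
        then have "Suc i = T (Suc n) + 0" using nj by (simp add: T_def)
        then have "v (Suc i) = u (Suc n)" using v[of 0 "Suc n"] g(1) by simp
        then show ?thesis using False nj v[of j n] \<pi>[of j n] g(2)[of n] by simp
      qed
    qed
    show "n \<le> T n" for n by (induction n) (auto simp: T_def)
    show "\<exists>n\<ge>m. \<exists>j\<le>length (ps n). i = T n + j" if Tm: "T m \<le> i" for m i
    proof -
      obtain n j where nj: "j \<le> length (ps n)" "i = T n + j" using cover by blast
      have "m \<le> n"
      proof (rule ccontr)
        assume "\<not> m \<le> n"
        then have "T (Suc n) \<le> T m" by (intro mono) simp
        then show False using nj Tm by (simp add: T_def)
      qed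
      then show ?thesis using nj by blast
    qed
  qed (use v \<pi> g in simp_all)
qed

theorem p_conv_NF: "\<exists>(q :: nat rel) us qs. strongly_p_conv R q us qs t (NF t)"
proof -
  \<comment> \<open>Round \<open>n\<close> has depth \<open>n\<close>, so every position is within
    the depth of all but finitely many rounds.\<close>
  have "\<exists>u. \<forall>n. (n = 0 \<longrightarrow> u n = t) \<and> (\<exists>ps. round n (u n) ps (u (Suc n)))"
  proof (rule dependent_nat_choice)
    show "\<exists>y. (Suc n = 0 \<longrightarrow> y = t) \<and> (\<exists>ps. round n x ps y)" for x n
      using round_exists[of n x] by blast
  qed simp
  then obtain u where u: "u 0 = t" "\<forall>n. \<exists>ps. round n (u n) ps (u (Suc n))" by metis
  then obtain ps where rounds: "\<And>n. round n (u n) (ps n) (u (Suc n))" by metis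
  have settles: "settles u ps (NF t) p" for p
    using rounds_settle[of 0 u ps p] rounds u(1) by simp
  obtain v \<pi> T g where v0: "v 0 = u 0"
    and steps: "\<forall>i. case \<pi> i of None \<Rightarrow> v (Suc i) = v i | Some p \<Rightarrow> rstep R (v i) p (v (Suc i))"
    and T: "\<forall>n. n \<le> T n" "\<forall>m i. T m \<le> i \<longrightarrow> (\<exists>n\<ge>m. \<exists>j\<le>length (ps n). i = T n + j)"
    and v\<pi>: "\<forall>n j. j \<le> length (ps n) \<longrightarrow> v (T n + j) = g n j \<and>
      \<pi> (T n + j) = (if j < length (ps n) then Some (ps n ! j) else None)"
    and g: "\<forall>n. g n 0 = u n" "\<forall>n j. j < length (ps n) \<longrightarrow> rstep R (g n j) (ps n ! j) (g n (Suc j))"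
    using flatten_runs[of u ps, OF round_run[OF rounds]] by (elim exE conjE)
  note T = T[rule_format] and g = g[rule_format]
  have v: "v (T n + j) = g n j" and \<pi>: "\<pi> (T n + j) = (if j < length (ps n) then Some (ps n ! j) else None)"
    if "j \<le> length (ps n)" for n j
    using v\<pi> that by blast+
  \<comment> \<open>If a round has no step at or above \<open>p\<close>, its intermediate terms keep
    the root at \<open>p\<close> too; this transfers the criterion from rounds to single
    steps.\<close>
  have const: "\<exists>w. subt_at (g n j) p = Some w \<and> root w = a"
    if "subt_at (u n) p = Some x" "root x = a" "\<forall>q\<in>set (ps n). \<not> prefix q p" "j \<le> length (ps n)" for n j p x a
    using that(4)
  proof (induction j)
    case 0
    then show ?case using g(1) that by simp
  next
    case (Suc j)
    then obtain w where w: "subt_at (g n j) p = Some w" "root w = a" by auto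
    have "\<not> prefix (ps n ! j) p" using that(3) Suc.prems by simp
    then have "\<not> strict_prefix (ps n ! j) p" "ps n ! j \<noteq> p" by auto
    then show ?case using rstep_at[OF g(2)[of j n] _ w(1)] Suc.prems w(2) by auto
  qed
  have "strongly_p_conv R (active_rel \<pi>) v (the \<circ> \<pi>) (v 0) (NF t)"
  proof (rule omega_conv)
    show "case \<pi> i of None \<Rightarrow> v (Suc i) = v i | Some p \<Rightarrow> rstep R (v i) p (v (Suc i))" for i
      using steps by blast
  next
    fix p a
    assume "symat (NF t) p = Some a"
    then obtain m where m: "\<forall>n\<ge>m. symat (u n) p = Some a \<and> (\<forall>q\<in>set (ps n). \<not> prefix q p)"
      using settles[of p] unfolding settles_def by blast
    have "symat (v i) p = Some a \<and> (\<forall>q. \<pi> i = Some q \<longrightarrow> \<not> prefix q p)" if i: "T m \<le> i" for i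
    proof -
      obtain n j where nj: "m \<le> n" "j \<le> length (ps n)" "i = T n + j" using T(2)[OF i] by blast
      then have n: "symat (u n) p = Some a" "\<forall>q\<in>set (ps n). \<not> prefix q p" using m by auto
      then obtain x where "subt_at (u n) p = Some x" "root x = Some a"
        unfolding symat_def by (auto split: option.splits)
      then obtain w where "subt_at (g n j) p = Some w" "root w = Some a" using const n nj by blast
      then have "symat (v i) p = Some a" using nj v symat_root by metis
      moreover have "\<not> prefix q p" if "\<pi> i = Some q" for q
      proof -
        have "q \<in> set (ps n)" using that nj \<pi>[OF nj(2)] by (auto split: if_splits)
        then show ?thesis using n by blast
      qed
      ultimately show ?thesis by blast
    qed
    then show "\<exists>m. \<forall>i\<ge>m. symat (v i) p = Some a \<and> (\<forall>q. \<pi> i = Some q \<longrightarrow> \<not> prefix q p)" by blast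
  next
    fix p
    assume "subt_at (NF t) p = Some Bot"
    then consider m where "\<forall>n\<ge>m. p \<in> set (ps n)"
      | m where "\<forall>n\<ge>m. subt_at (u n) p = Some Bot \<and> (\<forall>q\<in>set (ps n). \<not> prefix q p)"
      using settles[of p] unfolding settles_def by blast
    then show "(\<forall>b. \<exists>i\<ge>b. \<pi> i = Some p) \<or> (\<exists>m. \<forall>i\<ge>m. symat (v i) p = None)"
    proof cases
      case (1 m)
      have "\<exists>i\<ge>b. \<pi> i = Some p" for b
      proof -
        let ?n = "max m b"
        have "p \<in> set (ps ?n)" using 1 by simp
        then obtain j where "j < length (ps ?n)" "ps ?n ! j = p" by (auto simp: in_set_conv_nth)
        then have "\<pi> (T ?n + j) = Some p" using \<pi>[of j ?n] by simp
        moreover have "b \<le> T ?n + j" using T(1)[of ?n] by simp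
        ultimately show ?thesis by blast
      qed
      then show ?thesis by blast
    next
      case (2 m)
      have "symat (v i) p = None" if i: "T m \<le> i" for i
      proof -
        obtain n j where nj: "m \<le> n" "j \<le> length (ps n)" "i = T n + j" using T(2)[OF i] by blast
        then have n: "subt_at (u n) p = Some Bot" "\<forall>q\<in>set (ps n). \<not> prefix q p" using 2 by auto
        then obtain w where "subt_at (g n j) p = Some w" "root w = None"
          using const[of n p Bot None j] nj by auto
        then show ?thesis using nj v symat_root by metis
      qed
      then show ?thesis by blast
    qed
  qed
  then show ?thesis using v0 u(1) by metis
qed

end

theorem theorem6p13:
  fixes R :: "('f, 'v) trs" and r1 :: "'i rel" and r2 :: "'j rel"
  assumes "trs R" and "orthogonal R" and "left_finite R"
    and "strongly_p_conv R r1 ts1 ps1 t s1"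
    and "strongly_p_conv R r2 ts2 ps2 t s2"
  shows "\<exists>t' (q1 :: nat rel) us1 qs1 (q2 :: nat rel) us2 qs2.
           strongly_p_conv R q1 us1 qs1 s1 t' \<and> strongly_p_conv R q2 us2 qs2 s2 t'"
proof -
  interpret orthogonal_trs R by unfold_locales (fact assms)+
  interpret p1: p_reduction R r1 ts1 ps1 t s1 by unfold_locales (fact assms)
  interpret p2: p_reduction R r2 ts2 ps2 t s2 by unfold_locales (fact assms)
  have "NF s1 = NF t" "NF s2 = NF t"
    using NF_inf[OF p1.p_conv_inf] NF_inf[OF p2.p_conv_inf] by simp_all
  then show ?thesis using p_conv_NF[of s1] p_conv_NF[of s2] by metis
qed

end
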